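(* Let $K$ be a totally real number field of degree $d$, with ring of integers $O_K$. Let $b\in O_K\setminus\{0\}$ and let $F(X,Y)\in O_K[X,Y]$ be a binary form of degree $n\geq 2$. Let $a_0$ be the coefficient of $X^n$ in $F$, and assume $a_0\neq 0$. Suppose that $F(X,1)$ has a root $\alpha$ such that $K(\alpha)$ is a CM-field. Then every solution $(x,y)\in O_K^2$ of $F(x,y)=b$ satisfies $$H(x)<\Omega_1\quad\text{and}\quad H(y)<\Omega_2,$$ where $\Omega_1,\Omega_2$ are as follows. (i) If the coefficients of $X^n$ and of $Y^n$ in $F$ are both $\pm1$, then $$\Omega_1=\Omega_2=32\,H(b)^{1/n}H(F)^{1+1/n}|N_K(b)|^{2/d}.$$ (ii) If only the coefficient of $X^n$ is $\pm1$, then $$\Omega_1=2^9\,H(b)^{1/n}H(F)^{2+1/n}|N_K(b)|^{4/d},\qquad \Omega_2=32\,H(b)^{1/n}H(F)^{1+1/n}|N_K(b)|^{2/d}.$$ (iii) If both the coefficients of $X^n$ and of $Y^n$ are $\neq\pm1$, then $$\Omega_1=2^9\,H(b)^{1/n}H(\Gamma)^{2n+1}|N_K(b)|^{4/d}H(a_0)^{n-1}|N_K(a_0)|^{2(n-1)/d},$$ $$\Omega_2=32\,H(b)^{1/n}H(\Gamma)^{n+1}|N_K(b)|^{2/d}H(a_0)^{n-1}|N_K(a_0)|^{2(n-1)/d},$$ where $\Gamma$ is the point of projective space whose coordinates are $1$ together with the coefficients of $F(X,Y)$. Furthermore, the number of solutions $(x,y)\in O_K^2$ of $F(x,y)=b$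 is at most $72\cdot 4^{dn}|N_K(b)|^{2n}$. If $b$ is a unit of $O_K$, this number is at most $2wn$, where $w$ is the number of roots of unity in $K(\alpha)$.
   Context: A CM-field is a totally imaginary quadratic extension of a totally real number field. For a number field $L$, let $M(L)$ index the absolute values of $L$ extending the ordinary absolute value of $\mathbb{Q}$ and the $p$-adic absolute values $|\cdot|_p$ (normalized by $|p|_p=p^{-1}$) for all primes $p$; $d_v$ denotes the local degree of $v\in M(L)$. For $\mathbf{x}=(x_0:\dots:x_m)\in\mathbb{P}^m(L)$ the field height is $H_L(\mathbf{x})=\prod_{v\in M(L)}\max\{|x_0|_v,\dots,|x_m|_v\}^{d_v}$ and the absolute height is $H(\mathbf{x})=H_L(\mathbf{x})^{1/[L:\mathbb{Q}]}$ (independent of $L$). For $x\in L$, $H(x)=H((1:x))$. For a polynomial $G$, $H(G)$ is the absolute height of the projective point whose coordinates are the coefficients of $G$. $N_K$ denotes the norm from $K$ to $\mathbb{Q}$. *)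

theory Defs
  imports Complex_Main
    "HOL-Library.FuncSet"
    "HOL-Computational_Algebra.Computational_Algebra"
    "HOL-Algebra.Embedded_Algebras"
    "HOL-Algebra.Generated_Fields"
    "HOL-Algebra.QuotRing"
    "HOL-Algebra.Algebraic_Closure_Type"
begin

section \<open>Number fields\<close>

text \<open>Number fields are realised as subfields of the complex numbers.\<close>

abbreviation complex_ring :: "complex ring" where
  "complex_ring \<equiv> ring_of_type_algebra"

text \<open>The degree \<open>[L : K]\<close>; meaningful when \<open>K\<close> is a subfield and \<open>L\<close> is
  finite-dimensional over \<open>K\<close>.\<close>

definition field_degree :: "complex set \<Rightarrow> complex set \<Rightarrow> nat" where
  "field_degree K L = ring.dim complex_ring K L"

definition number_field :: "complex set \<Rightarrow> bool" where
  "number_field K \<longleftrightarrow> subfield K complex_ring \<and> ring.finite_dimension complex_ring \<rat> K"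

definition ring_of_ints :: "complex set \<Rightarrow> complex set" where
  "ring_of_ints K = {x \<in> K. algebraic_int x}"

text \<open>The field embeddings of \<open>K\<close> into the complex numbers. Extensionality makes two embeddings
  equal as soon as they agree on \<open>K\<close>.\<close>

definition field_embeddings :: "complex set \<Rightarrow> (complex \<Rightarrow> complex) set" where
  "field_embeddings K =
     {\<sigma> \<in> ring_hom (complex_ring\<lparr>carrier := K\<rparr>) complex_ring. \<sigma> \<in> extensional K}"

definition field_norm :: "complex set \<Rightarrow> complex \<Rightarrow> complex" where
  "field_norm K x = (\<Prod>\<sigma>\<in>field_embeddings K. \<sigma> x)"

definition totally_real :: "complex set \<Rightarrow> bool" where
  "totally_real K \<longleftrightarrow> (\<forall>\<sigma>\<in>field_embeddings K. \<sigma> ` K \<subseteq> \<real>)"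

definition totally_imaginary :: "complex set \<Rightarrow> bool" where
  "totally_imaginary K \<longleftrightarrow> (\<forall>\<sigma>\<in>field_embeddings K. \<not> \<sigma> ` K \<subseteq> \<real>)"

definition CM_field :: "complex set \<Rightarrow> bool" where
  "CM_field L \<longleftrightarrow> number_field L \<and> totally_imaginary L \<and>
     (\<exists>L0. number_field L0 \<and> totally_real L0 \<and> L0 \<subseteq> L \<and>
       ring.finite_dimension complex_ring L0 L \<and> field_degree L0 L = 2)"

definition adjoin :: "complex set \<Rightarrow> complex \<Rightarrow> complex set" where
  "adjoin K \<alpha> = generate_field complex_ring (insert \<alpha> K)"

definition roots_of_unity :: "complex set \<Rightarrow> complex set" where
  "roots_of_unity L = {z \<in> L. \<exists>m>0. z ^ m = 1}"

section \<open>Absolute values and local degrees\<close>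

definition padic_abs :: "nat \<Rightarrow> rat \<Rightarrow> real" where
  "padic_abs p q =
     (if q = 0 then 0
      else case quotient_of q of (r, s) \<Rightarrow>
        real p powi (int (Factorial_Ring.multiplicity (int p) s)
                   - int (Factorial_Ring.multiplicity (int p) r)))"

definition absolute_value :: "complex set \<Rightarrow> (complex \<Rightarrow> real) \<Rightarrow> bool" where
  "absolute_value L v \<longleftrightarrow> v \<in> extensional L \<and>
     (\<forall>x\<in>L. 0 \<le> v x \<and> (v x = 0 \<longleftrightarrow> x = 0)) \<and>
     (\<forall>x\<in>L. \<forall>y\<in>L. v (x * y) = v x * v y \<and> v (x + y) \<le> v x + v y)"

text \<open>The set \<open>M(L)\<close>. Its archimedean members extend the ordinary absolute value itself; the
  local degrees enter only as exponents in the height.\<close>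

definition abs_values :: "complex set \<Rightarrow> (complex \<Rightarrow> real) set" where
  "abs_values L = {v. absolute_value L v \<and>
     ((\<forall>q::rat. v (of_rat q) = of_rat \<bar>q\<bar>) \<or>
      (\<exists>p::nat. Factorial_Ring.prime p \<and> (\<forall>q::rat. v (of_rat q) = padic_abs p q)))}"

text \<open>The completion \<open>L\<^sub>v\<close> is the ring of \<open>v\<close>-Cauchy sequences in \<open>L\<close> modulo the null
  sequences; the completion of the rationals sits in it as the set of classes of rational
  Cauchy sequences.\<close>

definition cauchy_seqs :: "complex set \<Rightarrow> (complex \<Rightarrow> real) \<Rightarrow> (nat \<Rightarrow> complex) set" where
  "cauchy_seqs L v =
     {s. range s \<subseteq> L \<and> (\<forall>e>0. \<exists>N. \<forall>m\<ge>N. \<forall>n\<ge>N. v (s m - s n) < e)}"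

definition cauchy_ring :: "complex set \<Rightarrow> (complex \<Rightarrow> real) \<Rightarrow> (nat \<Rightarrow> complex) ring" where
  "cauchy_ring L v =
     \<lparr>carrier = cauchy_seqs L v, monoid.mult = (\<lambda>s t n. s n * t n), one = (\<lambda>n. 1),
      ring.zero = (\<lambda>n. 0), add = (\<lambda>s t n. s n + t n)\<rparr>"

definition null_seqs :: "complex set \<Rightarrow> (complex \<Rightarrow> real) \<Rightarrow> (nat \<Rightarrow> complex) set" where
  "null_seqs L v = {s \<in> cauchy_seqs L v. (\<lambda>n. v (s n)) \<longlonglongrightarrow> 0}"

definition completion :: "complex set \<Rightarrow> (complex \<Rightarrow> real) \<Rightarrow> (nat \<Rightarrow> complex) set ring" where
  "completion L v = cauchy_ring L v Quot null_seqs L v"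

definition rat_completion :: "complex set \<Rightarrow> (complex \<Rightarrow> real) \<Rightarrow> (nat \<Rightarrow> complex) set set" where
  "rat_completion L v =
     (\<lambda>s. null_seqs L v +>\<^bsub>cauchy_ring L v\<^esub> s) ` {s \<in> cauchy_seqs L v. range s \<subseteq> \<rat>}"

definition local_degree :: "complex set \<Rightarrow> (complex \<Rightarrow> real) \<Rightarrow> nat" where
  "local_degree L v =
     ring.dim (completion L v) (rat_completion L v) (carrier (completion L v))"

section \<open>Heights\<close>

text \<open>A point of projective space over \<open>L\<close> is given by a list of coordinates in \<open>L\<close>, not all
  zero. The product over \<open>M(L)\<close> has only finitely many factors different from \<open>1\<close>, and
  \<^const>\<open>prod'\<close> is the product over these.\<close>

definition field_height :: "complex set \<Rightarrow> complex list \<Rightarrow> real" where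
  "field_height L xs = prod' (\<lambda>v. Max (v ` set xs) ^ local_degree L v) (abs_values L)"

text \<open>The absolute height does not depend on the number field \<open>L\<close> containing the coordinates.\<close>

definition height :: "complex set \<Rightarrow> complex list \<Rightarrow> real" where
  "height L xs = field_height L xs powr (1 / real (field_degree \<rat> L))"

definition elem_height :: "complex set \<Rightarrow> complex \<Rightarrow> real" where
  "elem_height L x = height L [1, x]"

section \<open>Binary forms\<close>

text \<open>A binary form of degree \<open>n\<close> is given by its coefficients \<open>a 0, \<dots>, a n\<close>, where \<open>a i\<close>
  belongs to \<open>X\<^sup>n\<^sup>-\<^sup>i Y\<^sup>i\<close>; values of \<open>a\<close> beyond \<open>n\<close> play no role.\<close>

definition binary_form :: "nat \<Rightarrow> (nat \<Rightarrow> complex) \<Rightarrow> complex \<Rightarrow> complex \<Rightarrow> complex" where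
  "binary_form n a x y = (\<Sum>i\<le>n. a i * x ^ (n - i) * y ^ i)"

definition form_coeffs :: "nat \<Rightarrow> (nat \<Rightarrow> complex) \<Rightarrow> complex list" where
  "form_coeffs n a = map a [0..<Suc n]"

definition form_solutions ::
    "complex set \<Rightarrow> nat \<Rightarrow> (nat \<Rightarrow> complex) \<Rightarrow> complex \<Rightarrow> (complex \<times> complex) set" where
  "form_solutions K n a b =
     {(x, y). x \<in> ring_of_ints K \<and> y \<in> ring_of_ints K \<and> binary_form n a x y = b}"

end

(* For a solution (x, y) put delta = x - alpha y and epsilon = delta / cnj delta. In a CM-field complex
   conjugation commutes with every embedding, so all conjugates of epsilon lie on the unit circle, while
   delta divides b up to a controlled denominator. Since y is real, x V = y U with U = alpha - epsilon cnj alpha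
   and V = 1 - epsilon, whence y^n F(U, V) = b V^n and x^n F(U, V) = b U^n. The conjugates of F(U, V) are
   bounded above, and (a_0 b)^n F(U, V) is a nonzero algebraic integer, whose norm is at least 1; multiplying
   over all embeddings bounds the product of the max(1, |x|)^n and of the max(1, |y|)^n, that is, the heights.

   All points whose heights occur are integral with a coordinate 1 or -1, so that the finite places contribute
   nothing to their heights.

   Counting: if (x, y) and (x', y') are congruent modulo b, the quotient of their deltas is a unit, and the
   quotient of their epsilons is a root of unity by Kronecker's theorem; equal epsilons mean (x', y') = +-(x, y).
   Hence there are at most N(b)^2 * 2w solutions, and at most 2w if b is a unit. *)

theory Submission
  imports Defs "Jordan_Normal_Form.Char_Poly"
begin

section \<open>Algebraic integers\<close>

text \<open>The quotient \<epsilon> determines the ratio x : y = U : V, and F(U, V) then fixes the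
  scale, y^n = b V^n / F(U, V). A solution is large at an embedding only where F(U, V) is small
  there, and a lower bound for a norm forbids this on average. Since \<alpha> need not be integral,
  integrality rests on the cofactor G of X - \<alpha> Y in F: both G(x, y) and \<alpha> G(x, y) are
  integral, and b = \<delta> G(x, y). The power a_0^n spent on clearing denominators is recovered
  from Cauchy's root bound for \<alpha>, so that a_0 enters the estimate only through H(\<Gamma>).
  One estimate, 8 H(b)^(1/n) H(\<Gamma>)^(1 + 1/n) |N(b)|^(1/d), serves both coordinates and all
  three cases. If y = 0, then V = 0 and y^n F(U, V) = b V^n says nothing, so a_0 x^n = b is used
  directly.

  Heights are products over all absolute values, with local degrees taken from completions. They
  turn into products over embeddings only after the archimedean absolute values of K are shown to be
  those of the embeddings, each with completion \<real>.\<close>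

definition int_span :: "'a::field_char_0 set \<Rightarrow> 'a set" where
  "int_span B = {z. \<exists>f::'a \<Rightarrow> int. z = (\<Sum>b\<in>B. of_int (f b) * b)}"

text \<open>The multiplier ring of the \<int>-module spanned by \<open>B\<close>. When
  \<open>B\<close> is finite and has a nonzero element, this ring consists of algebraic integers.
  Since it is closed under sums and products, so are the algebraic integers, once any two of them
  lie in one such ring.\<close>

definition int_stable :: "'a::field_char_0 set \<Rightarrow> 'a set" where
  "int_stable B = {z. \<forall>b\<in>B. z * b \<in> int_span B}"

lemma int_span_add: "x \<in> int_span B \<Longrightarrow> y \<in> int_span B \<Longrightarrow> x + y \<in> int_span B"
  unfolding int_span_def
  by (auto, rule_tac x="\<lambda>b. f b + fa b" in exI) (simp add: sum.distrib algebra_simps)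

lemma int_span_scale: "x \<in> int_span B \<Longrightarrow> of_int k * x \<in> int_span B"
  unfolding int_span_def
  by (auto, rule_tac x="\<lambda>b. k * f b" in exI) (simp add: sum_distrib_left mult.assoc)

lemma int_span_0: "0 \<in> int_span B"
  unfolding int_span_def by (auto intro!: exI[of _ "\<lambda>_. 0"])

lemma int_span_uminus: "x \<in> int_span B \<Longrightarrow> - x \<in> int_span B"
  using int_span_scale[of x B "-1"] by simp

lemma int_span_sum: "(\<And>i. i \<in> I \<Longrightarrow> g i \<in> int_span B) \<Longrightarrow> (\<Sum>i\<in>I. g i) \<in> int_span B"
  by (induction I rule: infinite_finite_induct) (auto simp: int_span_0 int_span_add)

lemma int_span_base: "finite B \<Longrightarrow> b \<in> B \<Longrightarrow> b \<in> int_span B"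
  unfolding int_span_def
  by (auto intro!: exI[of _ "\<lambda>c. if c = b then 1 else 0"] simp: if_distrib if_distribR cong: if_cong)

lemma int_stable_int_span: "x \<in> int_stable B \<Longrightarrow> z \<in> int_span B \<Longrightarrow> x * z \<in> int_span B"
proof -
  assume x: "x \<in> int_stable B" and "z \<in> int_span B"
  then obtain f :: "'a \<Rightarrow> int" where z: "z = (\<Sum>b\<in>B. of_int (f b) * b)"
    unfolding int_span_def by auto
  have "x * z = (\<Sum>b\<in>B. of_int (f b) * (x * b))"
    unfolding z by (simp add: sum_distrib_left mult_ac)
  also have "\<dots> \<in> int_span B"
    using x by (intro int_span_sum int_span_scale) (auto simp: int_stable_def)
  finally show ?thesis .
qed

lemma int_stable_mult: "x \<in> int_stable B \<Longrightarrow> y \<in> int_stable B \<Longrightarrow> x * y \<in> int_stable B"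
  using int_stable_int_span[of x B] by (auto simp: int_stable_def mult.assoc)

lemma int_stable_add: "x \<in> int_stable B \<Longrightarrow> y \<in> int_stable B \<Longrightarrow> x + y \<in> int_stable B"
  by (auto simp: int_stable_def ring_distribs int_span_add)

lemma int_stable_Ints: "finite B \<Longrightarrow> x \<in> \<int> \<Longrightarrow> x \<in> int_stable B"
  by (auto simp: int_stable_def int_span_scale int_span_base elim!: Ints_cases)

text \<open>An element stabilising a finitely generated module is an eigenvalue of an integer matrix.\<close>

lemma int_stable_algebraic_int:
  assumes B: "finite B" and b0: "b0 \<in> B" "b0 \<noteq> 0" and z: "z \<in> int_stable B"
  shows "algebraic_int z"
proof -
  obtain bs where bs: "set bs = B" "distinct bs" using finite_distinct_list[OF B] by auto
  define n where "n = length bs"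
  have "\<forall>b\<in>B. \<exists>f::'a \<Rightarrow> int. z * b = (\<Sum>c\<in>B. of_int (f c) * c)"
    using z by (auto simp: int_stable_def int_span_def)
  then obtain f :: "'a \<Rightarrow> 'a \<Rightarrow> int"
    where f: "\<And>b. b \<in> B \<Longrightarrow> z * b = (\<Sum>c\<in>B. of_int (f b c) * c)" by metis
  define M where "M = mat n n (\<lambda>(i,j). f (bs ! i) (bs ! j))"
  have M: "M \<in> carrier_mat n n" by (simp add: M_def)
  have hM: "map_mat of_int M \<in> carrier_mat n n" using M by simp
  define v where "v = vec n (\<lambda>i. bs ! i)"
  have "eigenvector (map_mat of_int M) v z"
    unfolding eigenvector_def
  proof (intro conjI)
    show "v \<in> carrier_vec (dim_row (map_mat of_int M))" using M by (simp add: v_def)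
    obtain i where i: "i < n" "bs ! i = b0"
      using b0 bs by (metis in_set_conv_nth n_def)
    then have "v $ i \<noteq> 0\<^sub>v n $ i" using b0 by (simp add: v_def)
    then show "v \<noteq> 0\<^sub>v (dim_row (map_mat of_int M))" using M by auto
    show "map_mat of_int M *\<^sub>v v = z \<cdot>\<^sub>v v"
    proof (rule eq_vecI)
      fix i assume "i < dim_vec (z \<cdot>\<^sub>v v)"
      then have i: "i < n" by (simp add: v_def)
      have "(map_mat of_int M *\<^sub>v v) $ i = (\<Sum>j<n. of_int (f (bs ! i) (bs ! j)) * bs ! j)"
        using i M by (simp add: v_def scalar_prod_def M_def atLeast0LessThan)
      also have "\<dots> = (\<Sum>c\<in>B. of_int (f (bs ! i) c) * c)"
        using bs by (intro sum.reindex_bij_betw bij_betw_nth) (auto simp: n_def)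
      also have "\<dots> = z * bs ! i"
        using f[of "bs ! i"] i bs by (auto simp: n_def)
      finally show "(map_mat of_int M *\<^sub>v v) $ i = (z \<cdot>\<^sub>v v) $ i"
        using i by (simp add: v_def)
    qed (use M in \<open>simp add: v_def\<close>)
  qed
  then have "poly (char_poly (map_mat of_int M)) z = 0"
    using eigenvalue_root_char_poly[OF hM] by (auto simp: eigenvalue_def)
  then have "poly (map_poly of_int (char_poly M)) z = 0"
    by (simp add: of_int_hom.char_poly_hom[OF M])
  moreover have "lead_coeff (char_poly M) = 1"
    using degree_monic_char_poly[OF M] by simp
  ultimately show ?thesis unfolding algebraic_int_altdef_ipoly by blast
qed

text \<open>The powers of \<alpha> below \<open>degree p\<close>, multiplied into \<open>B\<close>,
  span a module stable under \<alpha>: the first power that leaves the list is rewritten by the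
  monic \<open>p\<close>, whose coefficients stabilise the old module. The inclusion for
  \<open>B'\<close> is recorded so that the generators can later be placed inside a given
  field.\<close>

lemma int_stable_extend:
  assumes B: "finite B" "1 \<in> B" and p: "lead_coeff p = 1" "poly p \<alpha> = 0"
    and coeffs: "\<And>i. coeff p i \<in> int_stable B"
  shows "\<exists>B'. finite B' \<and> 1 \<in> B' \<and> B' \<subseteq> {\<alpha> ^ i * b |i b. b \<in> B} \<and>
    int_stable B \<subseteq> int_stable B' \<and> \<alpha> \<in> int_stable B'"
proof -
  define n where "n = degree p"
  have n: "n > 0" using p by (auto simp: n_def intro!: Nat.gr0I elim!: degree_eq_zeroE)
  define B' where "B' = (\<lambda>(i,b). \<alpha> ^ i * b) ` ({..<n} \<times> B)"
  have fin: "finite B'" using B by (simp add: B'_def)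
  have base: "\<alpha> ^ i * b \<in> int_span B'" if "i < n" "b \<in> B" for i b
    by (rule int_span_base[OF fin]) (use that in \<open>auto simp: B'_def\<close>)
  have shift: "\<alpha> ^ i * z \<in> int_span B'" if i: "i < n" and "z \<in> int_span B" for i z
  proof -
    from that obtain f :: "'a \<Rightarrow> int" where z: "z = (\<Sum>b\<in>B. of_int (f b) * b)"
      unfolding int_span_def by auto
    have "\<alpha> ^ i * z = (\<Sum>b\<in>B. of_int (f b) * (\<alpha> ^ i * b))"
      unfolding z by (simp add: sum_distrib_left mult_ac)
    also have "\<dots> \<in> int_span B'" using i by (intro int_span_sum int_span_scale base) auto
    finally show ?thesis .
  qed
  have "1 \<in> B'" using n B by (auto simp: B'_def intro!: image_eqI[of _ _ "(0, 1)"])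
  moreover have "int_stable B \<subseteq> int_stable B'"
  proof
    fix x assume x: "x \<in> int_stable B"
    have "x * (\<alpha> ^ i * b) \<in> int_span B'" if "i < n" "b \<in> B" for i b
      using shift[OF that(1), of "x * b"] x that by (auto simp: int_stable_def mult_ac)
    then show "x \<in> int_stable B'" by (auto simp: int_stable_def B'_def)
  qed
  moreover have "\<alpha> * (\<alpha> ^ i * b) \<in> int_span B'" if i: "i < n" and b: "b \<in> B" for i b
  proof (cases "Suc i < n")
    case True
    then show ?thesis using base[OF True b] by (simp add: mult.assoc)
  next
    case False
    then have "Suc i = n" using i by simp
    then have "\<alpha> * (\<alpha> ^ i * b) = \<alpha> ^ n * b" by (auto simp: mult.assoc)
    also have "\<alpha> ^ n = - (\<Sum>j<n. coeff p j * \<alpha> ^ j)"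
      using p by (simp add: poly_altdef n_def lessThan_Suc_atMost[symmetric] eq_neg_iff_add_eq_0 add.commute)
    also have "\<dots> * b = - (\<Sum>j<n. \<alpha> ^ j * (coeff p j * b))"
      by (simp add: sum_distrib_left mult_ac)
    also have "\<dots> \<in> int_span B'"
      using coeffs b by (intro int_span_uminus int_span_sum shift) (auto simp: int_stable_def)
    finally show ?thesis .
  qed
  then have "\<alpha> \<in> int_stable B'" by (auto simp: int_stable_def B'_def)
  moreover have "B' \<subseteq> {\<alpha> ^ i * b |i b. b \<in> B}" by (auto simp: B'_def)
  ultimately show ?thesis using fin by blast
qed

lemma algebraic_ints_int_stable:
  assumes "finite S" "\<And>x. x \<in> S \<Longrightarrow> algebraic_int x"
  shows "\<exists>B. finite B \<and> 1 \<in> B \<and> S \<subseteq> int_stable B"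
  using assms
proof (induction S rule: finite_induct)
  case empty
  then show ?case by (intro exI[of _ "{1}"]) auto
next
  case (insert x S)
  then obtain B where B: "finite B" "1 \<in> B" "S \<subseteq> int_stable B" by auto
  obtain p where p: "lead_coeff p = 1" "\<forall>i. coeff p i \<in> \<int>" "poly p x = 0"
    using insert.prems[of x] by (auto elim: algebraic_int.cases)
  obtain B' where "finite B'" "1 \<in> B'" "int_stable B \<subseteq> int_stable B'" "x \<in> int_stable B'"
    using int_stable_extend[OF B(1,2) p(1,3)] int_stable_Ints[OF B(1)] p(2) by blast
  then show ?case using B by blast
qed

text \<open>The finitely many coefficients stabilise one finitely generated module, and adjoining
  powers of \<open>x\<close> keeps it finitely generated. Zero is added to the set for the
  coefficients beyond the degree.\<close>

lemma algebraic_int_integral_closure: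
  assumes "lead_coeff p = 1" "\<And>i. algebraic_int (coeff p i)" "poly p x = 0"
  shows "algebraic_int (x :: 'a :: field_char_0)"
proof -
  have "finite (coeff p ` {..degree p} \<union> {0})" by simp
  then obtain B where B: "finite B" "1 \<in> B" "coeff p ` {..degree p} \<union> {0} \<subseteq> int_stable B"
    using algebraic_ints_int_stable[of "coeff p ` {..degree p} \<union> {0}"] assms(2) by auto
  have "coeff p i \<in> int_stable B" for i
    using B(3) by (cases "i \<le> degree p") (auto simp: coeff_eq_0)
  from int_stable_extend[OF B(1,2) assms(1,3) this] show ?thesis
    using int_stable_algebraic_int by (metis zero_neq_one)
qed

lemma algebraic_int_add [intro]:
  "algebraic_int x \<Longrightarrow> algebraic_int y \<Longrightarrow> algebraic_int (x + y :: 'a :: field_char_0)"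
  and algebraic_int_times [intro]:
  "algebraic_int x \<Longrightarrow> algebraic_int y \<Longrightarrow> algebraic_int (x * y :: 'a :: field_char_0)"
proof -
  assume "algebraic_int x" "algebraic_int y"
  then obtain B where B: "finite B" "1 \<in> B" "{x,y} \<subseteq> int_stable B"
    using algebraic_ints_int_stable[of "{x,y}"] by auto
  then show "algebraic_int (x + y)" "algebraic_int (x * y)"
    using int_stable_add[of x B y] int_stable_mult[of x B y]
    by (auto intro!: int_stable_algebraic_int[OF B(1,2)])
qed

lemma algebraic_int_diff [intro]:
  "algebraic_int x \<Longrightarrow> algebraic_int y \<Longrightarrow> algebraic_int (x - y :: 'a :: field_char_0)"
  using algebraic_int_add[of x "-y"] by auto

lemma algebraic_int_sum [intro]:
  "(\<And>i. i \<in> I \<Longrightarrow> algebraic_int (f i)) \<Longrightarrow> algebraic_int (\<Sum>i\<in>I. f i :: 'a :: field_char_0)"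
  by (induction I rule: infinite_finite_induct) auto

lemma algebraic_int_prod [intro]:
  "(\<And>i. i \<in> I \<Longrightarrow> algebraic_int (f i)) \<Longrightarrow> algebraic_int (\<Prod>i\<in>I. f i :: 'a :: field_char_0)"
  by (induction I rule: infinite_finite_induct) auto

lemma algebraic_int_power [intro]:
  "algebraic_int x \<Longrightarrow> algebraic_int (x ^ n :: 'a :: field_char_0)"
  by (induction n) auto

lemma coeff_sum_monom: "coeff (\<Sum>i<n. monom (f i) i) j = (if j < n then f j else 0)"
  by (simp add: coeff_sum)

text \<open>With \<open>c\<close> the leading coefficient and \<open>n\<close> the degree,
  \<open>c ^ (n - 1) * poly p x\<close> is a monic polynomial in \<open>c * x\<close> with integral
  coefficients.\<close>

lemma algebraic_int_lead_coeff_times_root: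
  fixes x :: "'a :: field_char_0"
  assumes "\<And>i. algebraic_int (coeff p i)" "poly p x = 0"
  shows "algebraic_int (lead_coeff p * x)"
proof (cases "degree p = 0 \<or> p = 0")
  case True
  then show ?thesis using assms(2) by (auto elim!: degree_eq_zeroE)
next
  case False
  define n where "n = degree p"
  define c where "c = lead_coeff p"
  have n: "n > 0" and c: "c \<noteq> 0" using False by (auto simp: n_def c_def)
  define q where "q = monom 1 n + (\<Sum>i<n. monom (coeff p i * c ^ (n - 1 - i)) i)"
  have cq: "coeff q i = (if i = n then 1 else if i < n then coeff p i * c ^ (n - 1 - i) else 0)" for i
    by (simp add: q_def coeff_sum_monom)
  have deg: "degree q = n"
    by (rule antisym; rule degree_le le_degree) (auto simp: cq)
  have "poly q (c * x) = (c * x) ^ n + (\<Sum>i<n. coeff p i * c ^ (n - 1 - i) * (c * x) ^ i)"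
    by (simp add: q_def poly_monom poly_sum)
  also have "(\<Sum>i<n. coeff p i * c ^ (n - 1 - i) * (c * x) ^ i)
      = (\<Sum>i<n. c ^ (n - 1) * (coeff p i * x ^ i))"
  proof (intro sum.cong refl)
    fix i assume "i \<in> {..<n}"
    then have "c ^ (n - 1) = c ^ (n - 1 - i) * c ^ i" by (simp flip: power_add)
    then show "coeff p i * c ^ (n - 1 - i) * (c * x) ^ i = c ^ (n - 1) * (coeff p i * x ^ i)"
      by (simp add: power_mult_distrib mult_ac)
  qed
  also have "(c * x) ^ n = c ^ (n - 1) * (coeff p n * x ^ n)"
    using n by (cases n) (auto simp: c_def n_def power_mult_distrib mult_ac)
  also have "c ^ (n - 1) * (coeff p n * x ^ n) + (\<Sum>i<n. c ^ (n - 1) * (coeff p i * x ^ i))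
     = c ^ (n - 1) * poly p x"
    by (simp add: poly_altdef n_def lessThan_Suc_atMost[symmetric] sum_distrib_left ring_distribs)
  finally have "poly q (c * x) = 0" using assms(2) by simp
  moreover have "lead_coeff q = 1" by (simp add: deg cq)
  moreover have "algebraic_int (coeff q i)" for i
    using assms(1) by (auto simp: cq c_def)
  ultimately show ?thesis using algebraic_int_integral_closure c_def by blast
qed

text \<open>The numbers \<open>c\<^sub>k = a\<^sub>0\<alpha>\<^sup>k + \<dots> + a\<^sub>k\<close> are the coefficients of the cofactor of \<open>X - \<alpha>\<close>; the step
  is that \<open>c\<^sub>k \<alpha>\<close> is integral because \<open>\<alpha>\<close> is a root of \<open>c\<^sub>k X\<^sup>n\<^sup>-\<^sup>k + a\<^sub>k\<^sub>+\<^sub>1 X\<^sup>n\<^sup>-\<^sup>k\<^sup>-\<^sup>1 + \<dots>\<close>.\<close>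

lemma algebraic_int_horner:
  fixes x :: "'a :: field_char_0"
  assumes a: "\<And>i. i \<le> n \<Longrightarrow> algebraic_int (a i)" and root: "(\<Sum>i\<le>n. a i * x ^ (n - i)) = 0"
    and k: "k \<le> n"
  shows "algebraic_int (\<Sum>i\<le>k. a i * x ^ (k - i)) \<and> algebraic_int (x * (\<Sum>i\<le>k. a i * x ^ (k - i)))"
  using k
proof (induction k)
  case 0
  define p where "p = (\<Sum>i\<le>n. monom (a i) (n - i))"
  have cp: "coeff p j = (if j \<le> n then a (n - j) else 0)" for j
  proof -
    have "coeff p j = (\<Sum>i\<le>n. if i = n - j \<and> j \<le> n then a i else 0)"
      unfolding p_def coeff_sum by (intro sum.cong) auto
    then show ?thesis by (auto)
  qed
  have "poly p x = 0" using root by (simp add: p_def poly_sum poly_monom)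
  have "algebraic_int (x * a 0)"
  proof (cases "a 0 = 0")
    case False
    have "degree p = n" by (rule antisym; rule degree_le le_degree) (auto simp: cp False)
    then show ?thesis
      using algebraic_int_lead_coeff_times_root[of p x] \<open>poly p x = 0\<close> a
      by (auto simp: cp mult.commute)
  qed auto
  then show ?case using a by simp
next
  case (Suc k)
  define c where "c = (\<lambda>k. \<Sum>i\<le>k. a i * x ^ (k - i))"
  have step: "c (Suc k) = x * c k + a (Suc k)" for k
    by (simp add: c_def sum_distrib_left Suc_diff_le mult_ac)
  have ck: "algebraic_int (x * c k)" using Suc by (simp add: c_def)
  have int: "algebraic_int (c (Suc k))" 
    unfolding step using ck Suc.prems a[of "Suc k"] by (intro algebraic_int_add) auto
  define m where "m = n - Suc k"
  define p where "p = monom (c (Suc k)) m + (\<Sum>i<m. monom (a (n - i)) i)"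
  have cp: "coeff p j = (if j = m then c (Suc k) else if j < m then a (n - j) else 0)" for j
    by (simp add: p_def coeff_sum_monom)
  \<comment> \<open>Unrolls the recursion \<open>step\<close> by \<open>j\<close> further terms. For
    \<open>j = m\<close> it reaches \<open>c n = 0\<close>, so \<open>x\<close> is a root of
    \<open>p\<close>, whose leading coefficient is \<open>c (Suc k)\<close> unless that
    vanishes.\<close>
  have tele: "c (Suc k + j) = c (Suc k) * x ^ j + (\<Sum>i<j. a (Suc k + j - i) * x ^ i)" for j
  proof (induction j)
    case (Suc j)
    have "(\<Sum>i<Suc j. a (Suc k + Suc j - i) * x ^ i)
        = a (Suc k + Suc j) + (\<Sum>i<j. a (Suc k + j - i) * x ^ Suc i)"
      unfolding sum.lessThan_Suc_shift by simp
    also have "(\<Sum>i<j. a (Suc k + j - i) * x ^ Suc i) = x * (\<Sum>i<j. a (Suc k + j - i) * x ^ i)"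
      by (simp add: sum_distrib_left mult_ac)
    also have "\<dots> = x * (c (Suc k + j) - c (Suc k) * x ^ j)" by (simp only: Suc) simp
    finally show ?case using step[of "Suc k + j"] by (simp add: algebra_simps)
  qed simp
  have "Suc k + m = n" using Suc.prems by (simp add: m_def)
  then have "poly p x = c n"
    using tele[of m] by (simp add: p_def poly_sum poly_monom)
  also have "\<dots> = 0" using root by (simp add: c_def)
  finally have p0: "poly p x = 0" .
  have "algebraic_int (x * c (Suc k))"
  proof (cases "c (Suc k) = 0")
    case False
    have "degree p = m" by (rule antisym; rule degree_le le_degree) (auto simp: cp False)
    then show ?thesis
      using algebraic_int_lead_coeff_times_root[of p x] p0 int a
      by (auto simp: cp mult.commute)
  qed auto
  with int show ?case by (simp add: c_def)
qed

section \<open>Subfields of the complex numbers and their embeddings\<close>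

interpretation CR: ring complex_ring
  by (rule ring_from_type_algebra)

lemma field_complex_ring: "field complex_ring"
  by (rule field_from_type_algebra)

lemma cring_complex_ring: "cring complex_ring"
  by (rule cring_from_type_algebra)

lemma complex_ring_simps [simp]:
  "carrier complex_ring = UNIV" "x \<otimes>\<^bsub>complex_ring\<^esub> y = x * y" "x \<oplus>\<^bsub>complex_ring\<^esub> y = x + y"
  "\<one>\<^bsub>complex_ring\<^esub> = 1" "\<zero>\<^bsub>complex_ring\<^esub> = 0"
  by (simp_all add: ring_of_type_algebra_def)

lemma complex_ring_uminus [simp]: "\<ominus>\<^bsub>complex_ring\<^esub> x = - x"
  using CR.l_neg[of x] by (simp add: eq_neg_iff_add_eq_0)

lemma complex_ring_inv [simp]: "x \<noteq> 0 \<Longrightarrow> inv\<^bsub>complex_ring\<^esub> x = inverse x"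
  using comm_monoid.comm_inv_char[OF cring.axioms(2)[OF cring_complex_ring], of x "inverse x"] by simp

text \<open>As \<open>inverse 0 = 0\<close>, closure under inverses can be required at zero as well;
  subfields are then handled by the operations of the type alone.\<close>

lemma complex_subfield_iff:
  "subfield F complex_ring \<longleftrightarrow> 1 \<in> F \<and> (\<forall>x\<in>F. \<forall>y\<in>F. x - y \<in> F \<and> x * y \<in> F) \<and> (\<forall>x\<in>F. inverse x \<in> F)"
proof
  assume F: "subfield F complex_ring"
  note r = subringE[OF subfieldE(1)[OF F]]
  have "inverse x \<in> F" if "x \<in> F" for x
    using CR.subfield_m_inv(1)[OF F, of x] that r by (cases "x = 0") auto
  moreover have "x - y \<in> F" if "x \<in> F" "y \<in> F" for x y
    using r(5)[of y] r(7)[of x "-y"] that by simp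
  ultimately show "1 \<in> F \<and> (\<forall>x\<in>F. \<forall>y\<in>F. x - y \<in> F \<and> x * y \<in> F) \<and> (\<forall>x\<in>F. inverse x \<in> F)"
    using r by auto
next
  assume F: "1 \<in> F \<and> (\<forall>x\<in>F. \<forall>y\<in>F. x - y \<in> F \<and> x * y \<in> F) \<and> (\<forall>x\<in>F. inverse x \<in> F)"
  have 0: "0 \<in> F" using F diff_self[of 1] by metis
  have neg: "- x \<in> F" if "x \<in> F" for x using F 0 that diff_0[of x] by metis
  have add: "x + y \<in> F" if "x \<in> F" "y \<in> F" for x y
    using F that neg[of y] diff_minus_eq_add[of x y] by metis
  show "subfield F complex_ring"
  proof (rule field.subfieldI'[OF field_complex_ring])
    show "subring F complex_ring"
      by (rule CR.subringI) (use F neg add in auto)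
  qed (use F in auto)
qed

lemma subfield_0 [simp]: "subfield F complex_ring \<Longrightarrow> 0 \<in> F"
  unfolding complex_subfield_iff by (metis diff_self)

lemma subfield_1 [simp]: "subfield F complex_ring \<Longrightarrow> 1 \<in> F"
  and subfield_diff: "subfield F complex_ring \<Longrightarrow> x \<in> F \<Longrightarrow> y \<in> F \<Longrightarrow> x - y \<in> F"
  and subfield_mult: "subfield F complex_ring \<Longrightarrow> x \<in> F \<Longrightarrow> y \<in> F \<Longrightarrow> x * y \<in> F"
  and subfield_inverse: "subfield F complex_ring \<Longrightarrow> x \<in> F \<Longrightarrow> inverse x \<in> F"
  unfolding complex_subfield_iff by auto

lemma subfield_uminus: "subfield F complex_ring \<Longrightarrow> x \<in> F \<Longrightarrow> - x \<in> F"
  using subfield_diff[of F 0 x] by simp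

lemma subfield_add: "subfield F complex_ring \<Longrightarrow> x \<in> F \<Longrightarrow> y \<in> F \<Longrightarrow> x + y \<in> F"
  using subfield_diff[of F x "-y"] subfield_uminus[of F y] by simp

lemma subfield_divide: "subfield F complex_ring \<Longrightarrow> x \<in> F \<Longrightarrow> y \<in> F \<Longrightarrow> x / y \<in> F"
  by (simp add: divide_inverse subfield_mult subfield_inverse)

lemma subfield_sum: "subfield F complex_ring \<Longrightarrow> (\<And>i. i \<in> I \<Longrightarrow> f i \<in> F) \<Longrightarrow> (\<Sum>i\<in>I. f i) \<in> F"
  by (induction I rule: infinite_finite_induct) (auto simp: subfield_add)

lemma subfield_prod: "subfield F complex_ring \<Longrightarrow> (\<And>i. i \<in> I \<Longrightarrow> f i \<in> F) \<Longrightarrow> (\<Prod>i\<in>I. f i) \<in> F"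
  by (induction I rule: infinite_finite_induct) (auto simp: subfield_mult)

lemma subfield_power: "subfield F complex_ring \<Longrightarrow> x \<in> F \<Longrightarrow> x ^ n \<in> F"
  by (induction n) (auto simp: subfield_mult)

lemma subfield_of_nat: "subfield F complex_ring \<Longrightarrow> of_nat n \<in> F"
  by (induction n) (auto simp: subfield_add)

lemma subfield_of_int: "subfield F complex_ring \<Longrightarrow> of_int k \<in> F"
  by (cases k rule: int_cases2) (auto simp: subfield_of_nat subfield_uminus)

lemma Rats_subset_subfield: "subfield F complex_ring \<Longrightarrow> \<rat> \<subseteq> F"
  by (auto elim!: Rats_cases' simp: subfield_divide subfield_of_int)

lemma subfield_Rats: "subfield \<rat> complex_ring"
  unfolding complex_subfield_iff by auto

lemmas subfield_closed = subfield_0 subfield_1 subfield_diff subfield_mult subfield_inverse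
  subfield_uminus subfield_add subfield_divide subfield_sum subfield_prod subfield_power
  subfield_of_nat subfield_of_int

subsection \<open>Polynomials over a subfield\<close>

text \<open>Polynomials of the ambient type with restricted coefficients, so that evaluation, roots
  and derivatives are those of \<open>complex poly\<close>, and embeddings act by
  \<open>map_poly\<close>.\<close>

definition polys_over :: "complex set \<Rightarrow> complex poly set" where
  "polys_over F = {p. \<forall>i. coeff p i \<in> F}"

lemma polys_over_coeff: "p \<in> polys_over F \<Longrightarrow> coeff p i \<in> F"
  by (simp add: polys_over_def)

lemma polys_over_mono: "F \<subseteq> G \<Longrightarrow> p \<in> polys_over F \<Longrightarrow> p \<in> polys_over G"
  by (auto simp: polys_over_def)

context
  fixes F :: "complex set"
  assumes F: "subfield F complex_ring"
begin

lemma polys_over_0: "0 \<in> polys_over F"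
  and polys_over_1: "1 \<in> polys_over F"
  using F by (auto simp: polys_over_def coeff_1)

lemma polys_over_pCons: "c \<in> F \<Longrightarrow> p \<in> polys_over F \<Longrightarrow> pCons c p \<in> polys_over F"
  using F by (auto simp: polys_over_def coeff_pCons split: nat.split)

lemma polys_over_add: "p \<in> polys_over F \<Longrightarrow> q \<in> polys_over F \<Longrightarrow> p + q \<in> polys_over F"
  and polys_over_diff: "p \<in> polys_over F \<Longrightarrow> q \<in> polys_over F \<Longrightarrow> p - q \<in> polys_over F"
  and polys_over_mult: "p \<in> polys_over F \<Longrightarrow> q \<in> polys_over F \<Longrightarrow> p * q \<in> polys_over F"
  and polys_over_smult: "c \<in> F \<Longrightarrow> q \<in> polys_over F \<Longrightarrow> smult c q \<in> polys_over F"
  and polys_over_monom: "c \<in> F \<Longrightarrow> monom c n \<in> polys_over F"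
  and polys_over_pderiv: "p \<in> polys_over F \<Longrightarrow> pderiv p \<in> polys_over F"
  using F by (auto simp: polys_over_def coeff_mult coeff_pderiv intro!: subfield_closed[OF F])

lemma polys_over_pcompose: "p \<in> polys_over F \<Longrightarrow> q \<in> polys_over F \<Longrightarrow> pcompose p q \<in> polys_over F"
proof (induction p)
  case (pCons a p)
  have "a \<in> F" using polys_over_coeff[OF pCons.prems(1), of 0] by simp
  moreover have "p \<in> polys_over F"
    using pCons.prems(1) by (auto simp: polys_over_def coeff_pCons split: nat.splits)
  ultimately show ?case
    using pCons by (simp add: pcompose_pCons polys_over_add polys_over_mult polys_over_pCons polys_over_0)
qed (simp add: polys_over_0)

lemma poly_in_subfield: "p \<in> polys_over F \<Longrightarrow> x \<in> F \<Longrightarrow> poly p x \<in> F"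
  by (auto simp: poly_altdef polys_over_def intro!: subfield_closed[OF F])

lemma polys_over_division:
  assumes m: "m \<in> polys_over F" "m \<noteq> 0" and p: "p \<in> polys_over F"
  shows "\<exists>q\<in>polys_over F. \<exists>r\<in>polys_over F. p = q * m + r \<and> (r = 0 \<or> degree r < degree m)"
  using p
proof (induction "degree p" arbitrary: p rule: less_induct)
  case less
  show ?case
  proof (cases "p = 0 \<or> degree p < degree m")
    case True
    then show ?thesis
      using less.prems polys_over_0 by (intro bexI[of _ 0] bexI[of _ p]) auto
  next
    case False
    define c where "c = lead_coeff p / lead_coeff m"
    define k where "k = degree p - degree m"
    define t where "t = monom c k"
    have c: "c \<in> F" "c \<noteq> 0" using less.prems m F False by (auto simp: c_def subfield_divide polys_over_coeff)
    have t: "t \<in> polys_over F" using c by (simp add: t_def polys_over_monom)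
    have "degree (t * m) = degree p"
      using c m False by (simp add: t_def degree_mult_eq degree_monom_eq k_def monom_eq_0_iff)
    moreover have "lead_coeff (t * m) = lead_coeff p"
      using c m by (simp add: t_def lead_coeff_mult degree_monom_eq) (simp add: c_def)
    ultimately have degt: "degree (t * m) = degree p" "lead_coeff (t * m) = lead_coeff p"
      by auto
    define p' where "p' = p - t * m"
    have p': "p' \<in> polys_over F" using t m less.prems by (simp add: p'_def polys_over_diff polys_over_mult)
    show ?thesis
    proof (cases "p' = 0")
      case True
      then have "p = t * m + 0" by (simp add: p'_def)
      then show ?thesis using t polys_over_0 by blast
    next
      case False
      have "degree p' < degree p"
      proof -
        have "degree p' \<le> degree p" unfolding p'_def using degt(1) by (metis degree_diff_le order_refl)
        moreover have "coeff p' (degree p) = 0" using degt by (simp add: p'_def)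
        ultimately show ?thesis using False by (metis le_neq_implies_less leading_coeff_0_iff)
      qed
      from less.hyps[OF this p'] obtain q r where qr: "q \<in> polys_over F" "r \<in> polys_over F"
        "p' = q * m + r" "r = 0 \<or> degree r < degree m" by blast
      have "p = (q + t) * m + r" using qr(3) by (simp add: p'_def algebra_simps)
      then show ?thesis using qr t polys_over_add by blast
    qed
  qed
qed

lemma polys_over_bezout:
  assumes "p \<in> polys_over F" "q \<in> polys_over F" "p \<noteq> 0 \<or> q \<noteq> 0"
  shows "\<exists>u\<in>polys_over F. \<exists>v\<in>polys_over F. \<exists>g\<in>polys_over F. \<exists>s\<in>polys_over F. \<exists>t\<in>polys_over F.
    g \<noteq> 0 \<and> g = u * p + v * q \<and> p = s * g \<and> q = t * g"
  using assms
\<comment> \<open>\<open>degree 0\<close> is \<open>0\<close>, so the plain degree would not fall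
  when division by a nonzero constant leaves remainder zero; the shifted measure puts zero below the
  constants.\<close>
proof (induction "if q = 0 then 0 else Suc (degree q)" arbitrary: p q rule: less_induct)
  case less
  show ?case
  proof (cases "q = 0")
    case True
    then show ?thesis
      using less.prems polys_over_0 polys_over_1
      by (intro bexI[of _ 1] bexI[of _ 0] bexI[of _ p]) auto
  next
    case False
    obtain a r where ar: "a \<in> polys_over F" "r \<in> polys_over F" "p = a * q + r"
      "r = 0 \<or> degree r < degree q"
      using polys_over_division[OF less.prems(2) False less.prems(1)] by blast
    have "(if r = 0 then 0 else Suc (degree r)) < (if q = 0 then 0 else Suc (degree q))"
      using ar(4) False by auto
    from less.hyps[OF this less.prems(2) ar(2)] False
    obtain u v g s t where *: "u \<in> polys_over F" "v \<in> polys_over F" "g \<in> polys_over F"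
      "s \<in> polys_over F" "t \<in> polys_over F" "g \<noteq> 0" "g = u * q + v * r" "q = s * g" "r = t * g"
      by blast
    have "g = v * p + (u - v * a) * q" unfolding *(7) ar(3) by (simp add: algebra_simps)
    moreover have "p = (a * s + t) * g" unfolding ar(3) by (subst *(8), subst *(9)) (simp add: algebra_simps)
    ultimately show ?thesis
      using *(1-6,8) ar(1)
      by (intro bexI[of _ v] bexI[of _ "u - v * a"] bexI[of _ g] bexI[of _ "a * s + t"] bexI[of _ s])
        (auto intro!: polys_over_add polys_over_diff polys_over_mult)
  qed
qed

end

subsection \<open>Minimal polynomials and simple extensions\<close>

definition algebraic_over :: "complex set \<Rightarrow> complex \<Rightarrow> bool" where
  "algebraic_over F x \<longleftrightarrow> (\<exists>p\<in>polys_over F. p \<noteq> 0 \<and> poly p x = 0)"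

definition minimal_poly :: "complex set \<Rightarrow> complex \<Rightarrow> complex poly \<Rightarrow> bool" where
  "minimal_poly F x m \<longleftrightarrow> m \<in> polys_over F \<and> lead_coeff m = 1 \<and> poly m x = 0 \<and>
     (\<forall>p\<in>polys_over F. p \<noteq> 0 \<longrightarrow> poly p x = 0 \<longrightarrow> degree m \<le> degree p)"

definition simple_ext :: "complex set \<Rightarrow> complex \<Rightarrow> complex set" where
  "simple_ext F x = (\<lambda>p. poly p x) ` polys_over F"

lemma algebraic_over_mono: "F \<subseteq> G \<Longrightarrow> algebraic_over F x \<Longrightarrow> algebraic_over G x"
  unfolding algebraic_over_def using polys_over_mono by blast

context
  fixes F :: "complex set"
  assumes F: "subfield F complex_ring"
begin

lemma minimal_poly_exists:
  assumes "algebraic_over F x"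
  shows "\<exists>m. minimal_poly F x m"
proof -
  define P where "P = (\<lambda>p. p \<in> polys_over F \<and> p \<noteq> 0 \<and> poly p x = 0)"
  obtain p where p: "P p" "\<And>q. P q \<Longrightarrow> degree p \<le> degree q"
    using assms ex_has_least_nat[of P _ degree] unfolding algebraic_over_def P_def by blast
  have "smult (1 / lead_coeff p) p \<in> polys_over F"
    using p(1) F by (auto simp: P_def intro!: polys_over_smult subfield_divide polys_over_coeff)
  then have "minimal_poly F x (smult (1 / lead_coeff p) p)"
    using p by (auto simp: minimal_poly_def P_def)
  then show ?thesis ..
qed

lemma minimal_poly_dvd:
  assumes m: "minimal_poly F x m" and p: "p \<in> polys_over F" "poly p x = 0"
  shows "\<exists>q\<in>polys_over F. p = q * m"
proof -
  have "m \<noteq> 0" using m by (auto simp: minimal_poly_def)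
  then obtain q r where qr: "q \<in> polys_over F" "r \<in> polys_over F" "p = q * m + r"
      "r = 0 \<or> degree r < degree m"
    using polys_over_division[OF F, of m p] p(1) m unfolding minimal_poly_def by blast
  have "poly r x = 0" using qr(3) m p by (auto simp: minimal_poly_def)
  then have "r = 0" using qr m by (auto simp: minimal_poly_def)
  then show ?thesis using qr by auto
qed

lemma minimal_poly_degree_pos: "minimal_poly F x m \<Longrightarrow> degree m > 0"
  by (auto simp: minimal_poly_def intro!: Nat.gr0I elim!: degree_eq_zeroE)

text \<open>The gcd \<open>g\<close> of \<open>p\<close> and \<open>m\<close> does not vanish at
  \<open>x\<close>, so the cofactor of \<open>g\<close> in \<open>m\<close> does. By minimality that
  cofactor has full degree, and \<open>g\<close> is constant. This yields both the inverses in
  \<open>simple_ext\<close> and separability.\<close>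

lemma minimal_poly_coprime:
  assumes m: "minimal_poly F x m" and p: "p \<in> polys_over F" "poly p x \<noteq> 0"
  shows "\<exists>u\<in>polys_over F. \<exists>v\<in>polys_over F. u * p + v * m = 1"
proof -
  have "m \<noteq> 0" "m \<in> polys_over F" using m by (auto simp: minimal_poly_def)
  then obtain u v g s t where *: "u \<in> polys_over F" "v \<in> polys_over F" "g \<in> polys_over F"
      "s \<in> polys_over F" "t \<in> polys_over F" "g \<noteq> 0" "g = u * p + v * m" "p = s * g" "m = t * g"
    using polys_over_bezout[OF F p(1), of m] by blast
  have "poly g x \<noteq> 0" using p(2) *(8) by auto
  then have "poly t x = 0" using m *(9) by (auto simp: minimal_poly_def)
  moreover have "t \<noteq> 0" using \<open>m \<noteq> 0\<close> *(9) by auto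
  ultimately have "degree m \<le> degree t" using m *(5) by (auto simp: minimal_poly_def)
  then have "degree g = 0" using *(6,9) \<open>t \<noteq> 0\<close> by (auto simp: degree_mult_eq)
  then obtain c where c: "g = [:c:]" "c \<noteq> 0" using *(6) by (auto elim!: degree_eq_zeroE)
  have "c \<in> F" using polys_over_coeff[OF *(3), of 0] c by simp
  have "smult (1/c) u * p + smult (1/c) v * m = smult (1/c) g" by (simp add: *(7) smult_add_right)
  also have "\<dots> = 1" using c by simp
  finally show ?thesis
    using \<open>c \<in> F\<close> *(1,2) F by (meson polys_over_smult subfield_divide subfield_1)
qed

lemma subset_simple_ext: "F \<subseteq> simple_ext F x"
  using F by (auto simp: simple_ext_def intro!: image_eqI[of _ _ "[:_:]"] polys_over_pCons polys_over_0)

lemma gen_in_simple_ext: "x \<in> simple_ext F x"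
  using F by (auto simp: simple_ext_def intro!: image_eqI[of _ _ "[:0,1:]"] polys_over_pCons polys_over_0)

lemma simple_ext_subfield:
  assumes "algebraic_over F x"
  shows "subfield (simple_ext F x) complex_ring"
proof -
  obtain m where m: "minimal_poly F x m" using minimal_poly_exists[OF assms] by blast
  have "inverse (poly p x) \<in> simple_ext F x" if p: "p \<in> polys_over F" for p
  proof (cases "poly p x = 0")
    case False
    obtain u v where uv: "u \<in> polys_over F" "v \<in> polys_over F" "u * p + v * m = 1"
      using minimal_poly_coprime[OF m p False] by blast
    have "poly u x * poly p x = 1"
      using arg_cong[OF uv(3), of "\<lambda>p. poly p x"] m by (simp add: minimal_poly_def)
    then have "inverse (poly p x) = poly u x" using False by (metis inverse_unique mult.commute)
    then show ?thesis using uv by (auto simp: simple_ext_def)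
  qed (use subset_simple_ext[of x] F in auto)
  moreover have "poly p x - poly q x \<in> simple_ext F x" "poly p x * poly q x \<in> simple_ext F x"
    if "p \<in> polys_over F" "q \<in> polys_over F" for p q
    using image_eqI[OF _ polys_over_diff[OF F that], of _ "\<lambda>p. poly p x"]
      image_eqI[OF _ polys_over_mult[OF F that], of _ "\<lambda>p. poly p x"]
    by (auto simp: simple_ext_def)
  moreover have "1 \<in> simple_ext F x" using subset_simple_ext[of x] F by auto
  ultimately show ?thesis unfolding complex_subfield_iff by (auto simp: simple_ext_def)
qed

lemma simple_ext_minimal:
  assumes "subfield G complex_ring" "F \<subseteq> G" "x \<in> G"
  shows "simple_ext F x \<subseteq> G"
  using assms poly_in_subfield polys_over_mono unfolding simple_ext_def by blast

lemma simple_ext_degree_less: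
  assumes m: "minimal_poly F x m" and z: "z \<in> simple_ext F x"
  shows "\<exists>p\<in>polys_over F. z = poly p x \<and> degree p < degree m"
proof -
  obtain p where p: "p \<in> polys_over F" "z = poly p x" using z by (auto simp: simple_ext_def)
  have "m \<noteq> 0" using m by (auto simp: minimal_poly_def)
  then obtain q r where qr: "q \<in> polys_over F" "r \<in> polys_over F" "p = q * m + r"
      "r = 0 \<or> degree r < degree m"
    using polys_over_division[OF F, of m p] p(1) m unfolding minimal_poly_def by blast
  have "poly r x = z" using qr(3) p(2) m by (auto simp: minimal_poly_def)
  then show ?thesis using qr minimal_poly_degree_pos[OF m] by auto
qed

lemma adjoin_eq_simple_ext:
  assumes "algebraic_over F x"
  shows "adjoin F x = simple_ext F x"
proof
  have "subfield (simple_ext F x) complex_ring" by (rule simple_ext_subfield[OF assms])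
  then show "adjoin F x \<subseteq> simple_ext F x"
    unfolding adjoin_def
    by (intro field.generate_field_min_subfield1[OF field_complex_ring]) (use subset_simple_ext gen_in_simple_ext in auto)
  show "simple_ext F x \<subseteq> adjoin F x"
    unfolding adjoin_def
    by (intro simple_ext_minimal field.generate_field_is_subfield[OF field_complex_ring]) (auto intro: generate_field.incl)
qed

end

lemma algebraic_over_Rats_iff: "algebraic_over \<rat> x \<longleftrightarrow> algebraic x"
  by (auto simp: algebraic_over_def algebraic_altdef polys_over_def)

subsection \<open>Embeddings\<close>

lemma field_embeddingsI:
  assumes "\<sigma> \<in> extensional F" "\<sigma> 1 = 1" "\<And>x y. x \<in> F \<Longrightarrow> y \<in> F \<Longrightarrow> \<sigma> (x * y) = \<sigma> x * \<sigma> y"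
    "\<And>x y. x \<in> F \<Longrightarrow> y \<in> F \<Longrightarrow> \<sigma> (x + y) = \<sigma> x + \<sigma> y"
  shows "\<sigma> \<in> field_embeddings F"
  using assms by (auto simp: field_embeddings_def Ring.ring_hom_def)

context
  fixes F :: "complex set" and \<sigma> :: "complex \<Rightarrow> complex"
  assumes F: "subfield F complex_ring" and emb: "\<sigma> \<in> field_embeddings F"
begin

lemma embedding_add: "x \<in> F \<Longrightarrow> y \<in> F \<Longrightarrow> \<sigma> (x + y) = \<sigma> x + \<sigma> y"
  and embedding_mult: "x \<in> F \<Longrightarrow> y \<in> F \<Longrightarrow> \<sigma> (x * y) = \<sigma> x * \<sigma> y"
  and embedding_1: "\<sigma> 1 = 1"
  using emb by (auto simp: field_embeddings_def Ring.ring_hom_def)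

lemma embedding_0: "\<sigma> 0 = 0"
  using embedding_add[of 0 0] F by simp

lemma embedding_uminus: "x \<in> F \<Longrightarrow> \<sigma> (- x) = - \<sigma> x"
  using embedding_add[of x "-x"] F by (simp add: subfield_uminus embedding_0 eq_neg_iff_add_eq_0 add.commute)

lemma embedding_diff: "x \<in> F \<Longrightarrow> y \<in> F \<Longrightarrow> \<sigma> (x - y) = \<sigma> x - \<sigma> y"
  using embedding_add[of x "-y"] F by (simp add: subfield_uminus embedding_uminus)

lemma embedding_eq_0_iff: "x \<in> F \<Longrightarrow> \<sigma> x = 0 \<longleftrightarrow> x = 0"
  using embedding_mult[of x "inverse x"] F
  by (cases "x = 0") (auto simp: embedding_0 embedding_1 subfield_inverse)

lemma embedding_inverse: "x \<in> F \<Longrightarrow> \<sigma> (inverse x) = inverse (\<sigma> x)"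
  using embedding_mult[of x "inverse x"] F
  by (cases "x = 0") (auto simp: embedding_0 embedding_1 subfield_inverse inverse_unique)

lemma embedding_divide: "x \<in> F \<Longrightarrow> y \<in> F \<Longrightarrow> \<sigma> (x / y) = \<sigma> x / \<sigma> y"
  by (simp add: divide_inverse embedding_mult embedding_inverse subfield_inverse[OF F])

lemma embedding_power: "x \<in> F \<Longrightarrow> \<sigma> (x ^ n) = \<sigma> x ^ n"
  by (induction n) (auto simp: embedding_1 embedding_mult subfield_power[OF F])

lemma embedding_sum: "(\<And>i. i \<in> I \<Longrightarrow> f i \<in> F) \<Longrightarrow> \<sigma> (\<Sum>i\<in>I. f i) = (\<Sum>i\<in>I. \<sigma> (f i))"
  by (induction I rule: infinite_finite_induct)
    (auto simp: embedding_0 embedding_add subfield_sum[OF F])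

lemma embedding_of_nat: "\<sigma> (of_nat n) = of_nat n"
  by (induction n) (auto simp: embedding_0 embedding_add embedding_1 subfield_of_nat[OF F] F)

lemma embedding_of_int: "\<sigma> (of_int k) = of_int k"
  by (cases k rule: int_cases2) (auto simp: embedding_of_nat embedding_uminus subfield_of_nat[OF F])

lemma embedding_Rats: "q \<in> \<rat> \<Longrightarrow> \<sigma> q = q"
  by (auto elim!: Rats_cases' simp: embedding_divide embedding_of_int subfield_of_int[OF F])

lemma map_poly_embedding_add:
  "p \<in> polys_over F \<Longrightarrow> q \<in> polys_over F \<Longrightarrow> map_poly \<sigma> (p + q) = map_poly \<sigma> p + map_poly \<sigma> q"
  by (rule poly_eqI) (simp add: coeff_map_poly embedding_0 embedding_add polys_over_coeff)

lemma map_poly_embedding_mult: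
  "p \<in> polys_over F \<Longrightarrow> q \<in> polys_over F \<Longrightarrow> map_poly \<sigma> (p * q) = map_poly \<sigma> p * map_poly \<sigma> q"
  by (rule poly_eqI)
    (simp add: coeff_map_poly embedding_0 coeff_mult embedding_sum embedding_mult polys_over_coeff
       subfield_mult[OF F])

lemma map_poly_embedding_diff:
  "p \<in> polys_over F \<Longrightarrow> q \<in> polys_over F \<Longrightarrow> map_poly \<sigma> (p - q) = map_poly \<sigma> p - map_poly \<sigma> q"
  by (rule poly_eqI) (simp add: coeff_map_poly embedding_0 embedding_diff polys_over_coeff)

lemma map_poly_embedding_pderiv:
  "p \<in> polys_over F \<Longrightarrow> map_poly \<sigma> (pderiv p) = pderiv (map_poly \<sigma> p)"
  using embedding_of_nat
  by (intro poly_eqI) (simp add: coeff_map_poly embedding_0 coeff_pderiv embedding_mult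
    polys_over_coeff subfield_of_nat[OF F] subfield_add[OF F] F embedding_add embedding_1)

lemma map_poly_embedding_1: "map_poly \<sigma> 1 = 1"
  by (simp add: map_poly_1' embedding_1)

lemma degree_map_poly_embedding: "p \<in> polys_over F \<Longrightarrow> degree (map_poly \<sigma> p) = degree p"
  by (cases "p = 0")
    (auto intro!: map_poly_degree_eq simp: embedding_eq_0_iff polys_over_coeff)

lemma embedding_poly:
  "p \<in> polys_over F \<Longrightarrow> x \<in> F \<Longrightarrow> \<sigma> (poly p x) = poly (map_poly \<sigma> p) (\<sigma> x)"
  by (simp add: poly_altdef degree_map_poly_embedding coeff_map_poly embedding_0 embedding_sum
     embedding_mult embedding_power polys_over_coeff subfield_mult[OF F] subfield_power[OF F])

lemma map_poly_embedding_Rats: "p \<in> polys_over \<rat> \<Longrightarrow> map_poly \<sigma> p = p"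
  by (rule poly_eqI) (simp add: coeff_map_poly embedding_0 embedding_Rats polys_over_coeff)

lemma embedding_restrict:
  assumes "subfield G complex_ring" "G \<subseteq> F"
  shows "restrict \<sigma> G \<in> field_embeddings G"
  using assms(2) embedding_1 embedding_add embedding_mult subfield_closed[OF assms(1)]
  by (intro field_embeddingsI) (auto simp: subset_iff)

lemma embedding_cnj: "restrict (\<lambda>x. cnj (\<sigma> x)) F \<in> field_embeddings F"
  using embedding_1 embedding_add embedding_mult subfield_closed[OF F]
  by (intro field_embeddingsI) auto

end

lemma inclusion_embedding:
  assumes "subfield F complex_ring"
  shows "restrict (\<lambda>x. x) F \<in> field_embeddings F"
  using subfield_closed[OF assms] by (intro field_embeddingsI) auto

lemma embedding_ext:
  "\<sigma> \<in> field_embeddings F \<Longrightarrow> \<tau> \<in> field_embeddings F \<Longrightarrow> (\<And>x. x \<in> F \<Longrightarrow> \<sigma> x = \<tau> x) \<Longrightarrow> \<sigma> = \<tau>"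
  by (auto simp: field_embeddings_def intro: extensionalityI)

lemma embedding_algebraic_int:
  assumes F: "subfield F complex_ring" "\<sigma> \<in> field_embeddings F" and x: "x \<in> F" "algebraic_int x"
  shows "algebraic_int (\<sigma> x)"
proof -
  obtain p where p: "lead_coeff p = 1" "\<forall>i. coeff p i \<in> \<int>" "poly p x = 0"
    using x(2) by (auto elim: algebraic_int.cases)
  have pr: "p \<in> polys_over \<rat>" using p Ints_subset_Rats by (auto simp: polys_over_def)
  then have "poly p (\<sigma> x) = \<sigma> (poly p x)"
    using embedding_poly[OF F _ x(1), of p] map_poly_embedding_Rats[OF F pr]
      polys_over_mono[OF Rats_subset_subfield[OF F(1)] pr] by simp
  then show ?thesis using p embedding_0[OF F] by (auto intro: algebraic_int.intros)
qed

text \<open>Separability is expressed by a Bezout identity because such an identity survives when an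
  embedding is applied to the coefficients.\<close>

lemma roots_coprime_pderiv:
  fixes p :: "complex poly"
  assumes "u * pderiv p + v * p = 1" "p \<noteq> 0"
  shows "p = smult (lead_coeff p) (\<Prod>x\<in>{x. poly p x = 0}. [:-x, 1:])"
    and "card {x. poly p x = 0} = degree p"
proof -
  have sf: "rsquarefree p"
    unfolding rsquarefree_roots
  proof (intro allI notI)
    fix a assume "poly p a = 0 \<and> poly (pderiv p) a = 0"
    then show False using arg_cong[OF assms(1), of "\<lambda>p. poly p a"] by simp
  qed
  show *: "p = smult (lead_coeff p) (\<Prod>x\<in>{x. poly p x = 0}. [:-x, 1:])"
    using complex_poly_decompose_rsquarefree[OF sf] by simp
  then have "degree p = degree (\<Prod>x\<in>{x. poly p x = 0}. [:-x, 1:])"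
    using assms(2) by (metis degree_smult_eq leading_coeff_0_iff)
  also have "\<dots> = card {x. poly p x = 0}"
    by (subst degree_prod_eq_sum_degree) auto
  finally show "card {x. poly p x = 0} = degree p" by simp
qed

context
  fixes F :: "complex set" and x :: complex and m :: "complex poly" and \<sigma> :: "complex \<Rightarrow> complex"
  assumes F: "subfield F complex_ring" and emb: "\<sigma> \<in> field_embeddings F" and m: "minimal_poly F x m"
begin

lemma simple_ext_algebraic: "algebraic_over F x"
proof -
  have "m \<noteq> 0" using m by (auto simp: minimal_poly_def)
  then show ?thesis using m by (auto simp: minimal_poly_def algebraic_over_def)
qed

text \<open>\<tau> sends the value of a polynomial at \<open>x\<close> to the value of its image at
  \<rho>. Two polynomials over \<open>F\<close> with the same value at \<open>x\<close> differ by a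
  multiple of \<open>m\<close>, whose image vanishes at \<rho>, so the choice made by
  \<open>g\<close> is immaterial.\<close>

lemma embedding_extends:
  assumes \<rho>: "poly (map_poly \<sigma> m) \<rho> = 0"
  shows "\<exists>\<tau>\<in>field_embeddings (simple_ext F x). \<tau> x = \<rho> \<and> (\<forall>z\<in>F. \<tau> z = \<sigma> z)"
proof -
  define g where "g = (\<lambda>z. SOME p. p \<in> polys_over F \<and> poly p x = z)"
  define \<tau> where "\<tau> = restrict (\<lambda>z. poly (map_poly \<sigma> (g z)) \<rho>) (simple_ext F x)"
  have \<tau>: "\<tau> (poly p x) = poly (map_poly \<sigma> p) \<rho>" if p: "p \<in> polys_over F" for p
  proof -
    have g: "g (poly p x) \<in> polys_over F \<and> poly (g (poly p x)) x = poly p x"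
      unfolding g_def by (rule someI[of _ p]) (use p in simp)
    have d: "g (poly p x) - p \<in> polys_over F" using g p by (simp add: polys_over_diff[OF F])
    obtain q where q: "q \<in> polys_over F" "g (poly p x) - p = q * m"
      using minimal_poly_dvd[OF F m d] g by auto
    have "map_poly \<sigma> (g (poly p x)) - map_poly \<sigma> p = map_poly \<sigma> q * map_poly \<sigma> m"
      using map_poly_embedding_diff[OF F emb, of "g (poly p x)" p]
        map_poly_embedding_mult[OF F emb q(1)] g p q m by (simp add: minimal_poly_def)
    then have "poly (map_poly \<sigma> (g (poly p x)) - map_poly \<sigma> p) \<rho> = 0" using \<rho> by simp
    then show ?thesis using p by (simp add: \<tau>_def simple_ext_def)
  qed
  have "\<tau> \<in> field_embeddings (simple_ext F x)"
  proof -
    have "\<tau> (poly p x * poly q x) = \<tau> (poly p x) * \<tau> (poly q x)"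
         "\<tau> (poly p x + poly q x) = \<tau> (poly p x) + \<tau> (poly q x)"
      if "p \<in> polys_over F" "q \<in> polys_over F" for p q
      using that \<tau>[of "p * q"] \<tau>[of "p + q"] \<tau>[of p] \<tau>[of q]
      by (auto simp: map_poly_embedding_mult[OF F emb] map_poly_embedding_add[OF F emb]
          polys_over_mult[OF F] polys_over_add[OF F])
    moreover have "\<tau> 1 = 1" using \<tau>[of 1] polys_over_1[OF F] by (simp add: map_poly_embedding_1[OF F emb])
    moreover have "\<tau> \<in> extensional (simple_ext F x)" by (simp add: \<tau>_def)
    ultimately show ?thesis
      by (intro field_embeddingsI) (auto simp: simple_ext_def)
  qed
  moreover have "\<tau> x = \<rho>"
  proof -
    have "map_poly \<sigma> [:0, 1:] = [:0, 1:]"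
      by (rule poly_eqI)
        (simp add: coeff_map_poly embedding_0[OF F emb] embedding_1[OF F emb] coeff_pCons split: nat.split)
    then show ?thesis
      using \<tau>[of "[:0, 1:]"] F by (simp add: polys_over_pCons[OF F] polys_over_0[OF F])
  qed
  moreover have "\<tau> z = \<sigma> z" if "z \<in> F" for z
  proof -
    have "map_poly \<sigma> [:z:] = [:\<sigma> z:]"
      by (rule poly_eqI) (simp add: coeff_map_poly embedding_0[OF F emb] coeff_pCons split: nat.split)
    then show ?thesis
      using \<tau>[of "[:z:]"] that by (simp add: polys_over_pCons[OF F] polys_over_0[OF F])
  qed
  ultimately show ?thesis by blast
qed

text \<open>In characteristic zero the derivative of \<open>m\<close> is nonzero and of smaller
  degree, so it does not vanish at \<open>x\<close> and is coprime to \<open>m\<close>. The image of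
  \<open>m\<close> under \<sigma> therefore has only simple roots.\<close>

lemma minimal_poly_roots:
  "map_poly \<sigma> m = (\<Prod>\<rho>\<in>{\<rho>. poly (map_poly \<sigma> m) \<rho> = 0}. [:-\<rho>, 1:])"
  "card {\<rho>. poly (map_poly \<sigma> m) \<rho> = 0} = degree m"
proof -
  have mp: "m \<in> polys_over F" "m \<noteq> 0" "poly m x = 0" using m by (auto simp: minimal_poly_def)
  have pd: "pderiv m \<in> polys_over F" using polys_over_pderiv[OF F mp(1)] .
  have "degree m > 0" using minimal_poly_degree_pos[OF F m] .
  then have "pderiv m \<noteq> 0" "degree (pderiv m) < degree m"
    by (auto simp: pderiv_eq_0_iff degree_pderiv)
  then have "poly (pderiv m) x \<noteq> 0"
    using m pd by (auto simp: minimal_poly_def)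
  from minimal_poly_coprime[OF F m pd this] obtain u v where uv: "u \<in> polys_over F" "v \<in> polys_over F"
    "u * pderiv m + v * m = 1" by blast
  have "map_poly \<sigma> u * pderiv (map_poly \<sigma> m) + map_poly \<sigma> v * map_poly \<sigma> m = map_poly \<sigma> (u * pderiv m + v * m)"
    using uv(1,2) mp pd
    by (simp add: map_poly_embedding_mult[OF F emb] map_poly_embedding_add[OF F emb] polys_over_mult[OF F]
       map_poly_embedding_pderiv[OF F emb])
  then have "map_poly \<sigma> u * pderiv (map_poly \<sigma> m) + map_poly \<sigma> v * map_poly \<sigma> m = 1"
    by (simp add: uv(3) map_poly_embedding_1[OF F emb])
  moreover have "map_poly \<sigma> m \<noteq> 0"
    using degree_map_poly_embedding[OF F emb mp(1)] \<open>degree m > 0\<close> by auto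
  note roots = roots_coprime_pderiv[OF calculation this]
  show "card {\<rho>. poly (map_poly \<sigma> m) \<rho> = 0} = degree m"
    using roots(2) degree_map_poly_embedding[OF F emb mp(1)] by simp
  have "lead_coeff (map_poly \<sigma> m) = 1"
    using m by (simp add: degree_map_poly_embedding[OF F emb mp(1)] coeff_map_poly
      embedding_0[OF F emb] embedding_1[OF F emb] minimal_poly_def)
  then show "map_poly \<sigma> m = (\<Prod>\<rho>\<in>{\<rho>. poly (map_poly \<sigma> m) \<rho> = 0}. [:-\<rho>, 1:])"
    using roots(1) by simp
qed

text \<open>An extension of \<sigma> is determined by the image of \<open>x\<close>, which may be
  any root of the image of \<open>m\<close>.\<close>

lemma card_embedding_extensions:
  "card {\<tau>\<in>field_embeddings (simple_ext F x). \<forall>z\<in>F. \<tau> z = \<sigma> z} = degree m"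
  "finite {\<tau>\<in>field_embeddings (simple_ext F x). \<forall>z\<in>F. \<tau> z = \<sigma> z}"
proof -
  let ?E = "{\<tau>\<in>field_embeddings (simple_ext F x). \<forall>z\<in>F. \<tau> z = \<sigma> z}"
  have L: "subfield (simple_ext F x) complex_ring"
    using simple_ext_subfield[OF F simple_ext_algebraic] .
  have mp: "m \<in> polys_over F" "m \<noteq> 0" "poly m x = 0" using m by (auto simp: minimal_poly_def)
  have \<tau>p: "\<tau> (poly p x) = poly (map_poly \<sigma> p) (\<tau> x)" if "\<tau> \<in> ?E" "p \<in> polys_over F" for \<tau> p
  proof -
    have "map_poly \<tau> p = map_poly \<sigma> p"
      using that embedding_0[OF L, of \<tau>] embedding_0[OF F emb]
      by (intro poly_eqI) (auto simp: coeff_map_poly polys_over_coeff)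
    then show ?thesis
      using embedding_poly[OF L, of \<tau> p x] that gen_in_simple_ext[OF F]
        polys_over_mono[OF subset_simple_ext[OF F]] by auto
  qed
  have bij: "bij_betw (\<lambda>\<tau>. \<tau> x) ?E {\<rho>. poly (map_poly \<sigma> m) \<rho> = 0}"
    unfolding bij_betw_def
  proof
    show "inj_on (\<lambda>\<tau>. \<tau> x) ?E"
    proof (rule inj_onI)
      fix \<tau> \<tau>' assume t: "\<tau> \<in> ?E" "\<tau>' \<in> ?E" "\<tau> x = \<tau>' x"
      show "\<tau> = \<tau>'"
        by (rule embedding_ext[of _ "simple_ext F x"])
          (use t \<tau>p[OF t(1)] \<tau>p[OF t(2)] in \<open>auto simp: simple_ext_def\<close>)
    qed
    have "poly (map_poly \<sigma> m) (\<tau> x) = 0" if "\<tau> \<in> ?E" for \<tau>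
      using \<tau>p[OF that mp(1)] mp(3) embedding_0[OF L, of \<tau>] that by simp
    then show "(\<lambda>\<tau>. \<tau> x) ` ?E = {\<rho>. poly (map_poly \<sigma> m) \<rho> = 0}"
      using embedding_extends by (auto simp: image_iff)
  qed
  note card = minimal_poly_roots(2)
  show "card ?E = degree m" using bij_betw_same_card[OF bij] card by simp
  have "finite {\<rho>. poly (map_poly \<sigma> m) \<rho> = 0}"
    using card minimal_poly_degree_pos[OF F m] by (intro card_ge_0_finite) simp
  then show "finite ?E" using bij_betw_finite[OF bij] by simp
qed

end

section \<open>Number fields\<close>

lemma combine_complex:
  "CR.combine ks us = (\<Sum>i<min (length ks) (length us). ks ! i * us ! i)"
proof (induction ks us rule: CR.combine.induct)
  case (1 k Ks u Us)
  then show ?case by (simp add: sum.lessThan_Suc_shift del: sum.lessThan_Suc)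
qed auto

lemma dimension_dependent:
  assumes F: "subfield F complex_ring" and dim: "CR.dimension n F E"
    and us: "set us \<subseteq> E" "length us > n"
  shows "\<exists>c. (\<forall>i. c i \<in> F) \<and> (\<exists>i<length us. c i \<noteq> 0) \<and> (\<Sum>i<length us. c i * us ! i) = 0"
proof -
  have "CR.dependent F us"
    using CR.independent_length_le_dimension[OF F dim _ us(1)] us(2) by auto
  then obtain ks where ks: "length ks = length us" "CR.combine ks us = 0" "set ks \<subseteq> F" "set ks \<noteq> {0}"
    using CR.dependent_imp_non_trivial_combine[OF F, of us] by auto
  have "ks \<noteq> []" using ks(1) us(2) by auto
  then obtain i where i: "i < length ks" "ks ! i \<noteq> 0"
    using ks(4) by (metis in_set_conv_nth insert_absorb set_empty subsetI subset_singletonD singletonI singletonD)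
  define c where "c = (\<lambda>i. if i < length ks then ks ! i else 0)"
  have "(\<Sum>i<length us. c i * us ! i) = CR.combine ks us"
    by (simp add: combine_complex c_def ks(1))
  moreover have "\<forall>i. c i \<in> F" using ks(3) F by (auto simp: c_def)
  ultimately show ?thesis using i ks(1,2) by (intro exI[of _ c]) (auto simp: c_def)
qed

lemma number_field_subfield: "number_field K \<Longrightarrow> subfield K complex_ring"
  by (simp add: number_field_def)

lemma number_field_dimension: "number_field K \<Longrightarrow> CR.dimension (field_degree \<rat> K) \<rat> K"
  using CR.finite_dimensionE[OF subfield_Rats, of K] by (simp add: number_field_def field_degree_def over_def)

lemma number_field_algebraic:
  assumes K: "number_field K" and x: "x \<in> K"
  shows "algebraic_over \<rat> x"
proof -
  define n where "n = Suc (field_degree \<rat> K)"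
  define us where "us = map (\<lambda>i. x ^ i) [0..<n]"
  have "set us \<subseteq> K"
    using x subfield_power[OF number_field_subfield[OF K]] by (auto simp: us_def)
  then obtain c where c: "\<forall>i. c i \<in> \<rat>" "\<exists>i<n. c i \<noteq> 0" "(\<Sum>i<n. c i * us ! i) = 0"
    using dimension_dependent[OF subfield_Rats number_field_dimension[OF K], of us]
    by (auto simp: us_def n_def)
  define p where "p = (\<Sum>i<n. monom (c i) i)"
  have "coeff p j = (if j < n then c j else 0)" for j by (simp add: p_def coeff_sum_monom)
  then have "p \<in> polys_over \<rat>" "p \<noteq> 0"
    using c by (auto simp: polys_over_def poly_eq_iff)
  moreover have "poly p x = 0"
    using c(3) by (simp add: p_def poly_sum poly_monom us_def)
  ultimately show ?thesis by (auto simp: algebraic_over_def)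
qed

text \<open>A relation among the powers of \<open>x\<close> below \<open>degree m\<close> would be a
  polynomial of too small degree. Applied to a primitive element, this bounds the number of
  embeddings by the degree, and the constants of the final estimates grow with that number.\<close>

lemma minimal_poly_degree_le:
  assumes K: "number_field K" and x: "x \<in> K" and m: "minimal_poly \<rat> x m"
  shows "degree m \<le> field_degree \<rat> K"
proof -
  define us where "us = map (\<lambda>i. x ^ i) [0..<degree m]"
  have "CR.independent \<rat> us"
  proof (rule CR.trivial_combine_imp_independent[OF subfield_Rats])
    fix ks assume ks: "set ks \<subseteq> \<rat>" "CR.combine ks us = \<zero>\<^bsub>complex_ring\<^esub>"
    define l where "l = min (length ks) (degree m)"
    define p where "p = (\<Sum>i<l. monom (ks ! i) i)"
    have cp: "coeff p j = (if j < l then ks ! j else 0)" for j by (simp add: p_def coeff_sum_monom)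
    have "p \<in> polys_over \<rat>" using ks(1) by (auto simp: polys_over_def cp l_def)
    moreover have "poly p x = 0"
      using ks(2) by (simp add: p_def poly_sum poly_monom combine_complex us_def l_def)
    moreover have "degree p < degree m" if "p \<noteq> 0"
    proof -
      have "coeff p (degree p) \<noteq> 0" using that by simp
      then show ?thesis by (auto simp: cp l_def split: if_splits)
    qed
    ultimately have "p = 0" using m unfolding minimal_poly_def by (meson not_less)
    then have "ks ! j = 0" if "j < l" for j using cp[of j] that by simp
    then show "set (take (length us) ks) \<subseteq> {\<zero>\<^bsub>complex_ring\<^esub>}"
      by (auto simp: in_set_conv_nth us_def l_def)
  qed auto
  moreover have "set us \<subseteq> K"
    using x subfield_power[OF number_field_subfield[OF K]] by (auto simp: us_def)
  ultimately show ?thesis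
    using CR.independent_length_le_dimension[OF subfield_Rats number_field_dimension[OF K], of us]
    by (simp add: us_def)
qed

text \<open>If \<open>c\<close> avoids finitely many values, \<open>y\<close> is the only common root of the minimal polynomial
  \<open>g\<close> of \<open>y\<close> and of \<open>f(\<theta> - cX)\<close>, where \<open>\<theta> = x + cy\<close> and \<open>f(x) = 0\<close>; so the minimal polynomial
  of \<open>y\<close> over \<open>\<rat>(\<theta>)\<close>, being separable, is linear.\<close>

lemma primitive_element_two:
  assumes x: "algebraic_over \<rat> x" and y: "algebraic_over \<rat> y"
    and \<theta>alg: "\<And>c::nat. algebraic_over \<rat> (x + of_nat c * y)"
  shows "\<exists>c::nat. x \<in> simple_ext \<rat> (x + of_nat c * y) \<and> y \<in> simple_ext \<rat> (x + of_nat c * y)"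
proof -
  obtain f where f: "minimal_poly \<rat> x f" using minimal_poly_exists[OF subfield_Rats x] by blast
  obtain g where g: "minimal_poly \<rat> y g" using minimal_poly_exists[OF subfield_Rats y] by blast
  have fg: "f \<noteq> 0" "g \<noteq> 0" "f \<in> polys_over \<rat>" "g \<in> polys_over \<rat>" "poly f x = 0" "poly g y = 0"
    using f g by (auto simp: minimal_poly_def)
  \<comment> \<open>The values of \<open>c\<close> with \<open>x + c * y = s + c * t\<close> for
    some roots \<open>s\<close> and \<open>t\<close>, where \<open>t\<close> differs from
    \<open>y\<close>. Pairs with \<open>t = y\<close> contribute \<open>0\<close> through division
    by zero, which merely excludes \<open>c = 0\<close>.\<close>
  define Bad where "Bad = (\<lambda>(s,t). (s - x) / (y - t)) ` ({s. poly f s = 0} \<times> {t. poly g t = 0})"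
  have "finite Bad" using fg by (auto simp: Bad_def poly_roots_finite)
  then have "finite {c::nat. of_nat c \<in> Bad}"
    using finite_vimageI[of Bad "of_nat :: nat \<Rightarrow> complex"] by (simp add: vimage_def inj_of_nat)
  then obtain c :: nat where c: "of_nat c \<notin> Bad"
    using infinite_UNIV_nat by (metis (mono_tags) UNIV_eq_I mem_Collect_eq)
  define \<theta> where "\<theta> = x + of_nat c * y"
  define F where "F = simple_ext \<rat> \<theta>"
  have F: "subfield F complex_ring"
    unfolding F_def \<theta>_def by (rule simple_ext_subfield[OF subfield_Rats \<theta>alg])
  have \<theta>F: "\<theta> \<in> F" "\<rat> \<subseteq> F" "of_nat c \<in> F"
    using gen_in_simple_ext[OF subfield_Rats] subset_simple_ext[OF subfield_Rats] subfield_of_nat[OF F]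
    by (auto simp: F_def)
  obtain m where m: "minimal_poly F y m"
    using minimal_poly_exists[OF F algebraic_over_mono[OF \<theta>F(2) y]] by blast
  have mF: "m \<in> polys_over F" "lead_coeff m = 1" "poly m y = 0" using m by (auto simp: minimal_poly_def)
  obtain q where q: "g = q * m"
    using minimal_poly_dvd[OF F m polys_over_mono[OF \<theta>F(2) fg(4)] fg(6)] by blast
  define h where "h = pcompose f [:\<theta>, - of_nat c:]"
  have "[:\<theta>, - of_nat c:] \<in> polys_over F"
    using \<theta>F F by (intro polys_over_pCons[OF F]) (auto simp: polys_over_0 subfield_uminus)
  then have hF: "h \<in> polys_over F"
    unfolding h_def using polys_over_mono[OF \<theta>F(2) fg(3)] polys_over_pcompose[OF F] by blast
  have "poly h y = 0" using fg by (simp add: h_def poly_pcompose \<theta>_def mult.commute)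
  then obtain q' where q': "h = q' * m" using minimal_poly_dvd[OF F m hF] by blast
  have "\<rho> = y" if "poly m \<rho> = 0" for \<rho>
  proof (rule ccontr)
    assume ne: "\<rho> \<noteq> y"
    have "poly g \<rho> = 0" "poly f (\<theta> - of_nat c * \<rho>) = 0"
      using that q arg_cong[OF q', of "\<lambda>p. poly p \<rho>"] by (auto simp: h_def poly_pcompose mult.commute)
    moreover have "of_nat c = ((\<theta> - of_nat c * \<rho>) - x) / (y - \<rho>)"
      using ne by (simp add: \<theta>_def field_simps)
    ultimately have "of_nat c \<in> Bad" unfolding Bad_def by (auto intro!: image_eqI[of _ _ "(\<theta> - of_nat c * \<rho>, \<rho>)"])
    then show False using c by simp
  qed
  then have roots: "{\<rho>. poly m \<rho> = 0} = {y}" using mF(3) by blast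
  \<comment> \<open>The inclusion of \<open>F\<close> is taken as the embedding, so that the
    factorisation into distinct linear factors applies to \<open>m\<close> itself.\<close>
  have "map_poly (restrict (\<lambda>x. x) F) m = m"
    using mF(1) F by (intro poly_eqI) (auto simp: coeff_map_poly polys_over_coeff)
  then have "m = [:-y, 1:]"
    using minimal_poly_roots(1)[OF F inclusion_embedding[OF F] m] roots by simp
  then have "- y \<in> F" using polys_over_coeff[OF mF(1), of 0] by simp
  then have y: "y \<in> F" using subfield_uminus[OF F, of "-y"] by simp
  moreover have "x = \<theta> - of_nat c * y" by (simp add: \<theta>_def)
  then have "x \<in> F" using y \<theta>F F by (simp add: subfield_diff subfield_mult)
  ultimately show ?thesis unfolding F_def \<theta>_def by blast
qed

text \<open>A finite spanning list is absorbed one element at a time by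
  \<open>primitive_element_two\<close>.\<close>

theorem primitive_element:
  assumes K: "number_field K"
  shows "\<exists>\<theta>\<in>K. K = simple_ext \<rat> \<theta>"
proof -
  note S = number_field_subfield[OF K]
  obtain us where us: "CR.Span \<rat> us = K" "set us \<subseteq> UNIV"
    using CR.exists_base[OF subfield_Rats number_field_dimension[OF K]] by auto
  have usK: "set us \<subseteq> K" using CR.Span_base_incl[OF subfield_Rats, of us] us by simp
  then have "\<exists>\<theta>\<in>K. set us \<subseteq> simple_ext \<rat> \<theta>"
  proof (induction us)
    case Nil
    then show ?case using S by (intro bexI[of _ 0]) auto
  next
    case (Cons u us)
    then obtain \<theta> where \<theta>: "\<theta> \<in> K" "set us \<subseteq> simple_ext \<rat> \<theta>" by auto
    have mem: "u + of_nat c * \<theta> \<in> K" for c :: nat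
      using \<theta> Cons.prems S by (auto intro: subfield_closed)
    obtain c :: nat where c: "u \<in> simple_ext \<rat> (u + of_nat c * \<theta>)" "\<theta> \<in> simple_ext \<rat> (u + of_nat c * \<theta>)"
      using primitive_element_two[of u \<theta>] number_field_algebraic[OF K] mem \<theta> Cons.prems by auto
    have "subfield (simple_ext \<rat> (u + of_nat c * \<theta>)) complex_ring"
      using simple_ext_subfield[OF subfield_Rats] number_field_algebraic[OF K] mem by blast
    then have "simple_ext \<rat> \<theta> \<subseteq> simple_ext \<rat> (u + of_nat c * \<theta>)"
      using simple_ext_minimal[OF subfield_Rats] c subset_simple_ext[OF subfield_Rats] by blast
    then show ?case using \<theta> c mem by (intro bexI[of _ "u + of_nat c * \<theta>"]) auto
  qed
  then obtain \<theta> where \<theta>: "\<theta> \<in> K" "set us \<subseteq> simple_ext \<rat> \<theta>" by auto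
  have sub: "subfield (simple_ext \<rat> \<theta>) complex_ring"
    using simple_ext_subfield[OF subfield_Rats] number_field_algebraic[OF K] \<theta> by blast
  have "K \<subseteq> simple_ext \<rat> \<theta>"
  proof
    fix v assume "v \<in> K"
    then obtain ks where ks: "set ks \<subseteq> \<rat>" "v = CR.combine ks us"
      using CR.Span_eq_combine_set[OF subfield_Rats, of us] us by auto
    show "v \<in> simple_ext \<rat> \<theta>"
      unfolding ks(2) combine_complex
      using ks(1) \<theta>(2) subset_simple_ext[OF subfield_Rats]
      by (intro subfield_sum[OF sub] subfield_mult[OF sub]) (auto simp: subset_iff)
  qed
  moreover have "simple_ext \<rat> \<theta> \<subseteq> K"
    by (rule simple_ext_minimal[OF subfield_Rats S Rats_subset_subfield[OF S] \<theta>(1)])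
  ultimately show ?thesis using \<theta>(1) by blast
qed

lemma bij_betw_field_embeddings:
  assumes m: "minimal_poly \<rat> \<theta> m"
  shows "bij_betw (\<lambda>\<sigma>. \<sigma> \<theta>) (field_embeddings (simple_ext \<rat> \<theta>)) {\<rho>. poly m \<rho> = 0}"
    and "m = (\<Prod>\<rho>\<in>{\<rho>. poly m \<rho> = 0}. [:-\<rho>, 1:])"
    and "card (field_embeddings (simple_ext \<rat> \<theta>)) = degree m"
proof -
  let ?K = "simple_ext \<rat> \<theta>" and ?i = "restrict (\<lambda>x. x) \<rat> :: complex \<Rightarrow> complex"
  note i = inclusion_embedding[OF subfield_Rats]
  have mr: "m \<in> polys_over \<rat>" "poly m \<theta> = 0" using m by (auto simp: minimal_poly_def)
  have mm: "map_poly ?i m = m" by (rule map_poly_embedding_Rats[OF subfield_Rats i mr(1)])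
  have K: "subfield ?K complex_ring"
    using simple_ext_subfield[OF subfield_Rats simple_ext_algebraic[OF subfield_Rats i m]] .
  have \<tau>p: "\<tau> (poly p \<theta>) = poly p (\<tau> \<theta>)" if "\<tau> \<in> field_embeddings ?K" "p \<in> polys_over \<rat>" for \<tau> p
    using embedding_poly[OF K that(1), of p \<theta>] map_poly_embedding_Rats[OF K that]
      polys_over_mono[OF subset_simple_ext[OF subfield_Rats] that(2)] gen_in_simple_ext[OF subfield_Rats]
    by simp
  have inj: "inj_on (\<lambda>\<sigma>. \<sigma> \<theta>) (field_embeddings ?K)"
    by (intro inj_onI embedding_ext[of _ ?K]) (auto simp: simple_ext_def \<tau>p)
  have "(\<lambda>\<sigma>. \<sigma> \<theta>) ` field_embeddings ?K = {\<rho>. poly m \<rho> = 0}"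
    using \<tau>p[OF _ mr(1)] mr embedding_0[OF K] embedding_extends[OF subfield_Rats i m] mm
    by (auto simp: image_iff) metis+
  with inj show bij: "bij_betw (\<lambda>\<sigma>. \<sigma> \<theta>) (field_embeddings ?K) {\<rho>. poly m \<rho> = 0}"
    by (simp add: bij_betw_def)
  show "m = (\<Prod>\<rho>\<in>{\<rho>. poly m \<rho> = 0}. [:-\<rho>, 1:])"
    using minimal_poly_roots(1)[OF subfield_Rats i m] mm by simp
  show "card (field_embeddings ?K) = degree m"
    using minimal_poly_roots(2)[OF subfield_Rats i m] mm bij_betw_same_card[OF bij] by simp
qed

lemma field_embeddings_finite_card:
  assumes K: "number_field K"
  shows "finite (field_embeddings K)" "field_embeddings K \<noteq> {}" "card (field_embeddings K) > 0"
    "card (field_embeddings K) \<le> field_degree \<rat> K"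
proof -
  obtain \<theta> where \<theta>: "\<theta> \<in> K" "K = simple_ext \<rat> \<theta>" using primitive_element[OF K] by blast
  obtain m where m: "minimal_poly \<rat> \<theta> m"
    using minimal_poly_exists[OF subfield_Rats number_field_algebraic[OF K \<theta>(1)]] by blast
  have card: "card (field_embeddings K) = degree m"
    using bij_betw_field_embeddings(3)[OF m] \<theta> by simp
  then show pos: "card (field_embeddings K) > 0"
    using minimal_poly_degree_pos[OF subfield_Rats m] by simp
  then show "finite (field_embeddings K)" "field_embeddings K \<noteq> {}"
    by (auto intro: card_ge_0_finite)
  show "card (field_embeddings K) \<le> field_degree \<rat> K"
    using minimal_poly_degree_le[OF K \<theta>(1) m] card by simp
qed

subsection \<open>The norm\<close>

lemma prod_mset_prod_mset_swap:
  fixes f :: "'a \<Rightarrow> 'b \<Rightarrow> 'c :: comm_monoid_mult"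
  shows "(\<Prod>a\<in>#A. \<Prod>b\<in>#B. f a b) = (\<Prod>b\<in>#B. \<Prod>a\<in>#A. f a b)"
  by (induction A) (auto simp: prod_mset.distrib)

lemma poly_prod_mset_linear: "poly (\<Prod>b\<in>#B. [:-b, 1:]) x = (\<Prod>b\<in>#B. x - b)"
  for x :: "'a :: comm_ring_1"
  by (induction B) (auto simp: algebra_simps)

text \<open>The resultant \<open>\<Prod>P(a)\<close> over the roots \<open>a\<close> of \<open>f\<close> is computed by the Euclidean algorithm: up
  to a rational factor it equals \<open>\<Prod>f(b)\<close> over the roots \<open>b\<close> of \<open>P\<close>, and there \<open>f\<close> may be
  replaced by its remainder modulo \<open>P\<close>.\<close>

lemma prod_roots_Rats:
  assumes "f \<in> polys_over \<rat>" "P \<in> polys_over \<rat>" "c \<noteq> 0" "f = smult c (\<Prod>a\<in>#A. [:-a, 1:])"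
  shows "(\<Prod>a\<in>#A. poly P a) \<in> \<rat>"
  using assms
proof (induction "degree P" arbitrary: f P A c rule: less_induct)
  case less
  show ?case
  proof (cases "degree P = 0")
    case True
    then obtain k where k: "P = [:k:]" by (auto elim: degree_eq_zeroE)
    have "k \<in> \<rat>" using polys_over_coeff[OF less.prems(2), of 0] k by simp
    have "(\<Prod>a\<in>#A. poly P a) = k ^ size A" by (induction A) (auto simp: k)
    then show ?thesis using \<open>k \<in> \<rat>\<close> by simp
  next
    case False
    then have P0: "P \<noteq> 0" by auto
    then obtain B where B: "P = smult (lead_coeff P) (\<Prod>b\<in>#B. [:-b, 1:])"
      using alg_closed_imp_factorization by metis
    define l where "l = lead_coeff P"
    have l: "l \<in> \<rat>" "l \<noteq> 0" using less.prems(2) P0 by (auto simp: l_def polys_over_coeff)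
    obtain q r where qr: "q \<in> polys_over \<rat>" "r \<in> polys_over \<rat>" "f = q * P + r" "r = 0 \<or> degree r < degree P"
      using polys_over_division[OF subfield_Rats less.prems(2) P0 less.prems(1)] by blast
    have deg: "degree r < degree P" using qr(4) False by auto
    have IH: "(\<Prod>b\<in>#B. poly r b) \<in> \<rat>"
      by (rule less.hyps[OF deg less.prems(2) qr(2) l(2)]) (use B in \<open>simp add: l_def\<close>)
    have lc: "lead_coeff (\<Prod>a\<in>#A. [:-a, 1:]) = 1"
      by (induction A) (simp_all add: lead_coeff_mult del: mult_pCons_left)
    have "lead_coeff f = c" unfolding less.prems(4) using lc by (simp add: lead_coeff_smult)
    then have c: "c \<in> \<rat>" using less.prems(1) polys_over_coeff by blast
    have Pb: "poly P b = 0" if "b \<in># B" for b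
      using that by (subst B) (auto simp: poly_prod_mset_linear prod_mset_zero_iff)
    have fb: "(\<Prod>a\<in>#A. a - b) = (-1) ^ size A * (poly r b / c)" if b: "b \<in># B" for b
    proof -
      have "poly r b = poly f b" using qr(3) Pb[OF b] by simp
      also have "\<dots> = c * (\<Prod>a\<in>#A. b - a)" by (subst less.prems(4)) (simp add: poly_prod_mset_linear)
      finally have "(\<Prod>a\<in>#A. b - a) = poly r b / c" using less.prems(3) by simp
      moreover have "(\<Prod>a\<in>#A. a - b) = (-1) ^ size A * (\<Prod>a\<in>#A. b - a)"
        by (induction A) (auto simp: algebra_simps)
      ultimately show ?thesis by simp
    qed
    have Pv: "poly P a = l * (\<Prod>b\<in>#B. a - b)" for a
      using arg_cong[OF B, of "\<lambda>p. poly p a"] by (simp add: poly_prod_mset_linear l_def)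
    have "(\<Prod>a\<in>#A. poly P a) = (\<Prod>a\<in>#A. l * (\<Prod>b\<in>#B. a - b))"
      by (intro arg_cong[of _ _ prod_mset] image_mset_cong) (rule Pv)
    also have "\<dots> = l ^ size A * (\<Prod>b\<in>#B. \<Prod>a\<in>#A. a - b)"
      by (simp add: prod_mset.distrib prod_mset_prod_mset_swap[of _ A] prod_mset_constant)
    also have "(\<Prod>b\<in>#B. \<Prod>a\<in>#A. a - b) = (\<Prod>b\<in>#B. (-1) ^ size A / c * poly r b)"
      by (intro arg_cong[of _ _ prod_mset] image_mset_cong) (simp add: fb)
    also have "\<dots> = ((-1) ^ size A / c) ^ size B * (\<Prod>b\<in>#B. poly r b)"
      by (induction B) simp_all
    finally show ?thesis using IH c l by simp
  qed
qed

text \<open>For \<open>x = poly p \<theta>\<close> with \<theta> primitive, the conjugates of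
  \<open>x\<close> are the values of \<open>p\<close> at the roots of the minimal polynomial of
  \<theta>. Their product is a resultant of rational polynomials, which shows rationality without a
  normal closure.\<close>

lemma field_norm_Rats:
  assumes K: "number_field K" and x: "x \<in> K"
  shows "field_norm K x \<in> \<rat>"
proof -
  obtain \<theta> where \<theta>: "\<theta> \<in> K" "K = simple_ext \<rat> \<theta>" using primitive_element[OF K] by blast
  obtain m where m: "minimal_poly \<rat> \<theta> m"
    using minimal_poly_exists[OF subfield_Rats number_field_algebraic[OF K \<theta>(1)]] by blast
  note bij = bij_betw_field_embeddings[OF m, folded \<theta>(2)]
  obtain p where p: "p \<in> polys_over \<rat>" "x = poly p \<theta>" using x \<theta>(2) by (auto simp: simple_ext_def)
  note S = number_field_subfield[OF K]
  have "\<sigma> x = poly p (\<sigma> \<theta>)" if "\<sigma> \<in> field_embeddings K" for \<sigma>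
    using embedding_poly[OF S that, of p \<theta>] map_poly_embedding_Rats[OF S that p(1)]
      polys_over_mono[OF Rats_subset_subfield[OF S] p(1)] \<theta>(1) p(2) by simp
  then have "field_norm K x = (\<Prod>\<sigma>\<in>field_embeddings K. poly p (\<sigma> \<theta>))"
    unfolding field_norm_def by (intro prod.cong) auto
  also have "\<dots> = (\<Prod>\<rho>\<in>{\<rho>. poly m \<rho> = 0}. poly p \<rho>)"
    by (rule prod.reindex_bij_betw[OF bij(1)])
  also have "\<dots> = (\<Prod>\<rho>\<in>#mset_set {\<rho>. poly m \<rho> = 0}. poly p \<rho>)"
    by (simp add: prod_unfold_prod_mset)
  also have "\<dots> \<in> \<rat>"
    by (rule prod_roots_Rats[of m _ 1])
      (use m p bij(2) in \<open>auto simp: minimal_poly_def prod_unfold_prod_mset\<close>)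
  finally show ?thesis .
qed

text \<open>The norm is a rational algebraic integer, hence an integer, and it is not zero. This is
  the arithmetic lower bound behind the counts and the height estimate.\<close>

lemma norm_ge_1:
  assumes K: "number_field K" and x: "x \<in> ring_of_ints K" "x \<noteq> 0"
  shows "(\<Prod>\<sigma>\<in>field_embeddings K. cmod (\<sigma> x)) \<ge> 1"
proof -
  note S = number_field_subfield[OF K]
  have xK: "x \<in> K" "algebraic_int x" using x by (auto simp: ring_of_ints_def)
  have "algebraic_int (field_norm K x)"
    unfolding field_norm_def using embedding_algebraic_int[OF S _ xK] by blast
  then have "field_norm K x \<in> \<int>"
    using field_norm_Rats[OF K xK(1)] rational_algebraic_int_is_int by blast
  then obtain k where k: "field_norm K x = of_int k" by (auto elim: Ints_cases)
  have "field_norm K x \<noteq> 0"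
    unfolding field_norm_def using embedding_eq_0_iff[OF S _ xK(1)] x field_embeddings_finite_card(1)[OF K]
    by auto
  then have "k \<noteq> 0" using k by auto
  then have "cmod (field_norm K x) \<ge> 1" by (simp add: k)
  then show ?thesis by (simp add: field_norm_def prod_norm)
qed

section \<open>Complex conjugation in CM-fields, and embeddings in a tower\<close>

lemma embedding_real:
  assumes "number_field K" "totally_real K" "K \<subseteq> L" "subfield L complex_ring"
    and "\<tau> \<in> field_embeddings L" "x \<in> K"
  shows "\<tau> x \<in> \<real>"
  using embedding_restrict[OF assms(4,5) number_field_subfield[OF assms(1)] assms(3)] assms(2,6)
  unfolding totally_real_def by (fastforce simp: image_subset_iff)

lemma totally_real_subset_Reals:
  assumes "number_field K" "totally_real K"
  shows "K \<subseteq> \<real>"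
  using inclusion_embedding[OF number_field_subfield[OF assms(1)]] assms(2)
  unfolding totally_real_def by (fastforce simp: image_subset_iff)

lemma nonreal_quadratic_cnj:
  fixes z p q :: complex
  assumes "z\<^sup>2 = q + p * z" "p \<in> \<real>" "q \<in> \<real>" "z \<notin> \<real>"
  shows "cnj z = p - z"
proof -
  have "(cnj z)\<^sup>2 = q + p * cnj z"
    using arg_cong[OF assms(1), of cnj] assms(2,3) by (simp add: Reals_cnj_iff)
  then have "(z - cnj z) * (z + cnj z - p) = 0"
    using assms(1) by (simp add: power2_eq_square algebra_simps)
  moreover have "z \<noteq> cnj z" using assms(4) by (metis Reals_cnj_iff)
  ultimately have "z + cnj z - p = 0" by simp
  then show ?thesis by (simp add: algebra_simps)
qed

text \<open>\<open>L\<close> is spanned over \<open>L0\<close> by \<open>1\<close> and a nonreal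
  \<gamma>, and conjugation is the \<open>L0\<close>-linear map sending \<gamma> to
  \<open>p - \<gamma>\<close> with \<open>p\<close> in \<open>L0\<close>. The image of \<gamma>
  under \<tau> is again nonreal and satisfies the image of the quadratic equation, whose
  coefficients are real, so its conjugate is given by the same formula.\<close>

lemma CM_field_cnj:
  assumes L: "CM_field L" and z: "z \<in> L"
  shows "cnj z \<in> L" and "\<And>\<tau>. \<tau> \<in> field_embeddings L \<Longrightarrow> \<tau> (cnj z) = cnj (\<tau> z)"
proof -
  obtain L0 where L0: "number_field L0" "totally_real L0" "L0 \<subseteq> L"
      "CR.finite_dimension L0 L" "field_degree L0 L = 2"
    using L by (auto simp: CM_field_def)
  have SL: "subfield L complex_ring" and SL0: "subfield L0 complex_ring"
    using L L0 by (auto simp: CM_field_def number_field_def)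
  have dim: "CR.dimension 2 L0 L"
    using CR.finite_dimensionE[OF SL0 L0(4)] L0(5) by (simp add: field_degree_def over_def)
  have real: "L0 \<subseteq> \<real>" by (rule totally_real_subset_Reals[OF L0(1,2)])
  obtain \<gamma> where \<gamma>: "\<gamma> \<in> L" "\<gamma> \<notin> \<real>"
    using L inclusion_embedding[OF SL] unfolding CM_field_def totally_imaginary_def by fastforce
  have rep: "\<exists>u\<in>L0. \<exists>v\<in>L0. z = u + v * \<gamma>" if "z \<in> L" for z
  proof -
    have "set [1, \<gamma>, z] \<subseteq> L" using that \<gamma> SL by simp
    from dimension_dependent[OF SL0 dim this]
    obtain c :: "nat \<Rightarrow> complex" where c: "\<forall>i. c i \<in> L0" "\<exists>i<3. c i \<noteq> 0" "c 0 + c 1 * \<gamma> + c 2 * z = 0"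
      by (auto simp: numeral_3_eq_3 numeral_2_eq_2)
    have c2: "c 2 \<noteq> 0"
    proof
      assume 2: "c 2 = 0"
      then have eq: "c 0 + c 1 * \<gamma> = 0" using c(3) by simp
      have "c 1 = 0"
      proof (rule ccontr)
        assume "c 1 \<noteq> 0"
        then have "\<gamma> = - c 0 / c 1" using eq by (simp add: field_simps eq_neg_iff_add_eq_0)
        then show False using \<gamma>(2) c(1) real by (auto simp: subset_iff)
      qed
      then show False using eq 2 c(2) by (auto simp: less_Suc_eq numeral_3_eq_3 numeral_2_eq_2)
    qed
    have "z = - c 0 / c 2 + (- c 1 / c 2) * \<gamma>"
      using c(3) c2 by (simp add: field_simps eq_neg_iff_add_eq_0)
    then show ?thesis using c(1) SL0 by (metis subfield_divide subfield_uminus)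
  qed
  obtain q p where pq: "q \<in> L0" "p \<in> L0" "\<gamma>\<^sup>2 = q + p * \<gamma>"
    using rep[of "\<gamma>\<^sup>2"] \<gamma> SL by (auto simp: subfield_power)
  have cnj\<gamma>: "cnj \<gamma> = p - \<gamma>"
    using nonreal_quadratic_cnj[OF pq(3)] pq real \<gamma> by auto
  obtain u v where uv: "u \<in> L0" "v \<in> L0" "z = u + v * \<gamma>" using rep[OF z] by blast
  have cnjz: "cnj z = u + v * (p - \<gamma>)"
    using uv real cnj\<gamma> by (auto simp: Reals_cnj_iff subset_iff)
  show "cnj z \<in> L"
    unfolding cnjz using uv pq L0(3) \<gamma> by (auto intro!: subfield_closed[OF SL])
  fix \<tau> assume \<tau>: "\<tau> \<in> field_embeddings L"
  have \<tau>real: "\<tau> x \<in> \<real>" if "x \<in> L0" for x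
    by (rule embedding_real[OF L0(1-3) SL \<tau> that])
  have mem: "x \<in> L" if "x \<in> L0" for x using that L0(3) by blast
  note hom = embedding_add[OF SL \<tau>] embedding_mult[OF SL \<tau>] embedding_diff[OF SL \<tau>] embedding_power[OF SL \<tau>]
  note cl = subfield_add[OF SL] subfield_mult[OF SL] subfield_diff[OF SL]
  \<comment> \<open>Otherwise \<tau> would map all of \<open>L\<close> into \<real>, while
    \<open>L\<close> is totally imaginary.\<close>
  have "\<tau> \<gamma> \<notin> \<real>"
  proof
    assume r: "\<tau> \<gamma> \<in> \<real>"
    have "\<tau> w \<in> \<real>" if w: "w \<in> L" for w
    proof -
      obtain u v where "u \<in> L0" "v \<in> L0" "w = u + v * \<gamma>" using rep[OF w] by blast
      then show ?thesis using r \<tau>real \<gamma> mem by (simp add: hom cl)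
    qed
    then show False using L \<tau> unfolding CM_field_def totally_imaginary_def by blast
  qed
  moreover have "(\<tau> \<gamma>)\<^sup>2 = \<tau> q + \<tau> p * \<tau> \<gamma>"
    using arg_cong[OF pq(3), of \<tau>] pq(1,2) \<gamma> mem by (simp add: hom cl)
  ultimately have "cnj (\<tau> \<gamma>) = \<tau> p - \<tau> \<gamma>"
    using nonreal_quadratic_cnj \<tau>real pq by blast
  moreover have "cnj (\<tau> u) = \<tau> u" "cnj (\<tau> v) = \<tau> v" using \<tau>real uv by (auto simp: Reals_cnj_iff)
  moreover have "\<tau> (cnj z) = \<tau> u + \<tau> v * (\<tau> p - \<tau> \<gamma>)"
    unfolding cnjz using uv(1,2) pq(1,2) \<gamma>(1) mem by (simp add: hom cl)
  moreover have "\<tau> z = \<tau> u + \<tau> v * \<tau> \<gamma>"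
    unfolding uv(3) using uv(1,2) \<gamma>(1) mem by (simp add: hom cl)
  ultimately show "\<tau> (cnj z) = cnj (\<tau> z)" by simp
qed

lemma embedding_generator_nonreal:
  assumes K: "number_field K" "totally_real K" and alg: "algebraic_over K \<alpha>"
    and L: "totally_imaginary (simple_ext K \<alpha>)" and \<tau>: "\<tau> \<in> field_embeddings (simple_ext K \<alpha>)"
  shows "\<tau> \<alpha> \<notin> \<real>"
proof
  assume r: "\<tau> \<alpha> \<in> \<real>"
  note SK = number_field_subfield[OF K(1)]
  note SL = simple_ext_subfield[OF SK alg]
  have "\<tau> (poly p \<alpha>) \<in> \<real>" if p: "p \<in> polys_over K" for p
  proof -
    have "\<tau> (poly p \<alpha>) = poly (map_poly \<tau> p) (\<tau> \<alpha>)"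
      by (rule embedding_poly[OF SL \<tau> polys_over_mono[OF subset_simple_ext[OF SK] p] gen_in_simple_ext[OF SK]])
    also have "\<dots> = (\<Sum>i\<le>degree (map_poly \<tau> p). \<tau> (coeff p i) * \<tau> \<alpha> ^ i)"
      by (simp add: poly_altdef coeff_map_poly embedding_0[OF SL \<tau>])
    also have "\<dots> \<in> \<real>"
      using r embedding_real[OF K subset_simple_ext[OF SK] SL \<tau>] polys_over_coeff[OF p]
      by (intro sum_in_Reals Reals_mult Reals_power) auto
    finally show ?thesis .
  qed
  then have "\<tau> ` simple_ext K \<alpha> \<subseteq> \<real>" by (auto simp: simple_ext_def)
  then show False using L \<tau> by (auto simp: totally_imaginary_def)
qed

text \<open>The embeddings of the large field are grouped by their restriction to \<open>K\<close>,
  and each group has \<open>degree m\<close> members. An estimate over the large field for data from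
  \<open>K\<close> is thus a power of an estimate over \<open>K\<close>, from which the root can be
  taken.\<close>

lemma prod_embeddings_tower:
  fixes g :: "(complex \<Rightarrow> complex) \<Rightarrow> 'a :: comm_semiring_1"
  assumes K: "number_field K" and m: "minimal_poly K \<alpha> m" and L: "number_field (simple_ext K \<alpha>)"
  shows "(\<Prod>\<tau>\<in>field_embeddings (simple_ext K \<alpha>). g (restrict \<tau> K)) = (\<Prod>\<sigma>\<in>field_embeddings K. g \<sigma>) ^ degree m"
proof -
  let ?L = "simple_ext K \<alpha>"
  note SK = number_field_subfield[OF K] and SL = number_field_subfield[OF L]
  have sub: "K \<subseteq> ?L" by (rule subset_simple_ext[OF SK])
  have fibre: "{\<tau>\<in>field_embeddings ?L. restrict \<tau> K = \<sigma>} = {\<tau>\<in>field_embeddings ?L. \<forall>z\<in>K. \<tau> z = \<sigma> z}"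
    if \<sigma>: "\<sigma> \<in> field_embeddings K" for \<sigma>
  proof -
    have "restrict \<tau> K = \<sigma> \<longleftrightarrow> (\<forall>z\<in>K. \<tau> z = \<sigma> z)" if \<tau>: "\<tau> \<in> field_embeddings ?L" for \<tau>
    proof
      assume "restrict \<tau> K = \<sigma>"
      then show "\<forall>z\<in>K. \<tau> z = \<sigma> z" by (metis restrict_apply')
    next
      assume "\<forall>z\<in>K. \<tau> z = \<sigma> z"
      then show "restrict \<tau> K = \<sigma>"
        using embedding_ext[OF embedding_restrict[OF SL \<tau> SK sub] \<sigma>] by simp
    qed
    then show ?thesis by blast
  qed
  have "(\<Prod>\<tau>\<in>field_embeddings ?L. g (restrict \<tau> K))
      = (\<Prod>\<sigma>\<in>field_embeddings K. \<Prod>\<tau>\<in>{\<tau>\<in>field_embeddings ?L. restrict \<tau> K = \<sigma>}. g (restrict \<tau> K))"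
    using embedding_restrict[OF SL _ SK sub]
    by (intro prod.group[symmetric] field_embeddings_finite_card K L) auto
  also have "\<dots> = (\<Prod>\<sigma>\<in>field_embeddings K. g \<sigma> ^ degree m)"
  proof (rule prod.cong[OF refl])
    fix \<sigma> assume \<sigma>: "\<sigma> \<in> field_embeddings K"
    have "(\<Prod>\<tau>\<in>{\<tau>\<in>field_embeddings ?L. restrict \<tau> K = \<sigma>}. g (restrict \<tau> K))
        = (\<Prod>\<tau>\<in>{\<tau>\<in>field_embeddings ?L. restrict \<tau> K = \<sigma>}. g \<sigma>)"
      by (intro prod.cong) auto
    also have "\<dots> = g \<sigma> ^ degree m"
      unfolding prod_constant fibre[OF \<sigma>] using card_embedding_extensions(1)[OF SK \<sigma> m] by simp
    finally show "(\<Prod>\<tau>\<in>{\<tau>\<in>field_embeddings ?L. restrict \<tau> K = \<sigma>}. g (restrict \<tau> K)) = g \<sigma> ^ degree m" .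
  qed
  finally show ?thesis by (simp add: prod_power_distrib)
qed

lemma card_embeddings_tower:
  assumes K: "number_field K" and m: "minimal_poly K \<alpha> m" and L: "number_field (simple_ext K \<alpha>)"
  shows "card (field_embeddings (simple_ext K \<alpha>)) = card (field_embeddings K) * degree m"
proof -
  \<comment> \<open>The product formula for the constant function \<open>2\<close> counts embeddings
    in the exponents.\<close>
  have "(2::nat) ^ card (field_embeddings (simple_ext K \<alpha>)) = 2 ^ (card (field_embeddings K) * degree m)"
    using prod_embeddings_tower[OF assms, of "\<lambda>_. 2::nat"] by (simp add: power_mult)
  then show ?thesis by (metis one_less_numeral_iff power_inject_exp semiring_norm(76))
qed

section \<open>Counting integers by their conjugates\<close>

lemma prod_less_one:
  fixes f :: "'a \<Rightarrow> real"
  assumes "finite A" "A \<noteq> {}" "\<And>x. x \<in> A \<Longrightarrow> 0 \<le> f x" "\<And>x. x \<in> A \<Longrightarrow> f x < 1"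
  shows "(\<Prod>x\<in>A. f x) < 1"
  using assms
proof (induction A rule: finite_ne_induct)
  case (insert x F)
  have "f x * (\<Prod>x\<in>F. f x) \<le> f x * 1"
    using insert by (intro mult_left_mono) auto
  also have "\<dots> < 1" using insert by auto
  finally show ?case using insert by simp
qed auto

lemma ring_of_ints_closed:
  assumes "number_field K" "x \<in> ring_of_ints K" "y \<in> ring_of_ints K"
  shows "x + y \<in> ring_of_ints K" "x - y \<in> ring_of_ints K" "x * y \<in> ring_of_ints K" "x ^ k \<in> ring_of_ints K"
  using assms number_field_subfield[OF assms(1)]
  by (auto simp: ring_of_ints_def intro: subfield_closed)

lemma floor_eq_imp_abs_less:
  fixes x y c :: real
  assumes "\<lfloor>c * x\<rfloor> = \<lfloor>c * y\<rfloor>" "c > 0"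
  shows "\<bar>x - y\<bar> < 1 / c"
proof -
  have "\<bar>c * x - c * y\<bar> < 1" using assms(1) by linarith
  then have "c * \<bar>x - y\<bar> < 1" using assms(2) by (simp add: abs_mult flip: right_diff_distrib)
  then show ?thesis using assms(2) by (simp add: field_simps)
qed

text \<open>Conjugate embeddings share one complex number: one of them records its real part, the other
  its imaginary part, each up to an error below \<open>2/3\<close>. Two integers with the same record differ by an
  integer all of whose conjugates have absolute value below \<open>1\<close>.\<close>

lemma card_integers_in_unit_polydisc:
  assumes L: "number_field L" and \<gamma>: "\<gamma> \<in> L" "\<And>\<tau>. \<tau> \<in> field_embeddings L \<Longrightarrow> \<tau> \<gamma> \<notin> \<real>"
  defines "T \<equiv> {z \<in> ring_of_ints L. \<forall>\<tau>\<in>field_embeddings L. cmod (\<tau> z) \<le> 1}"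
  shows "finite T" "card T \<le> 4 ^ card (field_embeddings L)"
proof -
  let ?E = "field_embeddings L"
  note SL = number_field_subfield[OF L] and E = field_embeddings_finite_card[OF L]
  \<comment> \<open>The sign of the imaginary part at \<gamma> tells an embedding from its
    conjugate.\<close>
  define h where "h = (\<lambda>\<tau> z. if Im (\<tau> \<gamma>) > 0 then Re (\<tau> z) else Im (\<tau> z :: complex))"
  \<comment> \<open>The factor \<open>3/2\<close> gives cells of side 2/3. Real and imaginary parts
    that differ by less than 2/3 give a squared modulus of at most 8/9 < 1, while a coordinate in
    [-1, 1] meets only the four floors -2, -1, 0, 1: this is the origin of the base 4.\<close>
  define cell where "cell = (\<lambda>z. \<lambda>\<tau>\<in>?E. \<lfloor>3/2 * h \<tau> z\<rfloor>)"
  have inj: "inj_on cell T"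
  proof (rule inj_onI, rule ccontr)
    fix z z' assume z: "z \<in> T" "z' \<in> T" "cell z = cell z'" "z \<noteq> z'"
    have zL: "z \<in> L" "z' \<in> L" "z - z' \<in> ring_of_ints L"
      using z ring_of_ints_closed[OF L] by (auto simp: T_def ring_of_ints_def)
    have close: "\<bar>h \<tau> z - h \<tau> z'\<bar> < 2/3" if "\<tau> \<in> ?E" for \<tau>
      using floor_eq_imp_abs_less[of "3/2" "h \<tau> z" "h \<tau> z'"] fun_cong[OF z(3), of \<tau>] that
      by (simp add: cell_def)
    have small: "cmod (\<tau> (z - z')) < 1" if \<tau>: "\<tau> \<in> ?E" for \<tau>
    proof -
      define \<tau>' where "\<tau>' = restrict (\<lambda>x. cnj (\<tau> x)) L"
      have \<tau>': "\<tau>' \<in> ?E" unfolding \<tau>'_def by (rule embedding_cnj[OF SL \<tau>])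
      have "Im (\<tau> \<gamma>) \<noteq> 0" using \<gamma>(2)[OF \<tau>] by (auto simp: complex_is_Real_iff)
      then have "\<bar>Re (\<tau> z - \<tau> z')\<bar> < 2/3" "\<bar>Im (\<tau> z - \<tau> z')\<bar> < 2/3"
        using close[OF \<tau>] close[OF \<tau>'] \<gamma>(1) zL by (auto simp: h_def \<tau>'_def abs_minus_commute split: if_splits)
      then have "(Re (\<tau> z - \<tau> z'))\<^sup>2 \<le> (2/3)\<^sup>2" "(Im (\<tau> z - \<tau> z'))\<^sup>2 \<le> (2/3)\<^sup>2"
        by (auto intro!: abs_le_square_iff[THEN iffD1])
      then have "(cmod (\<tau> z - \<tau> z'))\<^sup>2 < 1\<^sup>2"
        unfolding cmod_power2 by (simp add: power2_eq_square)
      then show ?thesis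
        using embedding_diff[OF SL \<tau> zL(1,2)] power2_less_imp_less[of "cmod (\<tau> z - \<tau> z')" 1] by simp
    qed
    have "(\<Prod>\<tau>\<in>?E. cmod (\<tau> (z - z'))) < 1"
      using E small by (intro prod_less_one) auto
    then show False using norm_ge_1[OF L zL(3)] z(4) by simp
  qed
  have sub: "cell ` T \<subseteq> (\<Pi>\<^sub>E \<tau>\<in>?E. {-2..1})"
  proof (rule image_subsetI)
    fix z assume z: "z \<in> T"
    have "- 2 \<le> \<lfloor>3/2 * h \<tau> z\<rfloor> \<and> \<lfloor>3/2 * h \<tau> z\<rfloor> \<le> 1" if \<tau>: "\<tau> \<in> ?E" for \<tau>
    proof -
      have "cmod (\<tau> z) \<le> 1" using z \<tau> by (auto simp: T_def)
      then have "\<bar>h \<tau> z\<bar> \<le> 1"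
        using abs_Re_le_cmod[of "\<tau> z"] abs_Im_le_cmod[of "\<tau> z"] by (auto simp: h_def)
      then show ?thesis by linarith
    qed
    then show "cell z \<in> (\<Pi>\<^sub>E \<tau>\<in>?E. {-2..1})"
      unfolding cell_def restrict_PiE_iff atLeastAtMost_iff by blast
  qed
  have fin: "finite (\<Pi>\<^sub>E \<tau>\<in>?E. {-2..1::int})" using E by (intro finite_PiE) auto
  show "finite T" using inj sub fin by (metis finite_imageD finite_subset)
  have "card T \<le> card (\<Pi>\<^sub>E \<tau>\<in>?E. {-2..1::int})" by (rule card_inj_on_le[OF inj sub fin])
  also have "\<dots> = 4 ^ card ?E" using E by (simp add: card_PiE)
  finally show "card T \<le> 4 ^ card ?E" .
qed

text \<open>Some multiple \<eta> of a primitive element is integral, and every \<open>z\<close> is a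
  rational polynomial in \<eta> of bounded degree. Rounding its coefficients down leaves
  coefficients in [0, 1), so the error is bounded by the conjugates of \<eta> alone.\<close>

lemma integers_cover_number_field:
  assumes K: "number_field K"
  shows "\<exists>C\<ge>0. \<forall>z\<in>K. \<exists>y\<in>ring_of_ints K. \<forall>\<sigma>\<in>field_embeddings K. cmod (\<sigma> (z - y)) \<le> C"
proof -
  note S = number_field_subfield[OF K]
  obtain \<theta> where \<theta>: "\<theta> \<in> K" "K = simple_ext \<rat> \<theta>" using primitive_element[OF K] by blast
  obtain m where m: "minimal_poly \<rat> \<theta> m"
    using minimal_poly_exists[OF subfield_Rats number_field_algebraic[OF K \<theta>(1)]] by blast
  obtain p where p: "\<And>i. coeff p i \<in> \<int>" "p \<noteq> 0" "poly p \<theta> = 0"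
    using number_field_algebraic[OF K \<theta>(1)] algebraic_over_Rats_iff algebraicE by metis
  define t where "t = lead_coeff p"
  have t: "t \<in> \<int>" "t \<noteq> 0" using p by (auto simp: t_def)
  define \<eta> where "\<eta> = t * \<theta>"
  have "algebraic_int \<eta>"
    unfolding \<eta>_def t_def using p by (intro algebraic_int_lead_coeff_times_root int_imp_algebraic_int)
  moreover have tK: "t \<in> K" using t(1) S by (auto elim!: Ints_cases simp: subfield_of_int)
  ultimately have \<eta>: "\<eta> \<in> ring_of_ints K" "\<eta> \<in> K"
    using \<theta> S by (auto simp: ring_of_ints_def \<eta>_def subfield_mult)
  define C where "C = (\<Sum>\<sigma>\<in>field_embeddings K. \<Sum>j\<le>degree m. cmod (\<sigma> \<eta>) ^ j)"
  have "\<exists>y\<in>ring_of_ints K. \<forall>\<sigma>\<in>field_embeddings K. cmod (\<sigma> (z - y)) \<le> C" if z: "z \<in> K" for z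
  proof -
    obtain q where q: "q \<in> polys_over \<rat>" "z = poly q \<theta>" "degree q < degree m"
      using simple_ext_degree_less[OF subfield_Rats m] z \<theta>(2) by blast
    define c where "c = (\<lambda>j. coeff q j / t ^ j)"
    have cr: "c j \<in> \<rat>" for j using q(1) t Ints_subset_Rats by (auto simp: c_def polys_over_coeff)
    have "poly q \<theta> = (\<Sum>j\<le>degree m. coeff q j * \<theta> ^ j)"
      unfolding poly_altdef using q(3) by (intro sum.mono_neutral_left) (auto simp: coeff_eq_0)
    then have zc: "z = (\<Sum>j\<le>degree m. c j * \<eta> ^ j)"
      using t(2) q(2) by (simp add: c_def \<eta>_def power_mult_distrib)
    define r where "r = (\<lambda>j. c j - of_int \<lfloor>Re (c j)\<rfloor>)"
    have rr: "r j \<in> \<rat>" for j using cr[of j] by (simp add: r_def)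
    have rK: "r j \<in> K" for j using rr Rats_subset_subfield[OF S] by blast
    have r1: "cmod (r j) \<le> 1" for j
    proof -
      have "c j \<in> \<real>" using cr[of j] by (auto elim!: Rats_cases')
      then have "r j = of_real (frac (Re (c j)))"
        by (auto simp: r_def frac_def complex_eq_iff complex_is_Real_iff)
      then show ?thesis using frac_lt_1[of "Re (c j)"] frac_ge_0[of "Re (c j)"] by simp
    qed
    define y where "y = (\<Sum>j\<le>degree m. of_int \<lfloor>Re (c j)\<rfloor> * \<eta> ^ j)"
    have "y \<in> ring_of_ints K"
      using \<eta> S by (auto simp: y_def ring_of_ints_def int_imp_algebraic_int
          intro!: subfield_sum subfield_mult subfield_of_int subfield_power algebraic_int_sum
            algebraic_int_times algebraic_int_power)
    moreover have "cmod (\<sigma> (z - y)) \<le> C" if \<sigma>: "\<sigma> \<in> field_embeddings K" for \<sigma>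
    proof -
      have "z - y = (\<Sum>j\<le>degree m. r j * \<eta> ^ j)"
        by (simp add: zc y_def r_def sum_subtractf algebra_simps)
      then have "\<sigma> (z - y) = (\<Sum>j\<le>degree m. r j * \<sigma> \<eta> ^ j)"
        using rK \<eta>(2) S by (simp add: embedding_sum[OF S \<sigma>] embedding_mult[OF S \<sigma>]
            embedding_power[OF S \<sigma>] embedding_Rats[OF S \<sigma> rr] subfield_mult subfield_power)
      also have "cmod \<dots> \<le> (\<Sum>j\<le>degree m. cmod (r j) * cmod (\<sigma> \<eta>) ^ j)"
        by (rule order_trans[OF norm_sum]) (simp add: norm_mult norm_power)
      also have "\<dots> \<le> (\<Sum>j\<le>degree m. 1 * cmod (\<sigma> \<eta>) ^ j)"
        using r1 by (intro sum_mono mult_right_mono) auto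
      also have "\<dots> \<le> C"
        unfolding C_def mult_1_left
        by (rule member_le_sum[of \<sigma> _ "\<lambda>\<sigma>. \<Sum>j\<le>degree m. cmod (\<sigma> \<eta>) ^ j"])
          (use \<sigma> field_embeddings_finite_card(1)[OF K] in \<open>auto intro: sum_nonneg\<close>)
      finally show ?thesis .
    qed
    ultimately show ?thesis by blast
  qed
  moreover have "C \<ge> 0" by (simp add: C_def sum_nonneg)
  ultimately show ?thesis by blast
qed

section \<open>Residues modulo an integer of a number field\<close>

definition incongruent :: "complex set \<Rightarrow> complex \<Rightarrow> complex set \<Rightarrow> bool" where
  "incongruent K b R \<longleftrightarrow> R \<subseteq> ring_of_ints K \<and>
     (\<forall>x\<in>R. \<forall>y\<in>R. x \<noteq> y \<longrightarrow> \<not> (\<exists>t\<in>ring_of_ints K. x - y = b * t))"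

text \<open>These are expansions to the base \<open>b\<close> with digits from \<open>R\<close>: the
  last digit is determined modulo \<open>b\<close>, and after cancelling it and a factor
  \<open>b\<close>, the rest is determined modulo \<open>b ^ k\<close>.\<close>

lemma incongruent_power:
  assumes K: "number_field K" and b: "b \<in> ring_of_ints K" "b \<noteq> 0" and R: "finite R" "incongruent K b R"
  shows "\<exists>Y. finite Y \<and> incongruent K (b ^ k) Y \<and> card Y = card R ^ k"
proof (induction k)
  case 0
  have "0 \<in> ring_of_ints K" using number_field_subfield[OF K] by (simp add: ring_of_ints_def)
  then show ?case by (intro exI[of _ "{0}"]) (auto simp: incongruent_def)
next
  case (Suc k)
  then obtain Y where Y: "finite Y" "incongruent K (b ^ k) Y" "card Y = card R ^ k" by blast
  define f where "f = (\<lambda>(x,z). x + b * z)"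
  have ints: "R \<subseteq> ring_of_ints K" "Y \<subseteq> ring_of_ints K" using R Y by (auto simp: incongruent_def)
  have key: "x = x' \<and> z = z'"
    if h: "x \<in> R" "x' \<in> R" "z \<in> Y" "z' \<in> Y" "t \<in> ring_of_ints K" "(x + b * z) - (x' + b * z') = b ^ Suc k * t"
    for x x' z z' t
  proof -
    have I: "x \<in> ring_of_ints K" "x' \<in> ring_of_ints K" "z \<in> ring_of_ints K" "z' \<in> ring_of_ints K"
      using h ints by auto
    have "x - x' = b * (b ^ k * t - (z - z'))" using h(6) by (simp add: algebra_simps)
    moreover have "b ^ k * t - (z - z') \<in> ring_of_ints K"
      using I b h(5) by (intro ring_of_ints_closed[OF K])
    ultimately have xx: "x = x'" using R h unfolding incongruent_def by blast
    then have "b * (z - z') = b * (b ^ k * t)" using h(6) by (simp add: algebra_simps)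
    then have "z - z' = b ^ k * t" using b by simp
    then show ?thesis using xx Y h unfolding incongruent_def by blast
  qed
  have zero: "0 \<in> ring_of_ints K" using number_field_subfield[OF K] by (simp add: ring_of_ints_def)
  have inj: "inj_on f (R \<times> Y)"
    using key[OF _ _ _ _ zero] by (intro inj_onI) (auto simp: f_def)
  have "incongruent K (b ^ Suc k) (f ` (R \<times> Y))"
    unfolding incongruent_def
  proof (intro conjI ballI impI notI)
    show "f ` (R \<times> Y) \<subseteq> ring_of_ints K"
      using ints b by (auto simp: f_def intro!: ring_of_ints_closed[OF K])
    fix u v assume uv: "u \<in> f ` (R \<times> Y)" "v \<in> f ` (R \<times> Y)" "u \<noteq> v"
      and "\<exists>t\<in>ring_of_ints K. u - v = b ^ Suc k * t"
    then obtain t where t: "t \<in> ring_of_ints K" "u - v = b ^ Suc k * t" by blast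
    obtain x z x' z' where "x \<in> R" "z \<in> Y" "u = x + b * z" "x' \<in> R" "z' \<in> Y" "v = x' + b * z'"
      using uv by (auto simp: f_def)
    then show False using key[of x x' z z' t] t uv(3) by auto
  qed
  moreover have "card (f ` (R \<times> Y)) = card R ^ Suc k"
    using card_image[OF inj] Y(3) by (simp add: card_cartesian_product)
  ultimately show ?case using R(1) Y(1) by (intro exI[of _ "f ` (R \<times> Y)"]) auto
qed

text \<open>A constant factor becomes negligible when \<open>k\<close>-th powers are compared for
  large \<open>k\<close>. This sharpens the residue count and also bounds p-adic absolute
  values.\<close>

lemma pow_le_const_imp_le:
  fixes x y A :: real
  assumes "\<And>k. x ^ k \<le> A * y ^ k" "y > 0"
  shows "x \<le> y"
proof (rule ccontr)
  assume "\<not> x \<le> y"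
  then have "x / y > 1" using assms(2) by simp
  then obtain k where "A < (x / y) ^ k" using real_arch_pow by blast
  then show False using assms(1)[of k] assms(2) by (simp add: power_divide field_simps)
qed

text \<open>Incongruent residues modulo \<open>b\<^sup>k\<close> give \<open>|R|\<^sup>k\<close> points \<open>z/b\<^sup>k - y\<close> in a fixed box of \<open>\<real>\<^sup>r\<close>, and the
  differences of these points have norm at least \<open>N\<^sup>-\<^sup>k\<close>; so a cube of side \<open>N\<^sup>-\<^sup>k\<^sup>/\<^sup>r\<close> contains at most
  one of them. Letting \<open>k\<close> grow yields the sharp bound.\<close>

lemma card_incongruent_le_norm:
  assumes K: "number_field K" "totally_real K" and b: "b \<in> ring_of_ints K" "b \<noteq> 0"
    and R: "finite R" "incongruent K b R"
  shows "real (card R) \<le> (\<Prod>\<sigma>\<in>field_embeddings K. cmod (\<sigma> b))"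
proof -
  let ?E = "field_embeddings K"
  note S = number_field_subfield[OF K(1)] and E = field_embeddings_finite_card[OF K(1)]
  define N where "N = (\<Prod>\<sigma>\<in>?E. cmod (\<sigma> b))"
  define r where "r = card ?E"
  have N: "N \<ge> 1" unfolding N_def by (rule norm_ge_1[OF K(1) b])
  obtain C where C: "C \<ge> 0" "\<And>z. z \<in> K \<Longrightarrow> \<exists>y\<in>ring_of_ints K. \<forall>\<sigma>\<in>?E. cmod (\<sigma> (z - y)) \<le> C"
    using integers_cover_number_field[OF K(1)] by blast
  have bK: "b \<in> K" using b by (simp add: ring_of_ints_def)
  have "real (card R) ^ k \<le> (2 * C + 2) ^ r * N ^ k" for k
  proof -
    obtain Y where Y: "finite Y" "incongruent K (b ^ k) Y" "card Y = card R ^ k"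
      using incongruent_power[OF K(1) b R] by blast
    have YI: "z \<in> ring_of_ints K" "z \<in> K" if "z \<in> Y" for z
      using that Y by (auto simp: incongruent_def ring_of_ints_def)
    have bk: "b ^ k \<noteq> 0" "b ^ k \<in> K" using b bK S by (auto simp: subfield_power)
    have "\<forall>z\<in>Y. \<exists>y\<in>ring_of_ints K. \<forall>\<sigma>\<in>?E. cmod (\<sigma> (z / b ^ k - y)) \<le> C"
      using YI bk S C(2) by (simp add: subfield_divide)
    then obtain y where y: "\<And>z. z \<in> Y \<Longrightarrow> y z \<in> ring_of_ints K"
      "\<And>z \<sigma>. z \<in> Y \<Longrightarrow> \<sigma> \<in> ?E \<Longrightarrow> cmod (\<sigma> (z / b ^ k - y z)) \<le> C" by metis
    define u where "u = (\<lambda>z. z / b ^ k - y z)"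
    have uK: "u z \<in> K" if "z \<in> Y" for z
      using that YI bk y S by (auto simp: u_def ring_of_ints_def intro!: subfield_diff subfield_divide)
    \<comment> \<open>The inverse side length of the cells, chosen so that \<open>M ^ r\<close> is
      the absolute norm of \<open>b ^ k\<close>: multiplied by \<open>b ^ k\<close>, a difference of
      two points in one cell has norm below 1.\<close>
    define M where "M = root r (N ^ k)"
    have r: "r > 0" using E by (simp add: r_def)
    have M: "M \<ge> 1" "M ^ r = N ^ k" using N r by (auto simp: M_def)
    define cell where "cell = (\<lambda>z. \<lambda>\<sigma>\<in>?E. \<lfloor>M * Re (\<sigma> (u z))\<rfloor>)"
    have inj: "inj_on cell Y"
    proof (rule inj_onI, rule ccontr)
      fix z z' assume z: "z \<in> Y" "z' \<in> Y" "cell z = cell z'" "z \<noteq> z'"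
      have D: "u z - u z' \<in> K" using z uK S by (simp add: subfield_diff)
      have "cmod (\<sigma> (u z - u z')) < 1 / M" if \<sigma>: "\<sigma> \<in> ?E" for \<sigma>
      proof -
        have "\<bar>Re (\<sigma> (u z)) - Re (\<sigma> (u z'))\<bar> < 1 / M"
          using floor_eq_imp_abs_less[of M] fun_cong[OF z(3), of \<sigma>] \<sigma> M by (auto simp: cell_def)
        \<comment> \<open>The conjugates are real, so one real coordinate for each embedding
          controls the whole difference.\<close>
        moreover have "\<sigma> (u z - u z') \<in> \<real>" using K(2) \<sigma> D by (auto simp: totally_real_def)
        ultimately show ?thesis
          using embedding_diff[OF S \<sigma>] uK z by (auto simp: in_Reals_norm elim!: Reals_cases)
      qed
      then have "(\<Prod>\<sigma>\<in>?E. M * cmod (\<sigma> (u z - u z'))) < 1"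
        using E M by (intro prod_less_one) (auto simp: field_simps)
      moreover have "(\<Prod>\<sigma>\<in>?E. M * cmod (\<sigma> (u z - u z'))) = (\<Prod>\<sigma>\<in>?E. cmod (\<sigma> (b ^ k * (u z - u z'))))"
      proof -
        have "(\<Prod>\<sigma>\<in>?E. M * cmod (\<sigma> (u z - u z'))) = N ^ k * (\<Prod>\<sigma>\<in>?E. cmod (\<sigma> (u z - u z')))"
          using M by (simp add: prod.distrib r_def)
        also have "\<dots> = (\<Prod>\<sigma>\<in>?E. cmod (\<sigma> b) ^ k * cmod (\<sigma> (u z - u z')))"
          by (simp add: prod.distrib N_def prod_power_distrib)
        also have "\<dots> = (\<Prod>\<sigma>\<in>?E. cmod (\<sigma> (b ^ k * (u z - u z'))))"
          using D bk bK by (intro prod.cong)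
            (auto simp: embedding_mult[OF S] embedding_power[OF S] norm_mult norm_power)
        finally show ?thesis .
      qed
      moreover have eq: "b ^ k * (u z - u z') = (z - z') - b ^ k * (y z - y z')"
        using b(2) by (simp add: u_def field_simps)
      moreover have "b ^ k * (u z - u z') \<in> ring_of_ints K"
        unfolding eq using z YI y b by (intro ring_of_ints_closed[OF K(1)]) auto
      moreover have "b ^ k * (u z - u z') \<noteq> 0"
      proof
        assume "b ^ k * (u z - u z') = 0"
        then have "z - z' = b ^ k * (y z - y z')" using eq by simp
        moreover have "y z - y z' \<in> ring_of_ints K" using z y by (intro ring_of_ints_closed[OF K(1)])
        ultimately show False using Y(2) z unfolding incongruent_def by blast
      qed
      ultimately show False using norm_ge_1[OF K(1), of "b ^ k * (u z - u z')"] by simp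
    qed
    let ?I = "{\<lfloor>- (M * C)\<rfloor>..\<lfloor>M * C\<rfloor>}"
    have sub: "cell ` Y \<subseteq> (\<Pi>\<^sub>E \<sigma>\<in>?E. ?I)"
    proof (rule image_subsetI)
      fix z assume z: "z \<in> Y"
      have "\<lfloor>- (M * C)\<rfloor> \<le> \<lfloor>M * Re (\<sigma> (u z))\<rfloor> \<and> \<lfloor>M * Re (\<sigma> (u z))\<rfloor> \<le> \<lfloor>M * C\<rfloor>"
        if \<sigma>: "\<sigma> \<in> ?E" for \<sigma>
      proof -
        have "\<bar>Re (\<sigma> (u z))\<bar> \<le> C" using y(2)[OF z \<sigma>] abs_Re_le_cmod[of "\<sigma> (u z)"] by (simp add: u_def)
        then have "M * \<bar>Re (\<sigma> (u z))\<bar> \<le> M * C" using M by (intro mult_left_mono) auto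
        then have "\<bar>M * Re (\<sigma> (u z))\<bar> \<le> M * C" using M by (simp add: abs_mult)
        then show ?thesis by (intro conjI floor_mono) auto
      qed
      then show "cell z \<in> (\<Pi>\<^sub>E \<sigma>\<in>?E. ?I)"
        unfolding cell_def restrict_PiE_iff atLeastAtMost_iff by blast
    qed
    have fin: "finite (\<Pi>\<^sub>E \<sigma>\<in>?E. ?I)" using E by (intro finite_PiE) auto
    have "card Y \<le> card (\<Pi>\<^sub>E \<sigma>\<in>?E. ?I)" by (rule card_inj_on_le[OF inj sub fin])
    also have "\<dots> = card ?I ^ r" using E by (simp add: card_PiE r_def)
    finally have "real (card R) ^ k \<le> real (card ?I) ^ r"
      using Y(3) by (metis of_nat_le_iff of_nat_power)
    also have "\<dots> \<le> ((2 * C + 2) * M) ^ r"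
    proof (rule power_mono)
      have "M * C \<ge> 0" using M C by simp
      then have "real (card ?I) \<le> 2 * (M * C) + 2" by simp linarith
      also have "\<dots> \<le> (2 * C + 2) * M" using M by (simp add: algebra_simps)
      finally show "real (card ?I) \<le> (2 * C + 2) * M" .
    qed auto
    also have "\<dots> = (2 * C + 2) ^ r * N ^ k" using M by (simp add: power_mult_distrib)
    finally show ?thesis .
  qed
  then have "real (card R) \<le> N" by (rule pow_le_const_imp_le) (use N in simp)
  then show ?thesis by (simp add: N_def)
qed

text \<open>Incongruent sets have bounded size, and one of maximal size meets every residue class,
  since an integer outside all its classes could be added.\<close>

lemma residue_system_exists:
  assumes K: "number_field K" "totally_real K" and b: "b \<in> ring_of_ints K" "b \<noteq> 0"
  shows "\<exists>R. finite R \<and> real (card R) \<le> (\<Prod>\<sigma>\<in>field_embeddings K. cmod (\<sigma> b)) \<and>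
    (\<forall>x\<in>ring_of_ints K. \<exists>s\<in>R. \<exists>t\<in>ring_of_ints K. x - s = b * t)"
proof -
  define P where "P = (\<lambda>k. \<exists>R. finite R \<and> incongruent K b R \<and> card R = k)"
  let ?N = "(\<Prod>\<sigma>\<in>field_embeddings K. cmod (\<sigma> b))"
  have bound: "k \<le> nat \<lfloor>?N\<rfloor>" if "P k" for k
    using that card_incongruent_le_norm[OF K b] by (force simp: P_def le_nat_floor)
  have "P 0" by (auto simp: P_def incongruent_def intro!: exI[of _ "{}"])
  then obtain k where k: "P k" "\<And>j. P j \<Longrightarrow> j \<le> k"
    using bound by (metis Greatest_le_nat GreatestI_nat)
  then obtain R where R: "finite R" "incongruent K b R" "card R = k" by (auto simp: P_def)
  have "\<exists>s\<in>R. \<exists>t\<in>ring_of_ints K. x - s = b * t" if x: "x \<in> ring_of_ints K" for x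
  proof (rule ccontr)
    assume *: "\<not> ?thesis"
    have "0 \<in> ring_of_ints K" using number_field_subfield[OF K(1)] by (simp add: ring_of_ints_def)
    with * have "x \<notin> R" by (metis diff_self mult_zero_right)
    moreover have "incongruent K b (insert x R)"
      unfolding incongruent_def
    proof (intro conjI ballI impI notI)
      show "insert x R \<subseteq> ring_of_ints K" using x R by (auto simp: incongruent_def)
      fix u v assume uv: "u \<in> insert x R" "v \<in> insert x R" "u \<noteq> v" "\<exists>t\<in>ring_of_ints K. u - v = b * t"
      then obtain t where t: "t \<in> ring_of_ints K" "u - v = b * t" by blast
      have "v - u = b * (0 - t)" using t by (simp add: algebra_simps)
      moreover have "0 - t \<in> ring_of_ints K" by (intro ring_of_ints_closed[OF K(1)]) fact+
      ultimately show False using uv * R(2) t unfolding incongruent_def by blast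
    qed
    ultimately have "P (Suc k)" using R unfolding P_def by (metis card_insert_disjoint finite_insert)
    then show False using k(2) by force
  qed
  then show ?thesis using R card_incongruent_le_norm[OF K b R(1,2)] by blast
qed

section \<open>The Thue equation: counting solutions\<close>

text \<open>Homogeneous synthetic division by X - \<alpha> Y: the Horner sums \<open>g k\<close> are
  the coefficients of the quotient, and the remainder \<open>g n\<close> is the value of the form at
  (\<alpha>, 1).\<close>

lemma binary_form_factor:
  fixes a :: "nat \<Rightarrow> complex" and x y \<alpha> :: complex
  defines "g \<equiv> \<lambda>k. \<Sum>i\<le>k. a i * \<alpha> ^ (k - i)"
  shows "binary_form n a x y = (x - \<alpha> * y) * (\<Sum>k<n. g k * x ^ (n - 1 - k) * y ^ k) + g n * y ^ n"
proof (induction n)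
  case 0
  then show ?case by (simp add: binary_form_def g_def)
next
  case (Suc n)
  have step: "g (Suc n) = \<alpha> * g n + a (Suc n)"
    by (simp add: g_def sum_distrib_left Suc_diff_le mult_ac)
  have "binary_form (Suc n) a x y = x * binary_form n a x y + a (Suc n) * y ^ Suc n"
    by (simp add: binary_form_def sum_distrib_left Suc_diff_le mult_ac)
  moreover have "(\<Sum>k<Suc n. g k * x ^ (Suc n - 1 - k) * y ^ k)
      = x * (\<Sum>k<n. g k * x ^ (n - 1 - k) * y ^ k) + g n * y ^ n"
  proof -
    have "(\<Sum>k<n. g k * x ^ (n - k) * y ^ k) = (\<Sum>k<n. x * (g k * x ^ (n - 1 - k) * y ^ k))"
    proof (intro sum.cong refl)
      fix k assume "k \<in> {..<n}"
      then have "x ^ (n - k) = x * x ^ (n - 1 - k)" by (simp flip: power_Suc add: Suc_diff_Suc)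
      then show "g k * x ^ (n - k) * y ^ k = x * (g k * x ^ (n - 1 - k) * y ^ k)" by simp
    qed
    then show ?thesis by (simp add: sum_distrib_left)
  qed
  ultimately show ?case using Suc step by (simp add: algebra_simps)
qed

lemma binary_form_scale: "binary_form n a (c * x) (c * y) = c ^ n * binary_form n a x y"
proof -
  have "a i * (c * x) ^ (n - i) * (c * y) ^ i = c ^ n * (a i * x ^ (n - i) * y ^ i)" if "i \<le> n" for i
  proof -
    have "c ^ n = c ^ (n - i) * c ^ i" using that by (simp flip: power_add)
    then show ?thesis by (simp add: power_mult_distrib mult_ac)
  qed
  then show ?thesis unfolding binary_form_def sum_distrib_left by (intro sum.cong) auto
qed

locale cm_thue =
  fixes K :: "complex set" and n :: nat and a :: "nat \<Rightarrow> complex" and b \<alpha> :: complex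
  assumes K: "number_field K" "totally_real K"
    and b: "b \<in> ring_of_ints K" "b \<noteq> 0"
    and n: "n \<ge> 2" and a: "\<forall>i\<le>n. a i \<in> ring_of_ints K" "a 0 \<noteq> 0"
    and root: "binary_form n a \<alpha> 1 = 0" and CM: "CM_field (adjoin K \<alpha>)"
begin

abbreviation "L \<equiv> adjoin K \<alpha>"
abbreviation "EK \<equiv> field_embeddings K"
abbreviation "EL \<equiv> field_embeddings L"
abbreviation "sols \<equiv> form_solutions K n a b"

text \<open>The Horner sums at \<alpha> are the coefficients of the quotient of the form by X -
  \<alpha> Y; \<open>coform\<close> is that quotient, the cofactor G.\<close>

definition "coform_coeff k = (\<Sum>i\<le>k. a i * \<alpha> ^ (k - i))"
definition "coform x y = (\<Sum>k<n. coform_coeff k * x ^ (n - 1 - k) * y ^ k)"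

lemma SK: "subfield K complex_ring"
  by (rule number_field_subfield[OF K(1)])

lemma L: "number_field L"
  using CM by (simp add: CM_field_def)

lemma SL: "subfield L complex_ring"
  by (rule number_field_subfield[OF L])

lemma aK: "i \<le> n \<Longrightarrow> a i \<in> K" and a_int: "i \<le> n \<Longrightarrow> algebraic_int (a i)"
  using a by (auto simp: ring_of_ints_def)

lemma bK: "b \<in> K" "algebraic_int b"
  using b by (auto simp: ring_of_ints_def)

lemma root_eq: "(\<Sum>i\<le>n. a i * \<alpha> ^ (n - i)) = 0"
  using root by (simp add: binary_form_def)

lemma alpha_minimal_poly: "\<exists>m. minimal_poly K \<alpha> m \<and> degree m \<le> n"
proof -
  define p where "p = (\<Sum>i\<le>n. monom (a i) (n - i))"
  have cp: "coeff p j = (if j \<le> n then a (n - j) else 0)" for j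
  proof -
    have "coeff p j = (\<Sum>i\<le>n. if i = n - j \<and> j \<le> n then a i else 0)"
      unfolding p_def coeff_sum by (intro sum.cong) auto
    then show ?thesis by auto
  qed
  have p: "p \<in> polys_over K" using aK SK by (auto simp: polys_over_def cp)
  have "coeff p n \<noteq> 0" using a by (simp add: cp)
  then have p0: "p \<noteq> 0" by auto
  have r: "poly p \<alpha> = 0" using root_eq by (simp add: p_def poly_sum poly_monom)
  have deg: "degree p \<le> n" by (rule degree_le) (simp add: cp)
  have "algebraic_over K \<alpha>" using p p0 r by (auto simp: algebraic_over_def)
  then obtain m where m: "minimal_poly K \<alpha> m" using minimal_poly_exists[OF SK] by blast
  then have "degree m \<le> degree p" using p p0 r by (auto simp: minimal_poly_def)
  then show ?thesis using m deg by force
qed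

definition "rel_poly = (SOME m. minimal_poly K \<alpha> m \<and> degree m \<le> n)"

lemma rel_poly: "minimal_poly K \<alpha> rel_poly" "degree rel_poly \<le> n" "degree rel_poly > 0"
  using someI_ex[OF alpha_minimal_poly] minimal_poly_degree_pos[OF SK] by (auto simp: rel_poly_def)

lemma alpha_algebraic: "algebraic_over K \<alpha>"
  using rel_poly(1) minimal_poly_degree_pos[OF SK rel_poly(1)]
  by (auto simp: minimal_poly_def algebraic_over_def intro!: bexI[of _ rel_poly])

lemma L_eq: "L = simple_ext K \<alpha>"
  by (rule adjoin_eq_simple_ext[OF SK alpha_algebraic])

lemma K_subset_L: "K \<subseteq> L"
  unfolding L_eq by (rule subset_simple_ext[OF SK])

lemma K_real: "K \<subseteq> \<real>"
  by (rule totally_real_subset_Reals[OF K])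

lemma alphaL: "\<alpha> \<in> L"
  unfolding L_eq by (rule gen_in_simple_ext[OF SK])

lemma alpha_nonreal: "\<tau> \<in> EL \<Longrightarrow> \<tau> \<alpha> \<notin> \<real>"
  using embedding_generator_nonreal[OF K alpha_algebraic] CM by (simp add: CM_field_def L_eq)

lemma alpha_nonreal': "\<alpha> \<notin> \<real>"
  using alpha_nonreal[OF inclusion_embedding[OF SL]] alphaL by simp

lemma cnj_L: "z \<in> L \<Longrightarrow> cnj z \<in> L" and embedding_cnj_L: "z \<in> L \<Longrightarrow> \<tau> \<in> EL \<Longrightarrow> \<tau> (cnj z) = cnj (\<tau> z)"
  using CM_field_cnj[OF CM] by auto

lemma prod_EL: "(\<Prod>\<tau>\<in>EL. g (restrict \<tau> K)) = (\<Prod>\<sigma>\<in>EK. g \<sigma>) ^ degree rel_poly"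
  for g :: "(complex \<Rightarrow> complex) \<Rightarrow> 'b :: comm_semiring_1"
  using prod_embeddings_tower[OF K(1) rel_poly(1), of g] L by (simp add: L_eq)

lemma card_EL: "card EL = card EK * degree rel_poly"
  using card_embeddings_tower[OF K(1) rel_poly(1)] L by (simp add: L_eq)

lemma coform_coeff_int:
  "k \<le> n \<Longrightarrow> algebraic_int (coform_coeff k)"
  "k \<le> n \<Longrightarrow> algebraic_int (\<alpha> * coform_coeff k)"
  using algebraic_int_horner[OF a_int root_eq, of k] by (auto simp: coform_coeff_def)

lemma form_eq: "binary_form n a x y = (x - \<alpha> * y) * coform x y"
  using binary_form_factor[of n a x y \<alpha>] root_eq by (simp add: coform_def coform_coeff_def)

text \<open>\<alpha> need not be integral, but the cofactor absorbs its denominator. Together the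
  two claims make \<open>(t - \<alpha> * u) * coform x y\<close> integral for all algebraic integers
  \<open>t\<close> and \<open>u\<close>.\<close>

lemma coform_int:
  assumes "algebraic_int x" "algebraic_int y"
  shows "algebraic_int (coform x y)" "algebraic_int (\<alpha> * coform x y)"
proof -
  show "algebraic_int (coform x y)"
    unfolding coform_def using assms coform_coeff_int(1)
    by (intro algebraic_int_sum algebraic_int_times algebraic_int_power) auto
  have "\<alpha> * coform x y = (\<Sum>k<n. (\<alpha> * coform_coeff k) * x ^ (n - 1 - k) * y ^ k)"
    by (simp add: coform_def sum_distrib_left mult_ac)
  also have "algebraic_int \<dots>"
  proof (rule algebraic_int_sum)
    fix k assume "k \<in> {..<n}"
    then have "algebraic_int (\<alpha> * coform_coeff k)" by (intro coform_coeff_int) simp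
    then show "algebraic_int (\<alpha> * coform_coeff k * x ^ (n - 1 - k) * y ^ k)"
      by (rule algebraic_int_times[OF algebraic_int_times]) (rule algebraic_int_power, rule assms)+
  qed
  finally show "algebraic_int (\<alpha> * coform x y)" .
qed

text \<open>\<open>lin\<close> and \<open>unit_quot\<close> give the \<delta> and the \<epsilon> of
  a solution.\<close>

definition "lin s = (case s of (x, y) \<Rightarrow> x - \<alpha> * y)"
definition "unit_quot s = lin s / cnj (lin s)"

lemma sols_props:
  assumes "(x, y) \<in> sols"
  shows "x \<in> ring_of_ints K" "y \<in> ring_of_ints K" "x \<in> K" "y \<in> K" "algebraic_int x" "algebraic_int y"
    "x \<in> L" "y \<in> L" "lin (x, y) * coform x y = b" "lin (x, y) \<noteq> 0" "lin (x, y) \<in> L"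
proof -
  show *: "x \<in> ring_of_ints K" "y \<in> ring_of_ints K" "x \<in> K" "y \<in> K" "algebraic_int x" "algebraic_int y"
    "x \<in> L" "y \<in> L"
    using assms K_subset_L by (auto simp: form_solutions_def ring_of_ints_def)
  show "lin (x, y) * coform x y = b" using assms form_eq by (auto simp: form_solutions_def lin_def)
  then show "lin (x, y) \<noteq> 0" using b by auto
  show "lin (x, y) \<in> L" using * alphaL by (auto simp: lin_def intro!: subfield_closed[OF SL])
qed

text \<open>The two values of \<open>lin\<close> differ by \<open>b * (t - \<alpha> * u)\<close>,
  and \<open>b\<close> is \<open>lin (x, y)\<close> times \<open>coform x y\<close>; this cofactor
  remains after division and absorbs the denominator of \<alpha>.\<close>

lemma quotient_integral:
  assumes s: "(x, y) \<in> sols" "(x', y') \<in> sols"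
    and t: "algebraic_int t" "algebraic_int u" "x' - x = b * t" "y' - y = b * u"
  shows "algebraic_int (lin (x', y') / lin (x, y))"
proof -
  note p = sols_props[OF s(1)]
  have "lin (x', y') = lin (x, y) + b * (t - \<alpha> * u)"
    using t(3,4) by (simp add: lin_def algebra_simps)
  also have "\<dots> = lin (x, y) * (1 + coform x y * t - \<alpha> * coform x y * u)"
    by (simp add: p(9)[symmetric] algebra_simps)
  finally have "lin (x', y') / lin (x, y) = 1 + coform x y * t - \<alpha> * coform x y * u"
    using p(10) by (simp add: field_simps)
  then show ?thesis using coform_int[OF p(5,6)] t(1,2) by auto
qed

text \<open>For a unit \<open>b\<close> the inverse of \<open>lin (x, y)\<close> is
  \<open>coform x y * c\<close>, so any two solutions can be compared without a congruence between
  them.\<close>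

lemma quotient_integral_unit:
  assumes s: "(x, y) \<in> sols" "(x', y') \<in> sols" and c: "algebraic_int c" "b * c = 1"
  shows "algebraic_int (lin (x', y') / lin (x, y))"
proof -
  note p = sols_props[OF s(1)] and p' = sols_props[OF s(2)]
  have "lin (x, y) * (coform x y * c) = 1" using p(9) c(2) by (simp add: mult.assoc[symmetric])
  then have "1 / lin (x, y) = coform x y * c" using p(10) by (simp add: field_simps)
  then have "lin (x', y') / lin (x, y) = lin (x', y') * (coform x y * c)"
    by (metis times_divide_eq_right mult.right_neutral)
  also have "\<dots> = x' * (coform x y * c) - \<alpha> * coform x y * (y' * c)"
    by (simp add: lin_def algebra_simps)
  finally show ?thesis using coform_int[OF p(5,6)] p'(5,6) c by auto
qed

section \<open>Roots of unity and the number of solutions\<close>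

definition "polydisc = {z \<in> ring_of_ints L. \<forall>\<tau>\<in>EL. cmod (\<tau> z) \<le> 1}"

lemma polydisc: "finite polydisc" "card polydisc \<le> 4 ^ card EL"
  unfolding polydisc_def using card_integers_in_unit_polydisc[OF L alphaL] alpha_nonreal by auto

text \<open>Kronecker's argument: all powers of \<open>z\<close> lie in the finite set
  \<open>polydisc\<close>, so two of them coincide.\<close>

lemma unimodular_root_of_unity:
  assumes z: "z \<in> ring_of_ints L" "\<And>\<tau>. \<tau> \<in> EL \<Longrightarrow> cmod (\<tau> z) = 1"
  shows "z \<in> roots_of_unity L"
proof -
  have zL: "z \<in> L" using z by (simp add: ring_of_ints_def)
  have "z ^ k \<in> polydisc" for k
    using ring_of_ints_closed(4)[OF L z(1) z(1)] z(2) zL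
    by (auto simp: polydisc_def embedding_power[OF SL] norm_power)
  then have "finite (range (\<lambda>k. z ^ k))" using polydisc(1) by (meson finite_subset image_subsetI)
  then have "\<not> inj (\<lambda>k. z ^ k)" using finite_imageD infinite_UNIV_nat by blast
  then obtain k l where kl: "k < l" "z ^ k = z ^ l" unfolding inj_def by (metis linorder_neqE_nat)
  obtain \<tau> where "\<tau> \<in> EL" using field_embeddings_finite_card(2)[OF L] by blast
  then have "z \<noteq> 0" using z(2)[of \<tau>] embedding_0[OF SL] by force
  moreover have "z ^ l = z ^ k * z ^ (l - k)" using kl(1) by (simp flip: power_add)
  ultimately have "z ^ (l - k) = 1" using kl(2) by simp
  then show ?thesis using kl(1) zL unfolding roots_of_unity_def by (auto intro!: exI[of _ "l - k"])
qed

text \<open>Roots of unity are integers whose conjugates all have modulus 1, so the cell count for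
  \<open>polydisc\<close> bounds their number as well. This is the source of the factor 4^(dn) in
  the number of solutions.\<close>

lemma roots_of_unity: "finite (roots_of_unity L)" "card (roots_of_unity L) \<le> 4 ^ card EL"
proof -
  have "roots_of_unity L \<subseteq> polydisc"
  proof
    fix z assume "z \<in> roots_of_unity L"
    then obtain m where m: "z \<in> L" "m > 0" "z ^ m = 1" by (auto simp: roots_of_unity_def)
    have "algebraic_int z"
      by (rule algebraic_int_root[of 1 "monom 1 m"]) (use m in \<open>auto simp: poly_monom degree_monom_eq\<close>)
    moreover have "cmod (\<tau> z) = 1" if "\<tau> \<in> EL" for \<tau>
    proof -
      have "\<tau> z ^ m = 1" using embedding_power[OF SL that m(1), of m] embedding_1[OF SL that] m(3) by simp
      then show ?thesis using power_eq_1_iff m(2) by blast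
    qed
    ultimately show "z \<in> polydisc" using m by (simp add: polydisc_def ring_of_ints_def)
  qed
  then show "finite (roots_of_unity L)" "card (roots_of_unity L) \<le> 4 ^ card EL"
    using polydisc card_mono[OF polydisc(1)] by (auto intro: finite_subset order_trans)
qed

text \<open>The ratio is \<eta> divided by its conjugate, where \<eta> is the quotient of the two
  values of \<open>lin\<close>. It is integral because \<eta> and its inverse are, and its
  conjugates are unimodular because embeddings commute with \<open>cnj\<close>.\<close>

lemma unit_quot_ratio:
  assumes s: "s \<in> sols" "s' \<in> sols" and int: "algebraic_int (lin s' / lin s)" "algebraic_int (lin s / lin s')"
  shows "unit_quot s' / unit_quot s \<in> roots_of_unity L"
proof -
  obtain x y x' y' where xy: "s = (x, y)" "s' = (x', y')" by fastforce
  have nz: "lin s \<noteq> 0" "lin s' \<noteq> 0" and mem: "lin s \<in> L" "lin s' \<in> L"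
    using sols_props s by (auto simp: xy)
  define \<eta> where "\<eta> = lin s' / lin s"
  have \<eta>: "\<eta> \<noteq> 0" "\<eta> \<in> L" using nz mem SL by (auto simp: \<eta>_def subfield_divide)
  have eq: "unit_quot s' / unit_quot s = \<eta> * cnj (lin s / lin s')"
    using nz by (simp add: unit_quot_def \<eta>_def)
  also have "cnj (lin s / lin s') = inverse (cnj \<eta>)" by (simp add: \<eta>_def)
  finally have eq': "unit_quot s' / unit_quot s = \<eta> * inverse (cnj \<eta>)" .
  have "algebraic_int (unit_quot s' / unit_quot s)"
    unfolding eq \<eta>_def by (rule algebraic_int_times[OF int(1) algebraic_int_cnj[OF int(2)]])
  moreover have "unit_quot s' / unit_quot s \<in> L"
    unfolding eq' using \<eta> cnj_L SL by (intro subfield_mult subfield_inverse) auto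
  moreover have "cmod (\<tau> (unit_quot s' / unit_quot s)) = 1" if \<tau>: "\<tau> \<in> EL" for \<tau>
    unfolding eq' using \<eta> cnj_L[OF \<eta>(2)] embedding_eq_0_iff[OF SL \<tau> \<eta>(2)]
    by (simp add: embedding_mult[OF SL \<tau>] embedding_inverse[OF SL \<tau>] embedding_cnj_L[OF _ \<tau>]
        subfield_inverse[OF SL] norm_mult norm_inverse)
  ultimately show ?thesis by (intro unimodular_root_of_unity) (auto simp: ring_of_ints_def)
qed

text \<open>Equal quotients make \<open>\<lambda> = (x' - \<alpha>y') / (x - \<alpha>y)\<close> real, so \<open>(x', y') = \<lambda>(x, y)\<close> with \<open>\<lambda>\<^sup>n = 1\<close>.\<close>

lemma unit_quot_eq:
  assumes s: "(x, y) \<in> sols" "(x', y') \<in> sols" and eq: "unit_quot (x', y') = unit_quot (x, y)"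
  shows "(x', y') = (x, y) \<or> (x', y') = (-x, -y)"
proof -
  note p = sols_props[OF s(1)] and p' = sols_props[OF s(2)]
  define l where "l = lin (x', y') / lin (x, y)"
  have "lin (x', y') * cnj (lin (x, y)) = cnj (lin (x', y')) * lin (x, y)"
    using eq p(10) p'(10) by (simp add: unit_quot_def field_simps)
  then have "cnj l = l" using p(10) by (simp add: l_def field_simps)
  then have l: "l \<in> \<real>" by (simp add: Reals_cnj_iff)
  have "lin (x', y') = l * lin (x, y)" using p(10) by (simp add: l_def)
  then have *: "x' - l * x = \<alpha> * (y' - l * y)" by (simp add: lin_def algebra_simps)
  have "x' - l * x \<in> \<real>" "y' - l * y \<in> \<real>"
    using p(3,4) p'(3,4) K_real l by (auto intro!: Reals_diff Reals_mult)
  then have "y' - l * y = 0"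
    using * alpha_nonreal' by (metis Reals_divide nonzero_mult_div_cancel_right)
  then have xy: "x' = l * x" "y' = l * y" using * by auto
  have "b = l ^ n * b" using s binary_form_scale[of n a l x y] by (auto simp: form_solutions_def xy)
  then have "l ^ n = 1" using b by simp
  moreover obtain r where r: "l = complex_of_real r" using l by (auto elim: Reals_cases)
  ultimately have "r ^ n = 1" by (metis of_real_1 of_real_eq_iff of_real_power)
  then have "\<bar>r\<bar> = 1" using n power_eq_1_iff[of r n] by auto
  then have "l = 1 \<or> l = - 1" using r by (auto simp: abs_if split: if_splits)
  then show ?thesis using xy by auto
qed

text \<open>Division by the \<epsilon> of a fixed solution maps \<open>A\<close> to the roots of
  unity, and a fibre contains at most a solution and its negative.\<close>

lemma card_associated_sols:
  assumes A: "A \<subseteq> sols" and int: "\<And>s s'. s \<in> A \<Longrightarrow> s' \<in> A \<Longrightarrow> algebraic_int (lin s' / lin s)"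
  shows "finite A \<and> card A \<le> 2 * card (roots_of_unity L)"
proof (cases "A = {}")
  case False
  then obtain s0 where s0: "s0 \<in> A" by blast
  define f where "f = (\<lambda>s. unit_quot s / unit_quot s0)"
  have fU: "f s \<in> roots_of_unity L" if "s \<in> A" for s
    unfolding f_def using unit_quot_ratio[of s0 s] s0 that A int by blast
  have nz0: "unit_quot s0 \<noteq> 0"
    using sols_props(10) s0 A by (cases s0) (auto simp: unit_quot_def)
  have fibre: "finite {s\<in>A. f s = z} \<and> card {s\<in>A. f s = z} \<le> 2" for z
  proof (cases "{s\<in>A. f s = z} = {}")
    case False
    then obtain x y where xy: "(x, y) \<in> A" "f (x, y) = z" by auto
    have "{s\<in>A. f s = z} \<subseteq> {(x, y), (-x, -y)}"
    proof
      fix s assume s: "s \<in> {s\<in>A. f s = z}"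
      obtain x' y' where s': "s = (x', y')" by fastforce
      have "unit_quot (x', y') = unit_quot (x, y)" using s xy s' nz0 by (auto simp: f_def)
      then show "s \<in> {(x, y), (-x, -y)}" using unit_quot_eq[of x y x' y'] s s' xy A by auto
    qed
    moreover have "card {(x, y), (-x, -y)} \<le> 2" by (simp add: card_insert_if)
    ultimately show ?thesis
      by (meson card_mono finite.emptyI finite_insert finite_subset order_trans)
  next
    case True
    then show ?thesis by (simp only: card.empty) simp
  qed
  have AU: "A = (\<Union>z\<in>roots_of_unity L. {s\<in>A. f s = z})" using fU by auto
  have "card A \<le> (\<Sum>z\<in>roots_of_unity L. card {s\<in>A. f s = z})"
    by (subst AU) (rule card_UN_le[OF roots_of_unity(1)])
  also have "\<dots> \<le> (\<Sum>z\<in>roots_of_unity L. 2)" using fibre by (intro sum_mono) auto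
  finally have "card A \<le> 2 * card (roots_of_unity L)" by simp
  moreover have "finite A" by (subst AU) (use roots_of_unity fibre in auto)
  ultimately show ?thesis by blast
qed auto

abbreviation "Nb \<equiv> (\<Prod>\<sigma>\<in>EK. cmod (\<sigma> b))"

lemma card_sols_le: "finite sols" "real (card sols) \<le> 2 * 4 ^ (card EK * n) * Nb ^ 2"
proof -
  obtain R where R: "finite R" "real (card R) \<le> Nb"
    "\<And>x. x \<in> ring_of_ints K \<Longrightarrow> \<exists>s\<in>R. \<exists>t\<in>ring_of_ints K. x - s = b * t"
    using residue_system_exists[OF K b] by blast
  define A where "A = (\<lambda>(r, r'). {(x, y) \<in> sols. (\<exists>t\<in>ring_of_ints K. x - r = b * t) \<and>
      (\<exists>t\<in>ring_of_ints K. y - r' = b * t)})"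
  let ?w = "card (roots_of_unity L)"
  have A: "finite (A rr) \<and> card (A rr) \<le> 2 * ?w" for rr
  proof (rule card_associated_sols)
    show "A rr \<subseteq> sols" by (auto simp: A_def split: prod.splits)
    fix s s' assume s: "s \<in> A rr" "s' \<in> A rr"
    obtain r r' where rr: "rr = (r, r')" by fastforce
    obtain x y x' y' where xy: "s = (x, y)" "s' = (x', y')" by fastforce
    obtain t u t' u' where tu: "t \<in> ring_of_ints K" "u \<in> ring_of_ints K" "t' \<in> ring_of_ints K" "u' \<in> ring_of_ints K"
      "x - r = b * t" "y - r' = b * u" "x' - r = b * t'" "y' - r' = b * u'"
      using s by (auto simp: A_def rr xy)
    have "x' - x = b * (t' - t)" "y' - y = b * (u' - u)"
      using tu by (simp_all add: right_diff_distrib flip: tu(5-8))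
    moreover have "algebraic_int (t' - t)" "algebraic_int (u' - u)"
      using tu by (auto simp: ring_of_ints_def)
    moreover have "(x, y) \<in> sols" "(x', y') \<in> sols" using s by (auto simp: A_def rr xy)
    ultimately show "algebraic_int (lin s' / lin s)"
      unfolding xy using quotient_integral by blast
  qed
  have SU: "sols = (\<Union>rr\<in>R \<times> R. A rr)"
  proof
    show "sols \<subseteq> (\<Union>rr\<in>R \<times> R. A rr)"
    proof
      fix s assume s: "s \<in> sols"
      obtain x y where xy: "s = (x, y)" by fastforce
      obtain r r' where "r \<in> R" "\<exists>t\<in>ring_of_ints K. x - r = b * t" "r' \<in> R" "\<exists>t\<in>ring_of_ints K. y - r' = b * t"
        using R(3) sols_props(1,2)[of x y] s xy by metis
      then show "s \<in> (\<Union>rr\<in>R \<times> R. A rr)" using s by (force simp: A_def xy)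
    qed
    show "(\<Union>rr\<in>R \<times> R. A rr) \<subseteq> sols" by (auto simp: A_def)
  qed
  show "finite sols" by (subst SU) (use A R in auto)
  have "card sols \<le> (\<Sum>rr\<in>R \<times> R. card (A rr))"
    by (subst SU) (rule card_UN_le, use R in auto)
  also have "\<dots> \<le> (\<Sum>rr\<in>R \<times> R. 2 * ?w)" using A by (intro sum_mono) auto
  also have "\<dots> = (card R)\<^sup>2 * (2 * ?w)" by (simp add: card_cartesian_product power2_eq_square)
  also have "\<dots> \<le> (card R)\<^sup>2 * (2 * 4 ^ (card EK * n))"
  proof -
    have "card EL \<le> card EK * n" unfolding card_EL using rel_poly(2) by simp
    then have "(4::nat) ^ card EL \<le> 4 ^ (card EK * n)" by (rule power_increasing) simp
    with roots_of_unity(2) have "?w \<le> 4 ^ (card EK * n)" by (rule order_trans)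
    then show ?thesis by simp
  qed
  finally have "real (card sols) \<le> (real (card R))\<^sup>2 * (2 * 4 ^ (card EK * n))"
    by (metis (mono_tags, lifting) of_nat_le_iff of_nat_mult of_nat_numeral of_nat_power)
  also have "\<dots> \<le> Nb\<^sup>2 * (2 * 4 ^ (card EK * n))"
    using R(2) by (intro mult_right_mono power_mono) auto
  finally show "real (card sols) \<le> 2 * 4 ^ (card EK * n) * Nb ^ 2" by (simp add: mult_ac)
qed

lemma card_sols_unit:
  assumes c: "c \<in> ring_of_ints K" "b * c = 1"
  shows "card sols \<le> 2 * card (roots_of_unity L)"
proof -
  have "algebraic_int (lin s' / lin s)" if "s \<in> sols" "s' \<in> sols" for s s'
    using that quotient_integral_unit[of "fst s" "snd s" "fst s'" "snd s'" c] c
    by (simp add: ring_of_ints_def)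
  then show ?thesis using card_associated_sols[of sols] by blast
qed

end

section \<open>Absolute values of a totally real field\<close>

lemma absolute_value_0 [simp]: "absolute_value K v \<Longrightarrow> subfield K complex_ring \<Longrightarrow> v 0 = 0"
  by (simp add: absolute_value_def)

context
  fixes K :: "complex set" and v :: "complex \<Rightarrow> real"
  assumes S: "subfield K complex_ring" and v: "absolute_value K v"
begin

lemma absolute_value_nonneg: "x \<in> K \<Longrightarrow> 0 \<le> v x"
  and absolute_value_eq_0: "x \<in> K \<Longrightarrow> v x = 0 \<longleftrightarrow> x = 0"
  and absolute_value_mult: "x \<in> K \<Longrightarrow> y \<in> K \<Longrightarrow> v (x * y) = v x * v y"
  and absolute_value_add: "x \<in> K \<Longrightarrow> y \<in> K \<Longrightarrow> v (x + y) \<le> v x + v y"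
  using v by (auto simp: absolute_value_def)

lemma absolute_value_1: "v 1 = 1"
  using absolute_value_mult[of 1 1] absolute_value_eq_0[of 1] S by auto

lemma absolute_value_uminus: "x \<in> K \<Longrightarrow> v (- x) = v x"
proof -
  assume x: "x \<in> K"
  have m: "-1 \<in> K" using S subfield_uminus subfield_1 by blast
  have "v (-1) * v (-1) = 1" using absolute_value_mult[OF m m] absolute_value_1 by simp
  then have "v (-1) = 1" using absolute_value_nonneg[OF m] by (metis abs_of_nonneg abs_square_eq_1 power2_eq_square)
  then show ?thesis using absolute_value_mult[OF m x] by simp
qed

lemma absolute_value_power: "x \<in> K \<Longrightarrow> v (x ^ k) = v x ^ k"
  by (induction k) (auto simp: absolute_value_1 absolute_value_mult subfield_power[OF S])

lemma absolute_value_sum: "(\<And>i. i \<in> I \<Longrightarrow> f i \<in> K) \<Longrightarrow> v (\<Sum>i\<in>I. f i) \<le> (\<Sum>i\<in>I. v (f i))"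
proof (induction I rule: infinite_finite_induct)
  case (insert i I)
  then show ?case
    using absolute_value_add[of "f i" "\<Sum>i\<in>I. f i"] subfield_sum[OF S, of I f] by auto
qed (use v S in auto)

lemma absolute_value_prod: "(\<And>i. i \<in> I \<Longrightarrow> f i \<in> K) \<Longrightarrow> v (\<Prod>i\<in>I. f i) = (\<Prod>i\<in>I. v (f i))"
  by (induction I rule: infinite_finite_induct)
    (auto simp: absolute_value_1 absolute_value_mult subfield_prod[OF S])

lemma absolute_value_diff: "x \<in> K \<Longrightarrow> y \<in> K \<Longrightarrow> \<bar>v x - v y\<bar> \<le> v (x - y)"
  using absolute_value_add[of y "x - y"] absolute_value_add[of x "y - x"]
    absolute_value_uminus[of "x - y"] subfield_diff[OF S, of x y] subfield_diff[OF S, of y x] by auto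

end

text \<open>\<open>absolute_value\<close> supplies only the triangle inequality, not the ultrametric
  one. But all powers of \<open>x\<close> are integer combinations of one finite set
  \<open>B\<close>, and rational integers have p-adic value at most 1, so the powers of
  \<open>v x\<close> stay bounded.\<close>

lemma padic_absolute_value_int_le_1:
  assumes S: "subfield K complex_ring" and v: "absolute_value K v"
    and p: "Factorial_Ring.prime p" "\<And>q::rat. v (of_rat q) = padic_abs p q"
    and x: "x \<in> ring_of_ints K"
  shows "v x \<le> 1"
proof -
  have xK: "x \<in> K" and "algebraic_int x" using x by (auto simp: ring_of_ints_def)
  have vint: "v (of_int k) \<le> 1" for k
  proof -
    have "v (of_int k) = padic_abs p (of_int k)" using p(2)[of "of_int k"] by simp
    also have "\<dots> \<le> 1"
      using prime_gt_1_nat[OF p(1)]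
      by (auto simp: padic_abs_def power_int_def divide_simps intro!: power_le_one)
    finally show ?thesis .
  qed
  obtain f where f: "lead_coeff f = 1" "\<forall>i. coeff f i \<in> \<int>" "poly f x = 0"
    using \<open>algebraic_int x\<close> by (auto elim: algebraic_int.cases)
  have one: "finite {1::complex}" "1 \<in> {1::complex}" by auto
  \<comment> \<open>Starting from \<open>{1}\<close>, the generators are powers of \<open>x\<close>;
    hence they lie in \<open>K\<close>, where \<open>v\<close> is multiplicative and
    subadditive.\<close>
  obtain B where B: "finite B" "1 \<in> B" "B \<subseteq> {x ^ i * b |i b. b \<in> {1}}" "x \<in> int_stable B"
    using int_stable_extend[OF one f(1,3)] int_stable_Ints[OF one(1)] f(2) by blast
  have BK: "B \<subseteq> K" using B(3) xK S by (auto simp: subfield_power)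
  define C where "C = (\<Sum>b\<in>B. v b)"
  have "v x ^ k \<le> C * 1 ^ k" for k
  proof -
    have "x ^ k \<in> int_stable B"
      by (induction k) (use B int_stable_Ints[OF B(1)] in \<open>auto intro: int_stable_mult\<close>)
    then have "x ^ k \<in> int_span B" using B(2) by (force simp: int_stable_def)
    then obtain c :: "complex \<Rightarrow> int" where c: "x ^ k = (\<Sum>b\<in>B. of_int (c b) * b)"
      by (auto simp: int_span_def)
    have "v x ^ k = v (\<Sum>b\<in>B. of_int (c b) * b)"
      using absolute_value_power[OF S v xK, of k] c by simp
    also have "\<dots> \<le> (\<Sum>b\<in>B. v (of_int (c b) * b))"
      using BK S by (intro absolute_value_sum[OF S v]) (auto intro!: subfield_mult subfield_of_int)
    also have "\<dots> = (\<Sum>b\<in>B. v (of_int (c b)) * v b)"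
      using BK S by (intro sum.cong absolute_value_mult[OF S v]) (auto intro: subfield_of_int)
    also have "\<dots> \<le> (\<Sum>b\<in>B. 1 * v b)"
      using BK vint absolute_value_nonneg[OF S v] by (intro sum_mono mult_right_mono) auto
    finally show ?thesis by (simp add: C_def)
  qed
  then show ?thesis by (rule pow_le_const_imp_le) simp
qed

section \<open>Archimedean absolute values\<close>

lemma cmod_of_rat: "cmod (of_rat q) = of_rat \<bar>q\<bar>"
proof -
  have "complex_of_rat q = complex_of_real (of_rat q)"
    by (cases q) (simp add: of_rat_rat)
  then show ?thesis by (simp add: abs_if of_rat_minus)
qed

lemma tendsto_0_norm_bound:
  fixes f :: "nat \<Rightarrow> 'a :: real_normed_vector"
  assumes "\<And>n. norm (f n) \<le> g n" "g \<longlonglongrightarrow> 0"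
  shows "f \<longlonglongrightarrow> 0"
  by (rule tendsto_norm_zero_cancel,
      rule tendsto_sandwich[OF always_eventually always_eventually tendsto_const assms(2)])
    (use assms(1) in auto)

text \<open>Stated for sequences, because a representative of an element of the completion has to be
  replaced term by term by a rational sequence; a constant sequence gives approximations to a single
  real number.\<close>

lemma rational_approximation:
  assumes "\<And>n. c n \<in> \<real>"
  shows "\<exists>q. (\<forall>n::nat. q n \<in> \<rat>) \<and> (\<lambda>n. q n - c n :: complex) \<longlonglongrightarrow> 0"
proof -
  have "\<exists>r. r \<in> \<rat> \<and> cmod (r - c j) < 1 / real (Suc j)" for j
  proof -
    obtain s where s: "c j = of_real s" using assms[of j] by (auto elim: Reals_cases)
    obtain r where "r \<in> \<rat>" "s < r" "r < s + 1 / real (Suc j)"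
      using Rats_dense_in_real[of s "s + 1 / real (Suc j)"] by auto
    moreover from this(1) have "complex_of_real r \<in> \<rat>" by (auto elim!: Rats_cases')
    ultimately show ?thesis
      by (intro exI[of _ "of_real r"]) (auto simp: s simp flip: of_real_diff)
  qed
  then obtain q where q: "\<And>j. q j \<in> \<rat>" "\<And>j. cmod (q j - c j) < 1 / real (Suc j)" by metis
  have "(\<lambda>j. q j - c j) \<longlonglongrightarrow> 0"
    by (rule tendsto_0_norm_bound[OF _ LIMSEQ_inverse_real_of_nat])
      (use less_imp_le[OF q(2)] in \<open>auto simp: inverse_eq_divide\<close>)
  then show ?thesis using q(1) by blast
qed

lemma tendsto_coeff_prod_linear:
  fixes f :: "'a \<Rightarrow> nat \<Rightarrow> complex"
  assumes "finite A" "\<And>x. x \<in> A \<Longrightarrow> f x \<longlonglongrightarrow> g x"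
  shows "(\<lambda>j. coeff (\<Prod>x\<in>A. [:- f x j, 1:]) i) \<longlonglongrightarrow> coeff (\<Prod>x\<in>A. [:- g x, 1:]) i"
  using assms
proof (induction A arbitrary: i rule: finite_induct)
  case (insert x A)
  have c: "coeff ([:- r, 1:] * p) i = - r * coeff p i + (case i of 0 \<Rightarrow> 0 | Suc k \<Rightarrow> coeff p k)"
    for r :: complex and p by (simp add: coeff_pCons)
  have "(\<lambda>j. - f x j * coeff (\<Prod>x\<in>A. [:- f x j, 1:]) i +
        (case i of 0 \<Rightarrow> 0 | Suc k \<Rightarrow> coeff (\<Prod>x\<in>A. [:- f x j, 1:]) k))
      \<longlonglongrightarrow> - g x * coeff (\<Prod>x\<in>A. [:- g x, 1:]) i + (case i of 0 \<Rightarrow> 0 | Suc k \<Rightarrow> coeff (\<Prod>x\<in>A. [:- g x, 1:]) k)"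
    using insert by (cases i) (auto intro!: tendsto_intros simp del: mult_minus_left)
  then show ?case unfolding prod.insert[OF insert.hyps] c .
qed auto

text \<open>Let \<open>m = \<Prod>(X - \<rho>)\<close> be the minimal polynomial of a primitive element \<open>\<theta>\<close>. If the rationals \<open>r\<^sub>\<rho>\<close> are
  close to the real numbers \<open>\<rho>\<close>, then \<open>\<Prod>v(\<theta> - r\<^sub>\<rho>)\<close> is close to \<open>v(m(\<theta>)) = 0\<close>; in the limit some factor
  vanishes, and \<open>v\<close> is the absolute value induced by \<open>\<theta> \<mapsto> \<rho>\<close>.\<close>

lemma archimedean_absolute_value:
  assumes K: "number_field K" "totally_real K" and v: "absolute_value K v"
    and arch: "\<And>q::rat. v (of_rat q) = of_rat \<bar>q\<bar>"
  shows "\<exists>\<sigma>\<in>field_embeddings K. \<forall>x\<in>K. v x = cmod (\<sigma> x)"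
proof -
  note S = number_field_subfield[OF K(1)]
  have vQ: "v q = cmod q" if "q \<in> \<rat>" for q
  proof -
    obtain r where "q = of_rat r" using \<open>q \<in> \<rat>\<close> by (rule Rats_cases)
    then show ?thesis using arch cmod_of_rat by simp
  qed
  have QK: "q \<in> K" if "q \<in> \<rat>" for q using that Rats_subset_subfield[OF S] by blast
  obtain \<theta> where \<theta>: "\<theta> \<in> K" "K = simple_ext \<rat> \<theta>" using primitive_element[OF K(1)] by blast
  obtain m where m: "minimal_poly \<rat> \<theta> m"
    using minimal_poly_exists[OF subfield_Rats number_field_algebraic[OF K(1) \<theta>(1)]] by blast
  note bij = bij_betw_field_embeddings[OF m, folded \<theta>(2)]
  define A where "A = {\<rho>. poly m \<rho> = 0}"
  have "m \<noteq> 0" "poly m \<theta> = 0" "m \<in> polys_over \<rat>" using m by (auto simp: minimal_poly_def)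
  have A: "finite A" using \<open>m \<noteq> 0\<close> by (simp add: A_def poly_roots_finite)
  have mA: "m = (\<Prod>\<rho>\<in>A. [:- \<rho>, 1:])" using bij(2) by (simp add: A_def)
  have real: "\<rho> \<in> \<real>" if "\<rho> \<in> A" for \<rho>
  proof -
    have "\<rho> \<in> (\<lambda>\<sigma>. \<sigma> \<theta>) ` field_embeddings K" using that bij(1) by (simp add: bij_betw_def A_def)
    then obtain \<sigma> where "\<sigma> \<in> field_embeddings K" "\<rho> = \<sigma> \<theta>" by blast
    then show ?thesis using K(2) \<theta>(1) by (auto simp: totally_real_def)
  qed
  have "\<exists>q. (\<forall>j::nat. q j \<in> \<rat>) \<and> (\<lambda>j. q j - \<rho>) \<longlonglongrightarrow> 0" if "\<rho> \<in> A" for \<rho>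
    using rational_approximation[of "\<lambda>_. \<rho>"] real[OF that] by blast
  then obtain r where r: "\<And>\<rho> j. \<rho> \<in> A \<Longrightarrow> r \<rho> (j::nat) \<in> \<rat>" "\<And>\<rho>. \<rho> \<in> A \<Longrightarrow> (\<lambda>j. r \<rho> j - \<rho>) \<longlonglongrightarrow> 0"
    by metis
  have rlim: "r \<rho> \<longlonglongrightarrow> \<rho>" if "\<rho> \<in> A" for \<rho>
    using r(2)[OF that] by (simp add: LIM_zero_iff)
  \<comment> \<open>\<open>v\<close> is still unknown at \<theta>, but it is the usual modulus on
    \<rat>, where the differences of the approximants lie; hence the sequence is Cauchy.\<close>
  have "\<exists>l. (\<lambda>j. v (\<theta> - r \<rho> j)) \<longlonglongrightarrow> l" if \<rho>: "\<rho> \<in> A" for \<rho>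
  proof -
    have "Cauchy (\<lambda>j. v (\<theta> - r \<rho> j))"
    proof (rule metric_CauchyI)
      fix e :: real assume e: "e > 0"
      have "Cauchy (r \<rho>)" using rlim[OF \<rho>] LIMSEQ_imp_Cauchy by blast
      then obtain M where M: "\<And>i j. i \<ge> M \<Longrightarrow> j \<ge> M \<Longrightarrow> dist (r \<rho> i) (r \<rho> j) < e"
        using e metric_CauchyD by blast
      have "dist (v (\<theta> - r \<rho> i)) (v (\<theta> - r \<rho> j)) < e" if ij: "i \<ge> M" "j \<ge> M" for i j
      proof -
        have "\<bar>v (\<theta> - r \<rho> i) - v (\<theta> - r \<rho> j)\<bar> \<le> v ((\<theta> - r \<rho> i) - (\<theta> - r \<rho> j))"
          using \<theta>(1) r(1)[OF \<rho>] QK S by (intro absolute_value_diff[OF S v]) (auto intro: subfield_diff)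
        also have "\<dots> = cmod (r \<rho> j - r \<rho> i)" using r(1)[OF \<rho>] by (subst vQ[symmetric]) auto
        also have "\<dots> < e" using M[OF ij(2,1)] by (simp add: dist_norm)
        finally show ?thesis by (simp add: dist_real_def)
      qed
      then show "\<exists>M. \<forall>i\<ge>M. \<forall>j\<ge>M. dist (v (\<theta> - r \<rho> i)) (v (\<theta> - r \<rho> j)) < e" by blast
    qed
    then show ?thesis using Cauchy_convergent convergent_def by blast
  qed
  then obtain l where l: "\<And>\<rho>. \<rho> \<in> A \<Longrightarrow> (\<lambda>j. v (\<theta> - r \<rho> j)) \<longlonglongrightarrow> l \<rho>" by metis
  define p where "p = (\<lambda>j. \<Prod>\<rho>\<in>A. [:- r \<rho> j, 1:])"
  have pj: "p j \<in> polys_over \<rat>" for j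
  proof -
    have "B \<subseteq> A \<Longrightarrow> (\<Prod>\<rho>\<in>B. [:- r \<rho> j, 1:]) \<in> polys_over \<rat>" for B
      by (induction B rule: infinite_finite_induct)
        (use subfield_Rats r(1) in \<open>auto intro!: polys_over_mult polys_over_pCons polys_over_0 polys_over_1
           simp del: mult_pCons_left\<close>)
    then show ?thesis by (simp add: p_def)
  qed
  have degp: "degree (p j) \<le> card A" "degree m \<le> card A" for j
    unfolding p_def mA by (rule order_trans[OF degree_prod_sum_le[OF A]]; simp)+
  \<comment> \<open>As \<open>poly m \<theta> = 0\<close>, the product is the value of
    \<open>p j - m\<close> at \<theta>. The coefficients of this polynomial are rational, and there
    \<open>v\<close> is the usual modulus.\<close>
  have prod: "(\<Prod>\<rho>\<in>A. v (\<theta> - r \<rho> j)) \<le> (\<Sum>i\<le>card A. cmod (coeff (p j) i - coeff m i) * v \<theta> ^ i)" for j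
  proof -
    have pm: "poly q \<theta> = (\<Sum>i\<le>card A. coeff q i * \<theta> ^ i)" if "degree q \<le> card A" for q
      unfolding poly_altdef using that by (intro sum.mono_neutral_left) (auto simp: coeff_eq_0)
    have rat: "coeff (p j) i - coeff m i \<in> \<rat>" for i
      using pj[of j] \<open>m \<in> polys_over \<rat>\<close> by (auto simp: polys_over_coeff)
    have "(\<Prod>\<rho>\<in>A. v (\<theta> - r \<rho> j)) = v (\<Prod>\<rho>\<in>A. (\<theta> - r \<rho> j))"
      using \<theta>(1) r(1) QK S by (intro absolute_value_prod[OF S v, symmetric]) (auto intro: subfield_diff)
    also have "(\<Prod>\<rho>\<in>A. (\<theta> - r \<rho> j)) = poly (p j) \<theta> - poly m \<theta>"
      using \<open>poly m \<theta> = 0\<close> by (simp add: p_def poly_prod)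
    also have "\<dots> = (\<Sum>i\<le>card A. (coeff (p j) i - coeff m i) * \<theta> ^ i)"
      unfolding pm[OF degp(1)] pm[OF degp(2)] by (simp add: sum_subtractf algebra_simps)
    also have "v \<dots> \<le> (\<Sum>i\<le>card A. v ((coeff (p j) i - coeff m i) * \<theta> ^ i))"
      using rat \<theta>(1) QK S by (intro absolute_value_sum[OF S v]) (auto intro!: subfield_mult subfield_power)
    also have "\<dots> = (\<Sum>i\<le>card A. cmod (coeff (p j) i - coeff m i) * v \<theta> ^ i)"
      using rat \<theta>(1) QK S vQ[OF rat] absolute_value_power[OF S v \<theta>(1)]
      by (intro sum.cong) (auto simp: absolute_value_mult[OF S v] subfield_power)
    finally show ?thesis .
  qed
  have "(\<lambda>j. \<Sum>i\<le>card A. cmod (coeff (p j) i - coeff m i) * v \<theta> ^ i) \<longlonglongrightarrow> (\<Sum>i\<le>card A. 0 * v \<theta> ^ i)"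
  proof (intro tendsto_sum tendsto_mult tendsto_const tendsto_norm_zero)
    fix i
    show "(\<lambda>j. coeff (p j) i - coeff m i) \<longlonglongrightarrow> 0"
      using tendsto_coeff_prod_linear[of A r "\<lambda>x. x" i, OF A rlim] unfolding p_def mA[symmetric]
      by (simp add: LIM_zero)
  qed
  then have lim0: "(\<lambda>j. \<Sum>i\<le>card A. cmod (coeff (p j) i - coeff m i) * v \<theta> ^ i) \<longlonglongrightarrow> 0" by simp
  have nonneg: "0 \<le> (\<Prod>\<rho>\<in>A. v (\<theta> - r \<rho> j))" for j
    using \<theta>(1) QK[OF r(1)] by (intro prod_nonneg ballI absolute_value_nonneg[OF S v] subfield_diff[OF S])
  have "(\<lambda>j. \<Prod>\<rho>\<in>A. v (\<theta> - r \<rho> j)) \<longlonglongrightarrow> 0"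
    by (rule tendsto_0_norm_bound[OF _ lim0]) (simp only: real_norm_def abs_of_nonneg[OF nonneg] prod)
  moreover have "(\<lambda>j. \<Prod>\<rho>\<in>A. v (\<theta> - r \<rho> j)) \<longlonglongrightarrow> (\<Prod>\<rho>\<in>A. l \<rho>)" using l by (intro tendsto_prod)
  ultimately have "(\<Prod>\<rho>\<in>A. l \<rho>) = 0" using LIMSEQ_unique by blast
  then obtain \<rho> where \<rho>: "\<rho> \<in> A" "l \<rho> = 0" using A by (auto simp: prod_zero_iff)
  have l0: "(\<lambda>j. v (\<theta> - r \<rho> j)) \<longlonglongrightarrow> 0" using l[OF \<rho>(1)] \<rho>(2) by simp
  \<comment> \<open>The rationals \<open>r \<rho> j\<close> tend to \<theta> with respect to
    \<open>v\<close> and to \<rho> in the usual sense. Polynomials are continuous in both senses,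
    and at rational arguments the two absolute values agree.\<close>
  have vP: "v (poly P \<theta>) = cmod (poly P \<rho>)" if P: "P \<in> polys_over \<rat>" for P
  proof -
    have mem: "poly P \<theta> \<in> K" "poly P (r \<rho> j) \<in> \<rat>" if "P \<in> polys_over \<rat>" for P j
      using that \<theta>(1) r(1)[OF \<rho>(1)] poly_in_subfield[OF S polys_over_mono[OF Rats_subset_subfield[OF S]]]
        poly_in_subfield[OF subfield_Rats] by blast+
    have "(\<lambda>j. v (poly P \<theta> - poly P (r \<rho> j))) \<longlonglongrightarrow> 0"
      using P
    proof (induction P)
      case (pCons c P)
      have P: "P \<in> polys_over \<rat>"
        using pCons.prems by (auto simp: polys_over_def coeff_pCons split: nat.splits)
      have bound: "v (poly (pCons c P) \<theta> - poly (pCons c P) (r \<rho> j))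
          \<le> v (\<theta> - r \<rho> j) * v (poly P \<theta>) + cmod (r \<rho> j) * v (poly P \<theta> - poly P (r \<rho> j))" for j
      proof -
        have rj: "r \<rho> j \<in> K" "r \<rho> j \<in> \<rat>" using r(1)[OF \<rho>(1)] QK by auto
        have d: "\<theta> - r \<rho> j \<in> K" "poly P \<theta> - poly P (r \<rho> j) \<in> K"
          using \<theta>(1) rj mem[OF P] QK S by (auto intro!: subfield_diff)
        have "poly (pCons c P) \<theta> - poly (pCons c P) (r \<rho> j)
            = (\<theta> - r \<rho> j) * poly P \<theta> + r \<rho> j * (poly P \<theta> - poly P (r \<rho> j))" by (simp add: algebra_simps)
        also have "v \<dots> \<le> v ((\<theta> - r \<rho> j) * poly P \<theta>) + v (r \<rho> j * (poly P \<theta> - poly P (r \<rho> j)))"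
          using d rj mem[OF P] S by (intro absolute_value_add[OF S v] subfield_mult)
        also have "\<dots> = v (\<theta> - r \<rho> j) * v (poly P \<theta>) + cmod (r \<rho> j) * v (poly P \<theta> - poly P (r \<rho> j))"
          using d rj mem[OF P] by (simp add: absolute_value_mult[OF S v] vQ)
        finally show ?thesis .
      qed
      have "(\<lambda>j. v (\<theta> - r \<rho> j) * v (poly P \<theta>) + cmod (r \<rho> j) * v (poly P \<theta> - poly P (r \<rho> j)))
          \<longlonglongrightarrow> 0 * v (poly P \<theta>) + cmod \<rho> * 0"
        by (intro tendsto_intros l0 rlim \<rho> pCons.IH P)
      then have lim: "(\<lambda>j. v (\<theta> - r \<rho> j) * v (poly P \<theta>) + cmod (r \<rho> j) * v (poly P \<theta> - poly P (r \<rho> j))) \<longlonglongrightarrow> 0"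
        by simp
      have nn: "0 \<le> v (poly (pCons c P) \<theta> - poly (pCons c P) (r \<rho> j))" for j
        using mem[OF pCons.prems] QK by (intro absolute_value_nonneg[OF S v] subfield_diff[OF S]) blast+
      show ?case
        by (rule tendsto_0_norm_bound[OF _ lim]) (simp only: real_norm_def abs_of_nonneg[OF nn] bound)
    qed (use v S in simp)
    note lim = this
    have "norm (v (poly P \<theta>) - cmod (poly P (r \<rho> j))) \<le> v (poly P \<theta> - poly P (r \<rho> j))" for j
      using absolute_value_diff[OF S v mem(1)[OF P] QK[OF mem(2)[OF P]], of j] vQ[OF mem(2)[OF P], of j]
      by simp
    from tendsto_0_norm_bound[OF this lim]
    have "(\<lambda>j. v (poly P \<theta>) - cmod (poly P (r \<rho> j))) \<longlonglongrightarrow> 0" .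
    moreover have "(\<lambda>j. v (poly P \<theta>) - cmod (poly P (r \<rho> j))) \<longlonglongrightarrow> v (poly P \<theta>) - cmod (poly P \<rho>)"
      by (intro tendsto_intros rlim \<rho>)
    ultimately show ?thesis using LIMSEQ_unique by fastforce
  qed
  have "\<rho> \<in> (\<lambda>\<sigma>. \<sigma> \<theta>) ` field_embeddings K" using \<rho>(1) bij(1) by (simp add: bij_betw_def A_def)
  then obtain \<sigma> where \<sigma>: "\<sigma> \<in> field_embeddings K" "\<sigma> \<theta> = \<rho>" by blast
  have "v x = cmod (\<sigma> x)" if x: "x \<in> K" for x
  proof -
    obtain P where P: "P \<in> polys_over \<rat>" "x = poly P \<theta>" using x \<theta>(2) by (auto simp: simple_ext_def)
    have "\<sigma> x = poly P \<rho>"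
      using embedding_poly[OF S \<sigma>(1) polys_over_mono[OF Rats_subset_subfield[OF S] P(1)] \<theta>(1)]
        map_poly_embedding_Rats[OF S \<sigma>(1) P(1)] \<sigma>(2) P(2) by simp
    then show ?thesis using vP[OF P(1)] P(2) by simp
  qed
  then show ?thesis using \<sigma>(1) by blast
qed

subsection \<open>Local degrees at the real places\<close>

text \<open>Restricted to \<open>K\<close> because the members of \<open>abs_values\<close> are
  extensional.\<close>

definition place :: "complex set \<Rightarrow> (complex \<Rightarrow> complex) \<Rightarrow> complex \<Rightarrow> real" where
  "place K \<sigma> = restrict (\<lambda>x. cmod (\<sigma> x)) K"

context
  fixes K :: "complex set" and \<sigma> :: "complex \<Rightarrow> complex"
  assumes K: "number_field K" "totally_real K" and \<sigma>: "\<sigma> \<in> field_embeddings K"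
begin

lemma cauchy_seqs_place: "cauchy_seqs K (place K \<sigma>) = {s. range s \<subseteq> K \<and> convergent (\<lambda>n. \<sigma> (s n))}"
proof -
  note S = number_field_subfield[OF K(1)]
  have "(\<forall>e>0. \<exists>N. \<forall>m\<ge>N. \<forall>n\<ge>N. place K \<sigma> (s m - s n) < e) \<longleftrightarrow> convergent (\<lambda>n. \<sigma> (s n))"
    if s: "range s \<subseteq> K" for s
  proof -
    have "place K \<sigma> (s m - s n) = dist (\<sigma> (s m)) (\<sigma> (s n))" for m n
    proof -
      have "s m \<in> K" "s n \<in> K" using s by auto
      then show ?thesis
        using S by (simp add: place_def subfield_diff embedding_diff[OF S \<sigma>] dist_norm)
    qed
    then show ?thesis by (simp add: Cauchy_convergent_iff[symmetric] Cauchy_def)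
  qed
  then show ?thesis by (auto simp: cauchy_seqs_def)
qed

lemma cauchy_ring_place: "ring (cauchy_ring K (place K \<sigma>))"
proof -
  note S = number_field_subfield[OF K(1)]
  have mem: "s n \<in> K" if "range s \<subseteq> K" for s n using that by auto
  have add: "(\<lambda>n. s n + t n) \<in> cauchy_seqs K (place K \<sigma>)"
    and mult: "(\<lambda>n. s n * t n) \<in> cauchy_seqs K (place K \<sigma>)"
    if "s \<in> cauchy_seqs K (place K \<sigma>)" "t \<in> cauchy_seqs K (place K \<sigma>)" for s t
    using that S unfolding cauchy_seqs_place
    by (auto simp: embedding_add[OF S \<sigma> mem mem] embedding_mult[OF S \<sigma> mem mem] subfield_add subfield_mult mem
        intro: convergent_add convergent_mult)
  have const: "(\<lambda>n. c) \<in> cauchy_seqs K (place K \<sigma>)" if "c \<in> K" for c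
    using that unfolding cauchy_seqs_place by (auto simp: convergent_const)
  have neg: "(\<lambda>n. - s n) \<in> cauchy_seqs K (place K \<sigma>)" if "s \<in> cauchy_seqs K (place K \<sigma>)" for s
    using mult[OF const that, of "-1"] S subfield_uminus[OF S subfield_1[OF S]] by simp
  show ?thesis
  proof (rule ringI)
    show "abelian_group (cauchy_ring K (place K \<sigma>))"
    proof (rule abelian_groupI)
      fix s assume "s \<in> carrier (cauchy_ring K (place K \<sigma>))"
      then show "\<exists>t\<in>carrier (cauchy_ring K (place K \<sigma>)). t \<oplus>\<^bsub>cauchy_ring K (place K \<sigma>)\<^esub> s = \<zero>\<^bsub>cauchy_ring K (place K \<sigma>)\<^esub>"
        using neg by (intro bexI[of _ "\<lambda>n. - s n"]) (auto simp: cauchy_ring_def)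
    qed (use add const[of 0] S in \<open>auto simp: cauchy_ring_def add_ac\<close>)
    show "monoid (cauchy_ring K (place K \<sigma>))"
      by unfold_locales (use mult const[of 1] S in \<open>auto simp: cauchy_ring_def mult_ac\<close>)
  qed (auto simp: cauchy_ring_def algebra_simps)
qed

text \<open>The kernel of this map is the ideal of null sequences and its image is all of \<real>;
  this is how the completion is identified with the real field.\<close>

lemma lim_ring_hom:
  "ring_hom_ring (cauchy_ring K (place K \<sigma>)) (complex_ring\<lparr>carrier := \<real>\<rparr>) (\<lambda>s. lim (\<lambda>n. \<sigma> (s n)))"
proof (rule ring_hom_ringI)
  note S = number_field_subfield[OF K(1)]
  show "ring (cauchy_ring K (place K \<sigma>))" by (rule cauchy_ring_place)
  have "subfield \<real> complex_ring" unfolding complex_subfield_iff by auto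
  then show "ring (complex_ring\<lparr>carrier := \<real>\<rparr>)"
    by (intro CR.subring_is_ring subfieldE(1))
  have mem: "s n \<in> K" if "range s \<subseteq> K" for s n using that by auto
  fix s assume s: "s \<in> carrier (cauchy_ring K (place K \<sigma>))"
  then have sK: "range s \<subseteq> K" "convergent (\<lambda>n. \<sigma> (s n))" by (auto simp: cauchy_ring_def cauchy_seqs_place)
  then have "(\<lambda>n. Im (\<sigma> (s n))) \<longlonglongrightarrow> Im (lim (\<lambda>n. \<sigma> (s n)))"
    by (intro tendsto_Im) (simp add: convergent_LIMSEQ_iff)
  moreover have "Im (\<sigma> (s n)) = 0" for n
    using K(2) \<sigma> mem[OF sK(1)] by (auto simp: totally_real_def complex_is_Real_iff image_subset_iff)
  ultimately have "Im (lim (\<lambda>n. \<sigma> (s n))) = 0" by (simp add: LIMSEQ_const_iff)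
  then show "lim (\<lambda>n. \<sigma> (s n)) \<in> carrier (complex_ring\<lparr>carrier := \<real>\<rparr>)"
    by (simp add: complex_is_Real_iff)
  fix t assume t: "t \<in> carrier (cauchy_ring K (place K \<sigma>))"
  then have tK: "range t \<subseteq> K" "convergent (\<lambda>n. \<sigma> (t n))" by (auto simp: cauchy_ring_def cauchy_seqs_place)
  have l: "(\<lambda>n. \<sigma> (s n)) \<longlonglongrightarrow> lim (\<lambda>n. \<sigma> (s n))" "(\<lambda>n. \<sigma> (t n)) \<longlonglongrightarrow> lim (\<lambda>n. \<sigma> (t n))"
    using sK tK by (auto simp: convergent_LIMSEQ_iff)
  show "lim (\<lambda>n. \<sigma> ((s \<otimes>\<^bsub>cauchy_ring K (place K \<sigma>)\<^esub> t) n)) =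
      lim (\<lambda>n. \<sigma> (s n)) \<otimes>\<^bsub>complex_ring\<lparr>carrier := \<real>\<rparr>\<^esub> lim (\<lambda>n. \<sigma> (t n))"
    using tendsto_mult[OF l] by (simp add: cauchy_ring_def embedding_mult[OF S \<sigma> mem[OF sK(1)] mem[OF tK(1)]] limI)
  show "lim (\<lambda>n. \<sigma> ((s \<oplus>\<^bsub>cauchy_ring K (place K \<sigma>)\<^esub> t) n)) =
      lim (\<lambda>n. \<sigma> (s n)) \<oplus>\<^bsub>complex_ring\<lparr>carrier := \<real>\<rparr>\<^esub> lim (\<lambda>n. \<sigma> (t n))"
    using tendsto_add[OF l] by (simp add: cauchy_ring_def embedding_add[OF S \<sigma> mem[OF sK(1)] mem[OF tK(1)]] limI)
next
  show "lim (\<lambda>n. \<sigma> (\<one>\<^bsub>cauchy_ring K (place K \<sigma>)\<^esub> n)) = \<one>\<^bsub>complex_ring\<lparr>carrier := \<real>\<rparr>\<^esub>"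
    by (simp add: cauchy_ring_def embedding_1[OF number_field_subfield[OF K(1)] \<sigma>])
qed

text \<open>The completion is isomorphic to \<real>, and \<rat> is dense in \<real>. So every class
  contains a rational sequence, \<open>rat_completion\<close> is the whole completion, and a field
  has dimension one over itself.\<close>

lemma local_degree_place: "local_degree K (place K \<sigma>) = 1"
proof -
  note S = number_field_subfield[OF K(1)]
  let ?v = "place K \<sigma>" and ?h = "\<lambda>s. lim (\<lambda>n. \<sigma> (s n))"
  let ?R = "cauchy_ring K ?v" and ?S = "complex_ring\<lparr>carrier := \<real>\<rparr>"
  interpret h: ring_hom_ring ?R ?S ?h by (rule lim_ring_hom)
  have mem: "s n \<in> K" if "range s \<subseteq> K" for s n using that by auto
  have null: "s \<in> null_seqs K ?v \<longleftrightarrow> s \<in> carrier ?R \<and> ?h s = 0" for s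
  proof (cases "s \<in> carrier ?R")
    case True
    then have s: "range s \<subseteq> K" "convergent (\<lambda>n. \<sigma> (s n))" by (auto simp: cauchy_ring_def cauchy_seqs_place)
    have "(\<lambda>n. ?v (s n)) = (\<lambda>n. cmod (\<sigma> (s n)))" using mem[OF s(1)] by (simp add: place_def)
    then have "(\<lambda>n. ?v (s n)) \<longlonglongrightarrow> 0 \<longleftrightarrow> (\<lambda>n. \<sigma> (s n)) \<longlonglongrightarrow> 0" by (simp add: tendsto_norm_zero_iff)
    also have "\<dots> \<longleftrightarrow> ?h s = 0" using s(2) by (metis convergent_LIMSEQ_iff limI)
    finally show ?thesis using True by (simp add: null_seqs_def cauchy_ring_def)
  qed (auto simp: null_seqs_def cauchy_ring_def)
  then have ker: "a_kernel ?R ?S ?h = null_seqs K ?v"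
    unfolding a_kernel_def' by (auto simp: ring_of_type_algebra_def)
  have surj: "?h ` carrier ?R = carrier ?S"
  proof
    show "?h ` carrier ?R \<subseteq> carrier ?S" using h.hom_closed by blast
    show "carrier ?S \<subseteq> ?h ` carrier ?R"
    proof
      fix x assume "x \<in> carrier ?S"
      then have "x \<in> \<real>" by simp
      then obtain q where q: "\<And>n. q n \<in> \<rat>" "(\<lambda>n. q n - x) \<longlonglongrightarrow> 0"
        using rational_approximation[of "\<lambda>_. x"] by blast
      have lim: "(\<lambda>n. \<sigma> (q n)) \<longlonglongrightarrow> x"
        using q(2) embedding_Rats[OF S \<sigma> q(1)] by (simp add: LIM_zero_iff)
      then have "q \<in> carrier ?R"
        using q(1) Rats_subset_subfield[OF S] by (auto simp: cauchy_ring_def cauchy_seqs_place convergent_def)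
      then show "x \<in> ?h ` carrier ?R" using limI[OF lim] by (intro image_eqI[of _ _ q]) auto
    qed
  qed
  have id: "ideal (null_seqs K ?v) ?R" using h.kernel_is_ideal ker by simp
  have comp_ring: "ring (completion K ?v)"
    unfolding completion_def by (rule ideal.quotient_is_ring[OF id])
  have iso: "completion K ?v \<simeq> ?S"
    using h.FactRing_iso[OF surj] by (simp add: ker completion_def)
  then obtain g where g: "g \<in> ring_iso ?S (completion K ?v)"
    using ring_iso_sym[OF comp_ring iso] by (auto simp: is_ring_iso_def)
  have "field ?S"
    using CR.subfield_iff(2)[of \<real>] by (simp add: complex_subfield_iff)
  from field.ring_iso_imp_img_field[OF this g]
  have "field (completion K ?v \<lparr>ring.zero := g \<zero>\<^bsub>?S\<^esub>\<rparr>)" .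
  \<comment> \<open>The transfer rule describes the target ring with its zero replaced by the image
    of zero; this equation restores the completion itself.\<close>
  moreover have "g \<zero>\<^bsub>?S\<^esub> = \<zero>\<^bsub>completion K ?v\<^esub>"
    using g ring_hom_zero[OF _ h.S.ring_axioms comp_ring, of g] by (simp add: ring_iso_def)
  ultimately have field: "field (completion K ?v)" by simp
  have rat: "rat_completion K ?v = carrier (completion K ?v)"
  proof
    show "rat_completion K ?v \<subseteq> carrier (completion K ?v)"
      by (auto simp: rat_completion_def completion_def FactRing_def A_RCOSETS_def' cauchy_ring_def)
    show "carrier (completion K ?v) \<subseteq> rat_completion K ?v"
    proof
      fix c assume "c \<in> carrier (completion K ?v)"
      then obtain s where s: "s \<in> carrier ?R" "c = null_seqs K ?v +>\<^bsub>?R\<^esub> s"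
        by (auto simp: completion_def FactRing_def A_RCOSETS_def')
      then have sK: "range s \<subseteq> K" "convergent (\<lambda>n. \<sigma> (s n))" by (auto simp: cauchy_ring_def cauchy_seqs_place)
      have "\<sigma> (s n) \<in> \<real>" for n using K(2) \<sigma> mem[OF sK(1)] by (auto simp: totally_real_def)
      then obtain q where q: "\<And>n. q n \<in> \<rat>" "(\<lambda>n. q n - \<sigma> (s n)) \<longlonglongrightarrow> 0"
        using rational_approximation[of "\<lambda>n. \<sigma> (s n)"] by blast
      have sl: "(\<lambda>n. \<sigma> (s n)) \<longlonglongrightarrow> ?h s" using sK by (simp add: convergent_LIMSEQ_iff)
      have lim: "(\<lambda>n. \<sigma> (q n)) \<longlonglongrightarrow> ?h s"
        using tendsto_add[OF q(2) sl] embedding_Rats[OF S \<sigma> q(1)] by simp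
      then have qR: "q \<in> carrier ?R"
        using q(1) Rats_subset_subfield[OF S] by (auto simp: cauchy_ring_def cauchy_seqs_place convergent_def)
      have "?h s = ?h q" using limI[OF lim] by simp
      then have "s \<in> null_seqs K ?v +>\<^bsub>?R\<^esub> q"
        using h.homeq_imp_rcos[OF qR s(1)] by (simp add: ker)
      then have "c = null_seqs K ?v +>\<^bsub>?R\<^esub> q"
        using h.R.a_repr_independence'[of s "null_seqs K ?v" q] qR
          additive_subgroup.a_subgroup[OF ideal.axioms(1)[OF id]] s(2) by (simp add: a_r_coset_def)
      then show "c \<in> rat_completion K ?v"
        using qR q(1) by (auto simp: rat_completion_def cauchy_ring_def)
    qed
  qed
  interpret C: field "completion K ?v" by (rule field)
  have sub: "subfield (carrier (completion K ?v)) (completion K ?v)" by (rule C.carrier_is_subfield)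
  have "C.dimension 1 (carrier (completion K ?v)) (carrier (completion K ?v))" by (rule C.dimension_one[OF sub])
  from C.dimI[OF sub this] show ?thesis by (simp add: local_degree_def rat over_def)
qed

end

section \<open>Heights of integral points\<close>

lemma place_abs_values:
  assumes K: "number_field K" and \<sigma>: "\<sigma> \<in> field_embeddings K"
  shows "place K \<sigma> \<in> abs_values K" "place K \<sigma> (of_rat q) = of_rat \<bar>q\<bar>"
proof -
  note S = number_field_subfield[OF K]
  show *: "place K \<sigma> (of_rat q) = of_rat \<bar>q\<bar>" for q
  proof -
    have "of_rat q \<in> K" using Rats_subset_subfield[OF S] by (rule subsetD) simp
    then show ?thesis
      using cmod_of_rat[of q] embedding_Rats[OF S \<sigma>, of "of_rat q"] by (simp add: place_def)
  qed
  have "absolute_value K (place K \<sigma>)"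
    unfolding absolute_value_def using S
    by (auto simp: place_def embedding_eq_0_iff[OF S \<sigma>] embedding_mult[OF S \<sigma>] embedding_add[OF S \<sigma>]
        subfield_mult subfield_add norm_mult norm_triangle_ineq)
  then show "place K \<sigma> \<in> abs_values K" using * by (auto simp: abs_values_def)
qed

text \<open>A real number s is determined by |s| and |s + 1|. Total reality matters here, since two
  complex conjugate embeddings induce the same absolute value.\<close>

lemma inj_on_place:
  assumes K: "number_field K" "totally_real K"
  shows "inj_on (place K) (field_embeddings K)"
proof (rule inj_onI, rule embedding_ext[of _ K])
  note S = number_field_subfield[OF K(1)]
  fix \<sigma> \<tau> x assume \<sigma>: "\<sigma> \<in> field_embeddings K" and \<tau>: "\<tau> \<in> field_embeddings K"
    and eq: "place K \<sigma> = place K \<tau>" and x: "x \<in> K"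
  have e: "cmod (\<sigma> y) = cmod (\<tau> y)" if "y \<in> K" for y
    using fun_cong[OF eq, of y] that by (simp add: place_def)
  obtain s t where st: "\<sigma> x = of_real s" "\<tau> x = of_real t"
    using K(2) \<sigma> \<tau> x unfolding totally_real_def by (meson Reals_cases image_subset_iff)
  have "\<bar>s\<bar> = \<bar>t\<bar>" using e[OF x] st by simp
  moreover have "\<sigma> (x + 1) = of_real (s + 1)" "\<tau> (x + 1) = of_real (t + 1)"
    using st x S by (simp_all add: embedding_add[OF S \<sigma>] embedding_add[OF S \<tau>] embedding_1[OF S \<sigma>] embedding_1[OF S \<tau>])
  then have "\<bar>s + 1\<bar> = \<bar>t + 1\<bar>" using e[of "x + 1"] x S by (simp add: subfield_add del: of_real_add)
  ultimately have "s = t" by linarith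
  then show "\<sigma> x = \<tau> x" using st by simp
qed

lemma field_height_integral:
  assumes K: "number_field K" "totally_real K" and xs: "set xs \<subseteq> ring_of_ints K" "1 \<in> set xs \<or> -1 \<in> set xs"
  shows "field_height K xs = (\<Prod>\<sigma>\<in>field_embeddings K. Max ((\<lambda>x. cmod (\<sigma> x)) ` set xs))"
proof -
  note S = number_field_subfield[OF K(1)]
  let ?f = "\<lambda>v. Max (v ` set xs) ^ local_degree K v"
  let ?A = "place K ` field_embeddings K"
  have xsK: "set xs \<subseteq> K" using xs by (auto simp: ring_of_ints_def)
  have A: "?A \<subseteq> abs_values K" using place_abs_values[OF K(1)] by blast
  have triv: "?f v = 1" if v: "v \<in> abs_values K - ?A" for v
  proof -
    have av: "absolute_value K v" using v by (auto simp: abs_values_def)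
    \<comment> \<open>An absolute value extending the ordinary one would be the place of some
      embedding, and \<open>v\<close> lies outside \<open>?A\<close>.\<close>
    have "\<exists>p. Factorial_Ring.prime p \<and> (\<forall>q. v (of_rat q) = padic_abs p q)"
    proof (rule ccontr)
      assume "\<not> ?thesis"
      then have "\<And>q. v (of_rat q) = of_rat \<bar>q\<bar>" using v by (auto simp: abs_values_def)
      from archimedean_absolute_value[OF K av this]
      obtain \<sigma> where \<sigma>: "\<sigma> \<in> field_embeddings K" "\<forall>x\<in>K. v x = cmod (\<sigma> x)" by blast
      have "v = place K \<sigma>"
        using av \<sigma>(2) by (intro extensionalityI[of _ K]) (auto simp: absolute_value_def place_def)
      then show False using v \<sigma>(1) by blast
    qed
    then obtain p where p: "Factorial_Ring.prime p" "\<And>q. v (of_rat q) = padic_abs p q" by blast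
    have le: "v x \<le> 1" if "x \<in> set xs" for x
      using padic_absolute_value_int_le_1[OF S av p] xs(1) that by blast
    have "1 \<in> v ` set xs"
      using xs(2) absolute_value_1[OF S av] absolute_value_uminus[OF S av, of 1] S by (auto simp: image_iff)
    then have "Max (v ` set xs) = 1" using le by (intro Max_eqI) auto
    then show ?thesis by simp
  qed
  have "field_height K xs = prod' ?f ?A"
    unfolding field_height_def
    by (rule prod.mono_neutral_left'[OF A, symmetric]) (use triv in blast)
  also have "\<dots> = prod ?f ?A" using field_embeddings_finite_card(1)[OF K(1)] by simp
  also have "\<dots> = (\<Prod>\<sigma>\<in>field_embeddings K. ?f (place K \<sigma>))"
    by (rule prod.reindex_cong[OF inj_on_place[OF K]]) auto
  also have "\<dots> = (\<Prod>\<sigma>\<in>field_embeddings K. Max ((\<lambda>x. cmod (\<sigma> x)) ` set xs))"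
  proof (rule prod.cong[OF refl])
    fix \<sigma> assume \<sigma>: "\<sigma> \<in> field_embeddings K"
    have "place K \<sigma> ` set xs = (\<lambda>x. cmod (\<sigma> x)) ` set xs"
      using xsK by (intro image_cong) (auto simp: place_def)
    then show "?f (place K \<sigma>) = Max ((\<lambda>x. cmod (\<sigma> x)) ` set xs)"
      by (simp add: local_degree_place[OF K \<sigma>])
  qed
  finally show ?thesis .
qed

section \<open>The Thue equation: bounding solutions\<close>

text \<open>Cauchy's root bound, kept free of division by the leading coefficient. It later trades
  the factor \<open>a 0\<close> that clears denominators against the size of \<alpha>.\<close>

lemma root_bound_leading_coeff:
  fixes z :: complex
  assumes root: "(\<Sum>i\<le>n. c i * z ^ (n - i)) = 0" and n: "n > 0" and M: "\<And>i. i \<le> n \<Longrightarrow> cmod (c i) \<le> M"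
  shows "max 1 (cmod z) * cmod (c 0) \<le> 2 * M"
proof (cases "cmod z \<le> 1")
  case True
  have "0 \<le> cmod (c 0)" "cmod (c 0) \<le> M" using M[of 0] by auto
  then have "cmod (c 0) \<le> 2 * M" by linarith
  then show ?thesis using True by (simp add: max_absorb1)
next
  case False
  define t where "t = cmod z"
  have t: "t > 1" using False by (simp add: t_def)
  have "(\<Sum>i\<le>n. c i * z ^ (n - i)) = c 0 * z ^ n + (\<Sum>i<n. c (Suc i) * z ^ (n - Suc i))"
    by (simp add: lessThan_Suc_atMost[symmetric] sum.lessThan_Suc_shift del: sum.lessThan_Suc)
  then have "c 0 * z ^ n = - (\<Sum>i<n. c (Suc i) * z ^ (n - Suc i))"
    using root by (simp add: eq_neg_iff_add_eq_0)
  then have "cmod (c 0) * t ^ n = cmod (\<Sum>i<n. c (Suc i) * z ^ (n - Suc i))"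
    by (metis norm_minus_cancel norm_mult norm_power t_def)
  also have "\<dots> \<le> (\<Sum>i<n. M * t ^ (n - Suc i))"
    by (rule order_trans[OF norm_sum], rule sum_mono)
      (use M in \<open>auto simp: norm_mult norm_power t_def intro!: mult_right_mono\<close>)
  also have "\<dots> = M * (\<Sum>i<n. t ^ i)"
    by (simp add: sum.nat_diff_reindex[of "\<lambda>i. t ^ i"] flip: sum_distrib_left)
  finally have "cmod (c 0) * t ^ n * (t - 1) \<le> M * (\<Sum>i<n. t ^ i) * (t - 1)"
    using t by (intro mult_right_mono) auto
  also have "\<dots> = M * (t ^ n - 1)"
    using power_diff_1_eq[of t n] by (simp add: mult_ac)
  also have "\<dots> \<le> M * t ^ n"
    using order_trans[OF norm_ge_zero M[of 0]] by (intro mult_left_mono) auto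
  finally have "(cmod (c 0) * (t - 1)) * t ^ n \<le> M * t ^ n" by (simp add: mult_ac)
  then have "cmod (c 0) * (t - 1) \<le> M" using t by (simp add: mult_le_cancel_right)
  then show ?thesis using M[of 0] t by (simp add: t_def max_absorb2 algebra_simps)
qed

lemma power_max_mult_le:
  fixes s F :: real
  assumes "0 \<le> s" "0 \<le> F" "F \<le> C" "s ^ n * F \<le> C"
  shows "max 1 s ^ n * F \<le> C"
  using assms by (cases "s \<le> 1") (auto simp: max_def)

context cm_thue
begin

text \<open>The factor at \<sigma> of the height of \<Gamma>; the inserted \<open>1\<close> is the
  extra coordinate of that point.\<close>

definition "coeff_max \<sigma> = Max (insert 1 ((\<lambda>i. cmod (\<sigma> (a i))) ` {..n}))"

lemma coeff_max: "1 \<le> coeff_max \<sigma>" "i \<le> n \<Longrightarrow> cmod (\<sigma> (a i)) \<le> coeff_max \<sigma>"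
  unfolding coeff_max_def by (rule Max_ge; simp)+

text \<open>F(U, V) has \<open>n + 1\<close> terms. One factor \<open>2 ^ n\<close> arises because U
  and V are at most 2 max(1, |\<alpha>|) at each embedding, the other from
  \<open>root_bound_leading_coeff\<close>. That lemma also contributes \<open>n\<close> copies of
  \<open>coeff_max\<close>, and a coefficient of F one more. The factor
  \<open>max 1 (cmod (\<sigma> b))\<close> covers the right-hand sides b U^n and b V^n, and the last
  power of \<open>b\<close> clears denominators.\<close>

definition "local_bound \<sigma> = (real n + 1) * 4 ^ n * coeff_max \<sigma> ^ (n + 1) * max 1 (cmod (\<sigma> b)) * cmod (\<sigma> b) ^ n"

text \<open>With \<open>\<delta> = x - \<alpha>y\<close>, \<open>\<epsilon> = \<delta>/cnj \<delta>\<close>, \<open>U = \<alpha> - \<epsilon> cnj \<alpha>\<close> and \<open>V = 1 - \<epsilon>\<close> one has \<open>xV = yU\<close>. All conjugates of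
  \<open>\<epsilon>\<close> lie on the unit circle and \<open>b\<epsilon>\<close> is integral up to a denominator dividing \<open>a\<^sub>0\<close>. The conjugates of
  \<open>F(U,V)\<close> are therefore bounded above, and its norm is bounded below.\<close>

lemma conjugate_bound:
  assumes s: "(x, y) \<in> sols" and y: "y \<noteq> 0" and z: "z = x \<or> z = y"
  shows "(\<Prod>\<sigma>\<in>EK. max 1 (cmod (\<sigma> z)) ^ n) \<le> (\<Prod>\<sigma>\<in>EK. local_bound \<sigma>)"
proof -
  note p = sols_props[OF s]
  define \<delta> where "\<delta> = lin (x, y)"
  define \<epsilon> where "\<epsilon> = unit_quot (x, y)"
  define U where "U = \<alpha> - \<epsilon> * cnj \<alpha>"
  define V where "V = 1 - \<epsilon>"
  define F where "F = binary_form n a U V"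
  have \<delta>: "\<delta> \<in> L" "\<delta> \<noteq> 0" and b\<delta>: "b = \<delta> * coform x y" using p by (auto simp: \<delta>_def)
  have \<epsilon>\<delta>: "\<epsilon> = \<delta> / cnj \<delta>" by (simp add: \<epsilon>_def unit_quot_def \<delta>_def)
  have \<epsilon>L: "\<epsilon> \<in> L" unfolding \<epsilon>\<delta> using \<delta> cnj_L SL by (simp add: subfield_divide)
  have real: "cnj x = x" "cnj y = y" "cnj b = b"
    using p(3,4) bK(1) K_real by (auto simp: Reals_cnj_iff subset_iff)
  have cnj\<delta>: "cnj \<delta> = x - cnj \<alpha> * y" by (simp add: \<delta>_def lin_def real)
  have "\<delta> = \<epsilon> * cnj \<delta>" using \<delta> by (simp add: \<epsilon>\<delta>)
  then have xV: "x * V = y * U"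
    unfolding cnj\<delta> by (simp add: \<delta>_def lin_def U_def V_def algebra_simps)
  have V0: "V \<noteq> 0"
  proof
    assume "V = 0"
    then have "U = 0" using xV y by simp
    then have "\<alpha> = cnj \<alpha>" using \<open>V = 0\<close> by (simp add: U_def V_def)
    then show False using alpha_nonreal' by (metis Reals_cnj_iff)
  qed
  have sol: "binary_form n a x y = b" using s by (simp add: form_solutions_def)
  have yF: "y ^ n * F = V ^ n * b"
    using binary_form_scale[of n a y U V] binary_form_scale[of n a V x y] xV sol
    by (simp add: F_def mult.commute)
  have xF: "x ^ n * F = U ^ n * b"
    using binary_form_scale[of n a x U V] binary_form_scale[of n a U x y] xV sol
    by (simp add: F_def mult.commute)
  have F0: "F \<noteq> 0" using yF V0 b by auto
  have UL: "U \<in> L" "V \<in> L"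
    using \<epsilon>L alphaL cnj_L by (auto simp: U_def V_def intro!: subfield_closed[OF SL])
  have aL: "a i \<in> L" if "i \<le> n" for i using aK[OF that] K_subset_L by blast
  have bL: "b \<in> L" using bK K_subset_L by blast
  have FL: "F \<in> L"
    unfolding F_def binary_form_def using UL aL by (intro subfield_sum[OF SL] subfield_mult[OF SL] subfield_power[OF SL]) auto
  have zL: "z \<in> L" "z \<in> K" using z p by auto
  \<comment> \<open>By homogeneity this is the form at \<open>a 0 * b * U\<close> and
    \<open>a 0 * b * V\<close>: \<open>b\<close> clears the denominator of \<epsilon>, and
    \<open>a 0\<close> those of \<alpha> and \<delta>.\<close>
  define W where "W = (a 0 * b) ^ n * F"
  have "W = binary_form n a (a 0 * b * U) (a 0 * b * V)" by (simp add: W_def F_def binary_form_scale)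
  moreover have "algebraic_int (a 0 * b * U)" "algebraic_int (a 0 * b * V)"
  proof -
    have a0: "algebraic_int (a 0)" "algebraic_int (\<alpha> * a 0)"
      using a_int[of 0] coform_coeff_int(2)[of 0] by (auto simp: coform_coeff_def)
    \<comment> \<open>\<open>b\<close> is real, so its factorisation may be conjugated; the
      conjugate of \<delta> then cancels the denominator of \<epsilon>.\<close>
    have "b = cnj \<delta> * cnj (coform x y)" using real(3) b\<delta> by (metis complex_cnj_mult)
    then have b\<epsilon>: "b * \<epsilon> = \<delta> * cnj (coform x y)" using \<delta>(2) by (simp add: \<epsilon>\<delta>)
    have "algebraic_int (a 0 * x - (\<alpha> * a 0) * y)"
      by (intro algebraic_int_diff algebraic_int_times a0 p(5,6))
    then have a\<delta>: "algebraic_int (a 0 * \<delta>)" by (simp add: \<delta>_def lin_def algebra_simps)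
    note G = coform_int[OF p(5,6), THEN algebraic_int_cnj]
    have "a 0 * b * U = (\<alpha> * a 0) * b - (a 0 * \<delta>) * cnj (\<alpha> * coform x y)"
    proof -
      have "a 0 * b * U = \<alpha> * a 0 * b - a 0 * (b * \<epsilon>) * cnj \<alpha>" by (simp add: U_def algebra_simps)
      also have "\<dots> = (\<alpha> * a 0) * b - (a 0 * \<delta>) * cnj (\<alpha> * coform x y)"
        unfolding b\<epsilon> by (simp add: mult_ac)
      finally show ?thesis .
    qed
    moreover have "algebraic_int \<dots>"
      by (rule algebraic_int_diff[OF algebraic_int_times[OF a0(2) bK(2)] algebraic_int_times[OF a\<delta> G(2)]])
    ultimately show "algebraic_int (a 0 * b * U)" by (simp only:)
    have "a 0 * b * V = a 0 * b - (a 0 * \<delta>) * cnj (coform x y)"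
    proof -
      have "a 0 * b * V = a 0 * b - a 0 * (b * \<epsilon>)" by (simp add: V_def algebra_simps)
      also have "\<dots> = a 0 * b - (a 0 * \<delta>) * cnj (coform x y)"
        unfolding b\<epsilon> by (simp add: mult_ac)
      finally show ?thesis .
    qed
    moreover have "algebraic_int \<dots>"
      by (rule algebraic_int_diff[OF algebraic_int_times[OF a0(1) bK(2)] algebraic_int_times[OF a\<delta> G(1)]])
    ultimately show "algebraic_int (a 0 * b * V)" by (simp only:)
  qed
  ultimately have "algebraic_int W"
    unfolding binary_form_def using a_int
    by (auto intro!: algebraic_int_sum algebraic_int_times algebraic_int_power)
  moreover have "W \<in> L" unfolding W_def using aL[of 0] bL FL by (intro subfield_mult[OF SL] subfield_power[OF SL]) auto
  moreover have "W \<noteq> 0" using F0 b a by (simp add: W_def)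
  ultimately have W1: "1 \<le> (\<Prod>\<tau>\<in>EL. cmod (\<tau> W))"
    by (intro norm_ge_1[OF L]) (auto simp: ring_of_ints_def)
  have key: "max 1 (cmod (\<tau> z)) ^ n * cmod (\<tau> W) \<le> local_bound (restrict \<tau> K)" if \<tau>: "\<tau> \<in> EL" for \<tau>
  proof -
    note hom = embedding_mult[OF SL \<tau>] embedding_diff[OF SL \<tau>] embedding_power[OF SL \<tau>] embedding_1[OF SL \<tau>]
      embedding_divide[OF SL \<tau>]
    note cl = subfield_mult[OF SL] subfield_power[OF SL] subfield_diff[OF SL] subfield_divide[OF SL]
    let ?G = "coeff_max (restrict \<tau> K)"
    define A where "A = max 1 (cmod (\<tau> \<alpha>))"
    have A: "A \<ge> 1" "cmod (\<tau> \<alpha>) \<le> A" by (auto simp: A_def)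
    have ca: "cmod (\<tau> (a i)) \<le> ?G" if "i \<le> n" for i
      using coeff_max(2)[OF that, of "restrict \<tau> K"] aK[OF that] by simp
    have G: "1 \<le> ?G" by (rule coeff_max(1))
    have c\<alpha>: "\<tau> (cnj \<alpha>) = cnj (\<tau> \<alpha>)" by (rule embedding_cnj_L[OF alphaL \<tau>])
    have "\<tau> \<epsilon> = \<tau> \<delta> / cnj (\<tau> \<delta>)"
      unfolding \<epsilon>\<delta> using \<delta>(1) cnj_L[OF \<delta>(1)] by (simp add: hom embedding_cnj_L[OF _ \<tau>])
    moreover have "\<tau> \<delta> \<noteq> 0" using embedding_eq_0_iff[OF SL \<tau> \<delta>(1)] \<delta>(2) by simp
    ultimately have \<epsilon>1: "cmod (\<tau> \<epsilon>) = 1" by (simp add: norm_divide)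
    have "\<tau> U = \<tau> \<alpha> - \<tau> \<epsilon> * cnj (\<tau> \<alpha>)"
      using alphaL \<epsilon>L cnj_L[OF alphaL] by (simp add: U_def hom cl c\<alpha>)
    then have "cmod (\<tau> U) \<le> cmod (\<tau> \<alpha>) + cmod (\<tau> \<epsilon>) * cmod (cnj (\<tau> \<alpha>))"
      using norm_triangle_ineq4[of "\<tau> \<alpha>" "\<tau> \<epsilon> * cnj (\<tau> \<alpha>)"] by (simp only: norm_mult)
    then have U: "cmod (\<tau> U) \<le> 2 * A" using \<epsilon>1 A by simp
    have "cmod (\<tau> V) \<le> 1 + cmod (\<tau> \<epsilon>)"
      using \<epsilon>L SL norm_triangle_ineq4[of 1 "\<tau> \<epsilon>"] by (simp add: V_def hom)
    then have V: "cmod (\<tau> V) \<le> 2 * A" using \<epsilon>1 A by simp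
    have Un: "cmod (\<tau> U) ^ k \<le> (2 * A) ^ k" "cmod (\<tau> V) ^ k \<le> (2 * A) ^ k" for k
      by (rule power_mono[OF U norm_ge_zero], rule power_mono[OF V norm_ge_zero])
    have "\<tau> F = (\<Sum>i\<le>n. \<tau> (a i) * \<tau> U ^ (n - i) * \<tau> V ^ i)"
    proof -
      have "\<tau> F = (\<Sum>i\<le>n. \<tau> (a i * U ^ (n - i) * V ^ i))"
        unfolding F_def binary_form_def by (rule embedding_sum[OF SL \<tau>]) (use UL aL in \<open>auto intro!: cl\<close>)
      also have "\<dots> = (\<Sum>i\<le>n. \<tau> (a i) * \<tau> U ^ (n - i) * \<tau> V ^ i)"
        by (rule sum.cong[OF refl]) (use UL aL in \<open>simp add: hom cl\<close>)
      finally show ?thesis .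
    qed
    also have "cmod \<dots> \<le> (\<Sum>i\<le>n. ?G * (2 * A) ^ n)"
    proof (rule order_trans[OF norm_sum], rule sum_mono)
      fix i assume i: "i \<in> {..n}"
      have "cmod (\<tau> (a i) * \<tau> U ^ (n - i) * \<tau> V ^ i) = cmod (\<tau> (a i)) * cmod (\<tau> U) ^ (n - i) * cmod (\<tau> V) ^ i"
        by (simp add: norm_mult norm_power)
      also have "\<dots> \<le> ?G * (2 * A) ^ (n - i) * (2 * A) ^ i"
        using ca[of i] i Un G A by (intro mult_mono) auto
      also have "\<dots> = ?G * (2 * A) ^ n" 
        using i power_add[of "2 * A" "n - i" i] by (simp only: mult.assoc) simp
      finally show "cmod (\<tau> (a i) * \<tau> U ^ (n - i) * \<tau> V ^ i) \<le> ?G * (2 * A) ^ n" .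
    qed
    also have "\<dots> = (real n + 1) * (?G * (2 * A) ^ n)" by simp
    finally have F: "cmod (\<tau> F) \<le> (real n + 1) * (?G * (2 * A) ^ n)" .
    let ?B = "max 1 (cmod (\<tau> b))"
    define C where "C = (real n + 1) * (?G * (2 * A) ^ n) * ?B"
    have nn: "0 \<le> (2 * A) ^ n" "0 \<le> (real n + 1) * (?G * (2 * A) ^ n)" using A G by auto
    have "cmod (\<tau> F) \<le> C"
      unfolding C_def by (rule order_trans[OF F]) (use nn in \<open>simp add: mult_le_cancel_left1\<close>)
    moreover have "cmod (\<tau> z) ^ n * cmod (\<tau> F) \<le> C"
    proof -
      \<comment> \<open>Both coordinates are treated at once, as U and V have the same
        bound.\<close>
      have "z ^ n * F = V ^ n * b \<or> z ^ n * F = U ^ n * b" using z xF yF by blast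
      then have "\<tau> z ^ n * \<tau> F = \<tau> V ^ n * \<tau> b \<or> \<tau> z ^ n * \<tau> F = \<tau> U ^ n * \<tau> b"
        using zL FL UL bL by (metis embedding_mult[OF SL \<tau>] embedding_power[OF SL \<tau>] subfield_power[OF SL])
      then have "cmod (\<tau> z ^ n * \<tau> F) = cmod (\<tau> V) ^ n * cmod (\<tau> b) \<or>
          cmod (\<tau> z ^ n * \<tau> F) = cmod (\<tau> U) ^ n * cmod (\<tau> b)"
        by (metis norm_mult norm_power)
      then have "cmod (\<tau> z ^ n * \<tau> F) \<le> (2 * A) ^ n * cmod (\<tau> b)"
        using mult_right_mono[OF Un(1) norm_ge_zero] mult_right_mono[OF Un(2) norm_ge_zero] by metis
      also have "\<dots> \<le> (2 * A) ^ n * ?B" using nn by (intro mult_left_mono) auto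
      also have "\<dots> \<le> (real n + 1) * ?G * ((2 * A) ^ n * ?B)"
      proof -
        have "1 * 1 \<le> (real n + 1) * ?G" using G by (intro mult_mono) auto
        then show ?thesis using nn(1) mult_right_mono[of 1 "(real n + 1) * ?G" "(2 * A) ^ n * ?B"] by simp
      qed
      also have "\<dots> = C" by (simp add: C_def)
      finally show ?thesis by (simp add: norm_mult norm_power)
    qed
    ultimately have "max 1 (cmod (\<tau> z)) ^ n * cmod (\<tau> F) \<le> C"
      by (intro power_max_mult_le) auto
    moreover have "\<tau> W = (\<tau> (a 0) * \<tau> b) ^ n * \<tau> F"
      using aL[of 0] bL FL by (simp add: W_def hom cl)
    ultimately have "max 1 (cmod (\<tau> z)) ^ n * cmod (\<tau> W) \<le> (cmod (\<tau> (a 0)) * cmod (\<tau> b)) ^ n * C"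
      using mult_left_mono[of "max 1 (cmod (\<tau> z)) ^ n * cmod (\<tau> F)" C "(cmod (\<tau> (a 0)) * cmod (\<tau> b)) ^ n"]
      by (simp add: norm_mult norm_power mult_ac)
    also have "\<dots> = (real n + 1) * ?G * (2 * (A * cmod (\<tau> (a 0)))) ^ n * ?B * cmod (\<tau> b) ^ n"
      by (simp add: C_def power_mult_distrib mult_ac)
    \<comment> \<open>Each of the \<open>n\<close> factors \<open>a 0\<close> is paired with one
      factor \<open>A\<close>; the image of \<alpha> is a root of the conjugate form, so
      \<open>root_bound_leading_coeff\<close> bounds each pair.\<close>
    also have "\<dots> \<le> (real n + 1) * ?G * (4 * ?G) ^ n * ?B * cmod (\<tau> b) ^ n"
    proof -
      have "(\<Sum>i\<le>n. \<tau> (a i) * \<tau> \<alpha> ^ (n - i)) = 0"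
      proof -
        have "(\<Sum>i\<le>n. \<tau> (a i) * \<tau> \<alpha> ^ (n - i)) = (\<Sum>i\<le>n. \<tau> (a i * \<alpha> ^ (n - i)))"
          by (rule sum.cong[OF refl]) (use alphaL aL in \<open>simp add: hom cl\<close>)
        also have "\<dots> = \<tau> (\<Sum>i\<le>n. a i * \<alpha> ^ (n - i))"
          by (rule embedding_sum[OF SL \<tau>, symmetric]) (use alphaL aL in \<open>auto intro!: cl\<close>)
        finally show ?thesis by (simp add: root_eq embedding_0[OF SL \<tau>])
      qed
      then have "A * cmod (\<tau> (a 0)) \<le> 2 * ?G"
        unfolding A_def using ca n by (intro root_bound_leading_coeff) auto
      then have "2 * (A * cmod (\<tau> (a 0))) \<le> 4 * ?G" by simp
      then have "(2 * (A * cmod (\<tau> (a 0)))) ^ n \<le> (4 * ?G) ^ n" using A by (intro power_mono) auto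
      then show ?thesis using G by (intro mult_right_mono mult_left_mono) auto
    qed
    also have "\<dots> = local_bound (restrict \<tau> K)"
      using bK(1) by (simp add: local_bound_def power_mult_distrib mult_ac)
    finally show ?thesis .
  qed
  \<comment> \<open>Except for the values of \<open>W\<close>, whose product is at least 1,
    everything depends only on the restriction to \<open>K\<close>; so both sides are powers with
    exponent \<open>degree rel_poly\<close>.\<close>
  have "(\<Prod>\<sigma>\<in>EK. max 1 (cmod (\<sigma> z)) ^ n) ^ degree rel_poly
      = (\<Prod>\<tau>\<in>EL. max 1 (cmod (\<tau> z)) ^ n)"
    using prod_EL[of "\<lambda>\<sigma>. max 1 (cmod (\<sigma> z)) ^ n"] zL by simp
  also have "\<dots> \<le> (\<Prod>\<tau>\<in>EL. max 1 (cmod (\<tau> z)) ^ n) * (\<Prod>\<tau>\<in>EL. cmod (\<tau> W))"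
  proof -
    have "0 \<le> (\<Prod>\<tau>\<in>EL. max 1 (cmod (\<tau> z)) ^ n)" by (intro prod_nonneg) auto
    then show ?thesis using mult_left_mono[OF W1] by simp
  qed
  also have "\<dots> = (\<Prod>\<tau>\<in>EL. max 1 (cmod (\<tau> z)) ^ n * cmod (\<tau> W))" by (simp add: prod.distrib)
  also have "\<dots> \<le> (\<Prod>\<tau>\<in>EL. local_bound (restrict \<tau> K))" using key by (intro prod_mono) auto
  also have "\<dots> = (\<Prod>\<sigma>\<in>EK. local_bound \<sigma>) ^ degree rel_poly" by (rule prod_EL)
  finally show ?thesis
    using rel_poly(3) coeff_max(1)
    by (subst (asm) power_mono_iff)
      (auto intro!: prod_nonneg simp: local_bound_def order_trans[OF zero_le_one])
qed

text \<open>Here \<epsilon> = 1 and V = 0, so a_0 x^n = b takes the place of the identities in U and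
  V. The bound is weakened to \<open>local_bound\<close> so that the passage to heights is shared
  with the other case.\<close>

lemma conjugate_bound_y0:
  assumes s: "(x, 0) \<in> sols"
  shows "(\<Prod>\<sigma>\<in>EK. max 1 (cmod (\<sigma> x)) ^ n) \<le> (\<Prod>\<sigma>\<in>EK. local_bound \<sigma>)"
proof -
  note p = sols_props[OF s]
  note E = field_embeddings_finite_card[OF K(1)]
  have "binary_form n a x 0 = b" using s by (simp add: form_solutions_def)
  moreover have "binary_form n a x 0 = (\<Sum>i\<le>n. if i = 0 then a 0 * x ^ n else 0)"
    unfolding binary_form_def by (intro sum.cong) auto
  ultimately have eq: "a 0 * x ^ n = b" by simp
  have a0: "1 \<le> (\<Prod>\<sigma>\<in>EK. cmod (\<sigma> (a 0)))" using a by (intro norm_ge_1[OF K(1)]) auto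
  have Nb: "1 \<le> Nb ^ n" using norm_ge_1[OF K(1) b] by (rule one_le_power)
  let ?M = "\<Prod>\<sigma>\<in>EK. max 1 (cmod (\<sigma> x)) ^ n"
  have M: "0 \<le> ?M" by (intro prod_nonneg) auto
  have key: "max 1 (cmod (\<sigma> x)) ^ n * cmod (\<sigma> (a 0))
      \<le> (real n + 1) * 4 ^ n * coeff_max \<sigma> ^ (n + 1) * max 1 (cmod (\<sigma> b))" if \<sigma>: "\<sigma> \<in> EK" for \<sigma>
  proof -
    let ?B = "max 1 (cmod (\<sigma> b))"
    define C where "C = (real n + 1) * 4 ^ n * coeff_max \<sigma> ^ (n + 1) * ?B"
    have c: "1 \<le> coeff_max \<sigma>" "cmod (\<sigma> (a 0)) \<le> coeff_max \<sigma>" using coeff_max by auto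
    have c1: "coeff_max \<sigma> \<le> coeff_max \<sigma> ^ (n + 1)" using c(1) by (simp add: power_increasing[of 1, simplified])
    have n4: "1 \<le> (real n + 1) * 4 ^ n"
      using mult_mono[of 1 "real n + 1" 1 "(4::real) ^ n"] by (simp add: one_le_power)
    have "\<sigma> (a 0) * \<sigma> x ^ n = \<sigma> b"
      using arg_cong[OF eq, of \<sigma>] aK[of 0] p(3)
      by (simp add: embedding_mult[OF SK \<sigma>] embedding_power[OF SK \<sigma>] subfield_power[OF SK])
    then have b': "cmod (\<sigma> x) ^ n * cmod (\<sigma> (a 0)) = cmod (\<sigma> b)"
      by (metis mult.commute norm_mult norm_power)
    have C: "coeff_max \<sigma> ^ (n + 1) * ?B \<le> C"
      unfolding C_def mult.assoc[of _ _ ?B] using mult_right_mono[OF n4, of "coeff_max \<sigma> ^ (n + 1) * ?B"] c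
      by simp
    have "cmod (\<sigma> (a 0)) * 1 \<le> coeff_max \<sigma> ^ (n + 1) * ?B"
      using c(1) order_trans[OF c(2) c1] by (intro mult_mono) auto
    then have "cmod (\<sigma> (a 0)) \<le> C" using C by linarith
    moreover have "1 * ?B \<le> coeff_max \<sigma> ^ (n + 1) * ?B"
      by (rule mult_right_mono[OF one_le_power[OF c(1)]]) simp
    then have "cmod (\<sigma> x) ^ n * cmod (\<sigma> (a 0)) \<le> C" using C b' by linarith
    ultimately show ?thesis unfolding C_def[symmetric] by (intro power_max_mult_le) auto
  qed
  have "?M \<le> ?M * (\<Prod>\<sigma>\<in>EK. cmod (\<sigma> (a 0)))"
    using mult_left_mono[OF a0 M] by simp
  also have "\<dots> = (\<Prod>\<sigma>\<in>EK. max 1 (cmod (\<sigma> x)) ^ n * cmod (\<sigma> (a 0)))" by (simp add: prod.distrib)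
  also have "\<dots> \<le> (\<Prod>\<sigma>\<in>EK. (real n + 1) * 4 ^ n * coeff_max \<sigma> ^ (n + 1) * max 1 (cmod (\<sigma> b)))" (is "_ \<le> ?P")
    using key by (intro prod_mono) auto
  also have "\<dots> \<le> ?P * Nb ^ n"
  proof -
    have "0 \<le> ?P" using order_trans[OF zero_le_one coeff_max(1)] by (intro prod_nonneg) auto
    then show ?thesis using mult_left_mono[OF Nb, of ?P] by simp
  qed
  also have "\<dots> = (\<Prod>\<sigma>\<in>EK. local_bound \<sigma>)"
    by (simp add: local_bound_def prod.distrib prod_power_distrib)
  finally show ?thesis .
qed

section \<open>From conjugates to heights\<close>

lemma elem_height_integral:
  assumes "z \<in> ring_of_ints K"
  shows "elem_height K z = (\<Prod>\<sigma>\<in>EK. max 1 (cmod (\<sigma> z))) powr (1 / field_degree \<rat> K)"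
proof -
  have "1 \<in> ring_of_ints K" using SK by (simp add: ring_of_ints_def int_imp_algebraic_int)
  then have "field_height K [1, z] = (\<Prod>\<sigma>\<in>EK. Max ((\<lambda>x. cmod (\<sigma> x)) ` set [1, z]))"
    using assms by (intro field_height_integral[OF K]) auto
  also have "\<dots> = (\<Prod>\<sigma>\<in>EK. max 1 (cmod (\<sigma> z)))"
    by (intro prod.cong) (auto simp: embedding_1[OF SK])
  finally show ?thesis by (simp add: elem_height_def height_def)
qed

lemma set_form_coeffs: "set (form_coeffs n a) = a ` {..n}"
  by (simp add: form_coeffs_def atLeast0LessThan lessThan_Suc_atMost del: upt_Suc)

lemma height_coeffs:
  "height K (1 # form_coeffs n a) = (\<Prod>\<sigma>\<in>EK. coeff_max \<sigma>) powr (1 / field_degree \<rat> K)"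
proof -
  have "1 \<in> ring_of_ints K" using SK by (simp add: ring_of_ints_def int_imp_algebraic_int)
  then have "field_height K (1 # form_coeffs n a) =
      (\<Prod>\<sigma>\<in>EK. Max ((\<lambda>x. cmod (\<sigma> x)) ` set (1 # form_coeffs n a)))"
    using a by (intro field_height_integral[OF K]) (auto simp: set_form_coeffs)
  also have "\<dots> = (\<Prod>\<sigma>\<in>EK. coeff_max \<sigma>)"
    by (intro prod.cong) (auto simp: coeff_max_def set_form_coeffs embedding_1[OF SK] image_image)
  finally show ?thesis by (simp add: height_def)
qed

text \<open>A leading coefficient +-1 has modulus 1 at every embedding, so the extra coordinate of
  \<Gamma> changes no local maximum. Thus H(F) can replace H(\<Gamma>) in cases (i) and
  (ii).\<close>

lemma height_form_coeffs_unit: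
  assumes "a 0 = 1 \<or> a 0 = -1"
  shows "height K (form_coeffs n a) = height K (1 # form_coeffs n a)"
proof -
  have "field_height K (form_coeffs n a) = (\<Prod>\<sigma>\<in>EK. Max ((\<lambda>x. cmod (\<sigma> x)) ` set (form_coeffs n a)))"
    using a assms by (intro field_height_integral[OF K]) (force simp: set_form_coeffs image_iff)+
  also have "\<dots> = (\<Prod>\<sigma>\<in>EK. coeff_max \<sigma>)"
  proof (rule prod.cong[OF refl])
    fix \<sigma> assume \<sigma>: "\<sigma> \<in> EK"
    have "cmod (\<sigma> (a 0)) = 1"
      using assms embedding_1[OF SK \<sigma>] embedding_uminus[OF SK \<sigma>, of 1] SK by auto
    then have "1 \<in> (\<lambda>i. cmod (\<sigma> (a i))) ` {..n}" by force
    then show "Max ((\<lambda>x. cmod (\<sigma> x)) ` set (form_coeffs n a)) = coeff_max \<sigma>"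
      by (simp add: coeff_max_def set_form_coeffs image_image insert_absorb)
  qed
  finally show ?thesis by (simp add: height_coeffs) (simp add: height_def)
qed

lemma one_le_elem_height: "z \<in> ring_of_ints K \<Longrightarrow> 1 \<le> elem_height K z"
  unfolding elem_height_integral by (intro ge_one_powr_ge_zero prod_ge_1) auto

lemma one_le_height_coeffs: "1 \<le> height K (1 # form_coeffs n a)"
  unfolding height_coeffs using coeff_max(1) by (intro ge_one_powr_ge_zero prod_ge_1) auto

lemma cmod_field_norm: "cmod (field_norm K z) = (\<Prod>\<sigma>\<in>EK. cmod (\<sigma> z))"
  by (simp add: field_norm_def prod_norm)

text \<open>The constant 8 is the \<open>n\<close>-th root of the bound (n + 1) 4^n \<le> 2^n 4^n;
  the remaining factors of \<open>local_bound\<close> multiply over the embeddings to powers of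
  heights and of the norm of \<open>b\<close>.\<close>

lemma solution_height_le:
  assumes s: "(x, y) \<in> sols" and z: "z = x \<or> z = y"
  defines "d \<equiv> field_degree \<rat> K"
  shows "elem_height K z \<le> 8 * (elem_height K b powr (1 / n) *
    height K (1 # form_coeffs n a) powr (1 + 1 / n) * cmod (field_norm K b) powr (1 / d))"
proof -
  note p = sols_props[OF s] and E = field_embeddings_finite_card[OF K(1)]
  have zI: "z \<in> ring_of_ints K" using z p by auto
  define P where "P = (\<Prod>\<sigma>\<in>EK. max 1 (cmod (\<sigma> z)))"
  define B where "B = (\<Prod>\<sigma>\<in>EK. max 1 (cmod (\<sigma> b)))"
  define C where "C = (\<Prod>\<sigma>\<in>EK. coeff_max \<sigma>)"
  have d: "d > 0" "card EK \<le> d" using E by (auto simp: d_def)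
  have ge1: "1 \<le> P" "1 \<le> B" "1 \<le> C" "1 \<le> Nb"
    using coeff_max(1) norm_ge_1[OF K(1) b] by (auto simp: P_def B_def C_def intro!: prod_ge_1)
  have lb: "1 \<le> (\<Prod>\<sigma>\<in>EK. local_bound \<sigma>)"
  proof -
    have "(\<Prod>\<sigma>\<in>EK. local_bound \<sigma>) = ((real n + 1) * 4 ^ n) ^ card EK * C ^ (n + 1) * B * Nb ^ n"
      by (simp add: local_bound_def prod.distrib prod_power_distrib B_def C_def power_mult_distrib)
    moreover have "1 \<le> (real n + 1) * 4 ^ n"
      using mult_mono[of 1 "real n + 1" 1 "(4::real) ^ n"] by (simp add: one_le_power)
    then have "1 * 1 * 1 * 1 \<le> ((real n + 1) * 4 ^ n) ^ card EK * C ^ (n + 1) * B * Nb ^ n"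
      using ge1 by (intro mult_mono one_le_power) auto
    ultimately show ?thesis by simp
  qed
  have "P ^ n \<le> (\<Prod>\<sigma>\<in>EK. local_bound \<sigma>)"
  proof (cases "y = 0")
    case True
    show ?thesis
    proof (cases "z = x")
      case True
      then show ?thesis using conjugate_bound_y0 s \<open>y = 0\<close> by (simp add: P_def prod_power_distrib)
    next
      case False
      then have "z = 0" using z True by simp
      then have "P = 1" by (simp add: P_def embedding_0[OF SK])
      then show ?thesis using lb by simp
    qed
  next
    case False
    then show ?thesis using conjugate_bound[OF s False z] by (simp add: P_def prod_power_distrib)
  qed
  also have "\<dots> = ((real n + 1) * 4 ^ n) ^ card EK * C ^ (n + 1) * B * Nb ^ n"
    by (simp add: local_bound_def prod.distrib prod_power_distrib B_def C_def power_mult_distrib)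
  also have "\<dots> \<le> (8 ^ n) ^ d * C ^ (n + 1) * B * Nb ^ n"
  proof -
    have "real n + 1 \<le> 2 ^ n"
      using less_exp[of n] by (metis Suc_leI of_nat_Suc of_nat_le_iff of_nat_numeral of_nat_power add.commute)
    then have "(real n + 1) * 4 ^ n \<le> 2 ^ n * 4 ^ n" by (intro mult_right_mono) auto
    also have "\<dots> = (8::real) ^ n" by (simp flip: power_mult_distrib)
    finally have "((real n + 1) * 4 ^ n) ^ card EK \<le> (8 ^ n) ^ card EK" by (intro power_mono) auto
    also have "\<dots> \<le> (8 ^ n) ^ d" using d(2) by (intro power_increasing) (auto simp: one_le_power)
    finally show ?thesis using ge1 by (intro mult_right_mono) auto
  qed
  finally have main: "P ^ n \<le> (8 ^ n) ^ d * C ^ (n + 1) * B * Nb ^ n" .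
  \<comment> \<open>The exponent combines the \<open>n\<close>-th root with the root by the degree
    in the absolute height.\<close>
  define e where "e = 1 / (real n * real d)"
  have npos: "n > 0" using n by simp
  have "P powr (1 / d) = (P ^ n) powr e"
    using ge1 npos by (simp add: e_def powr_powr flip: powr_realpow)
  also have "\<dots> \<le> ((8 ^ n) ^ d * C ^ (n + 1) * B * Nb ^ n) powr e"
    using main ge1 by (intro powr_mono2) (auto simp: e_def)
  also have "\<dots> = ((8 ^ n) ^ d) powr e * (C ^ (n + 1)) powr e * B powr e * (Nb ^ n) powr e"
    using ge1 by (simp add: powr_mult)
  also have "((8 ^ n) ^ d) powr e = (8::real)"
  proof -
    have "(8 ^ n) ^ d = (8::real) powr (real n * real d)" by (simp add: powr_realpow flip: power_mult of_nat_mult)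
    then show ?thesis using npos d by (simp add: e_def powr_powr)
  qed
  also have "(C ^ (n + 1)) powr e = (C powr (1 / d)) powr (1 + 1 / n)"
  proof -
    have "C ^ (n + 1) = C powr real (n + 1)" using ge1 by (intro powr_realpow[symmetric]) simp
    then show ?thesis using npos d by (simp add: e_def powr_powr field_simps)
  qed
  also have "B powr e = (B powr (1 / d)) powr (1 / n)" by (simp add: e_def powr_powr mult.commute)
  also have "(Nb ^ n) powr e = Nb powr (1 / d)"
    using ge1 npos by (simp add: e_def powr_powr flip: powr_realpow)
  finally show ?thesis
    unfolding elem_height_integral[OF zI] elem_height_integral[OF b(1)] height_coeffs cmod_field_norm
    by (simp add: P_def B_def C_def d_def mult_ac)
qed

end

theorem theorem1:
  fixes K :: "complex set" and d n :: nat and a :: "nat \<Rightarrow> complex" and b \<alpha> :: complex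
  assumes "number_field K" and "totally_real K" and "field_degree \<rat> K = d"
    and "b \<in> ring_of_ints K" and "b \<noteq> 0"
    and "n \<ge> 2" and "\<forall>i\<le>n. a i \<in> ring_of_ints K" and "a 0 \<noteq> 0"
    and "binary_form n a \<alpha> 1 = 0" and "CM_field (adjoin K \<alpha>)"
  shows
    "let N = (\<lambda>z. cmod (field_norm K z));
         H = elem_height K;
         HF = height K (form_coeffs n a);
         H\<Gamma> = height K (1 # form_coeffs n a);
         S = form_solutions K n a b;
         w = card (roots_of_unity (adjoin K \<alpha>))
     in
       (\<forall>(x, y)\<in>S.
          (a 0 \<in> {1, -1} \<and> a n \<in> {1, -1} \<longrightarrow>
             H x < 32 * H b powr (1 / n) * HF powr (1 + 1 / n) * N b powr (2 / d) \<and>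
             H y < 32 * H b powr (1 / n) * HF powr (1 + 1 / n) * N b powr (2 / d)) \<and>
          (a 0 \<in> {1, -1} \<and> a n \<notin> {1, -1} \<longrightarrow>
             H x < 2 ^ 9 * H b powr (1 / n) * HF powr (2 + 1 / n) * N b powr (4 / d) \<and>
             H y < 32 * H b powr (1 / n) * HF powr (1 + 1 / n) * N b powr (2 / d)) \<and>
          (a 0 \<notin> {1, -1} \<and> a n \<notin> {1, -1} \<longrightarrow>
             H x < 2 ^ 9 * H b powr (1 / n) * H\<Gamma> ^ (2 * n + 1) * N b powr (4 / d)
                     * H (a 0) ^ (n - 1) * N (a 0) powr (2 * (real n - 1) / d) \<and>
             H y < 32 * H b powr (1 / n) * H\<Gamma> ^ (n + 1) * N b powr (2 / d)
                     * H (a 0) ^ (n - 1) * N (a 0) powr (2 * (real n - 1) / d))) \<and>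
       finite S \<and>
       real (card S) \<le> 72 * 4 ^ (d * n) * N b ^ (2 * n) \<and>
       (b \<in> Units (complex_ring\<lparr>carrier := ring_of_ints K\<rparr>) \<longrightarrow> card S \<le> 2 * w * n)"
proof -
  interpret cm_thue K n a b \<alpha> using assms by unfold_locales
  let ?d = "field_degree \<rat> K"
  define N where "N = (\<lambda>z. cmod (field_norm K z))"
  define Hb where "Hb = elem_height K b powr (1 / n)"
  define G where "G = height K (1 # form_coeffs n a)"
  define A where "A = elem_height K (a 0) ^ (n - 1) * N (a 0) powr (2 * (real n - 1) / d)"
  have a0: "a 0 \<in> ring_of_ints K" using assms(7) by simp
  have Nge: "1 \<le> N b" "1 \<le> N (a 0)"
    unfolding N_def cmod_field_norm using norm_ge_1[OF K(1)] b a0 assms(8) by auto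
  have Hb: "1 \<le> Hb" unfolding Hb_def using one_le_elem_height[OF b(1)] by (intro ge_one_powr_ge_zero) auto
  have G: "1 \<le> G" unfolding G_def by (rule one_le_height_coeffs)
  have "1 * 1 \<le> A"
    unfolding A_def using one_le_elem_height[OF a0] Nge(2) assms(6)
    by (intro mult_mono one_le_power ge_one_powr_ge_zero) auto
  then have A: "1 \<le> A" by simp
  \<comment> \<open>Each of the stated bounds has a constant of at least 32 against 8, which makes
    the inequality strict, larger powers of quantities that are at least 1, and possibly a further
    factor \<open>q\<close> of at least 1.\<close>
  have bound: "elem_height K z < c * Hb * g * N b powr t * q"
    if "(x, y) \<in> form_solutions K n a b" "z = x \<or> z = y" "32 \<le> c" "G powr (1 + 1 / n) \<le> g" "1 / d \<le> t" "1 \<le> q"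
    for x y z and c g t q :: real
  proof -
    have g: "0 < G powr (1 + 1 / n)" using G by simp
    have nt: "N b powr (1 / d) \<le> N b powr t" "0 < N b powr (1 / d)" using Nge that(5) by (auto intro: powr_mono)
    have "elem_height K z \<le> 8 * (Hb * G powr (1 + 1 / n) * N b powr (1 / d))"
      using solution_height_le[OF that(1,2)] assms(3) by (simp add: Hb_def G_def N_def)
    also have "\<dots> < c * (Hb * G powr (1 + 1 / n) * N b powr (1 / d))"
      using that(3) Hb g nt(2) by (intro mult_strict_right_mono mult_pos_pos) auto
    also have "\<dots> = c * Hb * G powr (1 + 1 / n) * N b powr (1 / d) * 1" by simp
    also have "\<dots> \<le> c * Hb * g * N b powr t * q"
      using that(3,4,6) Hb g nt order_trans[OF less_imp_le[OF g] that(4)]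
      by (intro mult_mono mult_nonneg_nonneg) auto
    finally show ?thesis .
  qed
  have n: "real n \<ge> 2" using assms(6) by simp
  have powG: "G powr (1 + 1 / n) \<le> G powr (2 + 1 / n)" using G by (intro powr_mono) auto
  have powG': "G powr (1 + 1 / n) \<le> G ^ k" if "n + 1 \<le> k" for k
  proof -
    have "1 / real n \<le> 1" using n by simp
    then have "1 + 1 / real n \<le> real k" using that n by linarith
    then have "G powr (1 + 1 / n) \<le> G powr (real k)" using G by (intro powr_mono) auto
    then show ?thesis using G by (simp add: powr_realpow)
  qed
  have HF: "height K (form_coeffs n a) = G" if "a 0 \<in> {1, -1}"
    unfolding G_def using height_form_coeffs_unit that by auto
  have dd: "1 / real d \<le> 2 / real d" "1 / real d \<le> 4 / real d" by (auto simp: divide_right_mono)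
  have heights:
    "(a 0 \<in> {1, -1} \<and> a n \<in> {1, -1} \<longrightarrow>
       elem_height K x < 32 * Hb * height K (form_coeffs n a) powr (1 + 1 / n) * N b powr (2 / d) \<and>
       elem_height K y < 32 * Hb * height K (form_coeffs n a) powr (1 + 1 / n) * N b powr (2 / d)) \<and>
     (a 0 \<in> {1, -1} \<and> a n \<notin> {1, -1} \<longrightarrow>
       elem_height K x < 2 ^ 9 * Hb * height K (form_coeffs n a) powr (2 + 1 / n) * N b powr (4 / d) \<and>
       elem_height K y < 32 * Hb * height K (form_coeffs n a) powr (1 + 1 / n) * N b powr (2 / d)) \<and>
     (a 0 \<notin> {1, -1} \<and> a n \<notin> {1, -1} \<longrightarrow>
       elem_height K x < 2 ^ 9 * Hb * G ^ (2 * n + 1) * N b powr (4 / d)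
         * elem_height K (a 0) ^ (n - 1) * N (a 0) powr (2 * (real n - 1) / d) \<and>
       elem_height K y < 32 * Hb * G ^ (n + 1) * N b powr (2 / d)
         * elem_height K (a 0) ^ (n - 1) * N (a 0) powr (2 * (real n - 1) / d))"
    if s: "(x, y) \<in> form_solutions K n a b" for x y
  proof (intro conjI impI)
    assume "a 0 \<in> {1, -1} \<and> a n \<in> {1, -1}"
    then show "elem_height K x < 32 * Hb * height K (form_coeffs n a) powr (1 + 1 / n) * N b powr (2 / d)"
      "elem_height K y < 32 * Hb * height K (form_coeffs n a) powr (1 + 1 / n) * N b powr (2 / d)"
      using bound[OF s _ _ order_refl dd(1) order_refl, of _ 32] HF by auto
  next
    assume "a 0 \<in> {1, -1} \<and> a n \<notin> {1, -1}"
    then show "elem_height K x < 2 ^ 9 * Hb * height K (form_coeffs n a) powr (2 + 1 / n) * N b powr (4 / d)"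
      "elem_height K y < 32 * Hb * height K (form_coeffs n a) powr (1 + 1 / n) * N b powr (2 / d)"
      using bound[OF s _ _ order_refl dd(1) order_refl, of _ 32] bound[OF s _ _ powG dd(2) order_refl, of _ "2 ^ 9"] HF
      by auto
  next
    show "elem_height K x < 2 ^ 9 * Hb * G ^ (2 * n + 1) * N b powr (4 / d)
         * elem_height K (a 0) ^ (n - 1) * N (a 0) powr (2 * (real n - 1) / d)"
      using bound[OF s _ _ powG' dd(2) A, of x "2 ^ 9" "2 * n + 1"] assms(6) by (simp add: A_def mult.assoc)
    show "elem_height K y < 32 * Hb * G ^ (n + 1) * N b powr (2 / d)
         * elem_height K (a 0) ^ (n - 1) * N (a 0) powr (2 * (real n - 1) / d)"
      using bound[OF s _ _ powG' dd(1) A, of y 32 "n + 1"] by (simp add: A_def mult.assoc)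
  qed
  have card: "real (card (form_solutions K n a b)) \<le> 72 * 4 ^ (d * n) * N b ^ (2 * n)"
  proof -
    have "real (card (form_solutions K n a b)) \<le> 2 * 4 ^ (card EK * n) * N b ^ 2"
      using card_sols_le(2) by (simp add: N_def cmod_field_norm)
    also have "\<dots> \<le> 72 * 4 ^ (d * n) * N b ^ (2 * n)"
      using field_embeddings_finite_card(4)[OF K(1)] assms(3,6) Nge(1)
      by (intro mult_mono power_increasing) auto
    finally show ?thesis .
  qed
  have unit: "card (form_solutions K n a b) \<le> 2 * card (roots_of_unity L) * n"
    if bU: "b \<in> Units (complex_ring\<lparr>carrier := ring_of_ints K\<rparr>)"
  proof -
    obtain c where "c \<in> ring_of_ints K" "b * c = 1" using bU by (auto simp: Units_def)
    then have "card (form_solutions K n a b) \<le> 2 * card (roots_of_unity L)" by (rule card_sols_unit)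
    also have "\<dots> \<le> 2 * card (roots_of_unity L) * n" using assms(6) by simp
    finally show ?thesis .
  qed
  show ?thesis
    unfolding Let_def N_def[symmetric, THEN fun_cong] Hb_def[symmetric] G_def[symmetric]
    using heights card unit card_sols_le(1) by (auto simp: N_def)
qed

end
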